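(* Let $q\in(0,1)$ and let $n\in\{1,2,3,4,5,6,7,8\}$. Let $\mathcal{O}(S_q^{4n-1})$ be the $*$-algebra of the quantum symplectic $(4n-1)$-sphere, with generators $x_1,\dots,x_n,y_1,\dots,y_n$ (and their adjoints). Then the elements $$ (y_1^* )^{m_1}\cdots (y_n^* )^{m_n}(x_1^* )^{k_1}\cdots (x_n^* )^{k_n}\,x_{n-1}^{s_{n-1}}\cdots x_1^{s_1}\,y_n^{t_n}\cdots y_1^{t_1}, $$ $$ (y_1^* )^{m_1}\cdots (y_n^* )^{m_n}(x_1^* )^{k_1}\cdots (x_{n-1}^* )^{k_{n-1}}\,x_n^{s_n}\cdots x_1^{s_1}\,y_n^{t_n}\cdots y_1^{t_1}, $$ where all exponents $m_j,k_j,s_j,t_j$ range over the integers $\geq 0$, form a vector space basis over $\mathbb{C}$ for $\mathcal{O}(S_q^{4n-1})$.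
   Context: All algebras are over $\mathbb{C}$. Conventions: $y_j^0=(y_j^* )^0=x_j^0=(x_j^* )^0=1$. The monomials that occur in both families (those with no factor $x_n$ and no factor $x_n^*$) are counted once. For $q\in(0,1)$ and $n\geq 1$, $\mathcal{O}(S_q^{4n-1})$ is the (unital) $*$-algebra generated by elements $x_1,\dots,x_n,y_1,\dots,y_n$ and their adjoints, subject to the following relations (indices $i,j$ range over $1,\dots,n$; since this is a $*$-algebra, the adjoints of all these relations hold as well): - $x_ix_j=q^{-1}x_jx_i$ for all $i<j$; $\quad y_iy_j=q\,y_jy_i$ for all $j>i$; $\quad y_jx_i=q\,x_iy_j$ for all $i\neq j$; - $y_ix_i=q^{2}x_iy_i+(q^2-1)\sum_{k=1}^{i-1}q^{i-k}x_ky_k$ for all $i$; - $x_ix_i^*=x_i^*x_i+(1-q^2)\sum_{k=1}^{i-1}x_k^*x_k$ for all $i$; - $y_iy_i^*=y_i^*y_i+(1-q^2)\left(q^{2(n+1-i)}x_i^*x_i+\sum_{k=1}^n x_k^*x_k+\sum_{k=i+1}^n y_k^*y_k\right)$ for all $i$; - $x_iy_i^*=q^2y_i^*x_i$ for all $i$; $\quad x_ix_j^*=q\,x_j^*x_i$ for all $i\neq j$; - $y_iy_j^*=q\,y_j^*y_i-(q^2-1)q^{2n+2-i-j}x_i^*x_j$ for all $i\neq j$; - $x_iy_j^*=q\,y_j^*x_i$ for all $i<j$; $\quad x_iy_j^*=q\,y_j^*x_i+(q^2-1)q^{i-j}y_i^*x_j$ for all $i>j$; - the sphere relation $\sum_{i=1}^n(x_i^*x_i+y_i^*y_i)=1$.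 *)

theory Defs
  imports
    "Jordan_Normal_Form.VS_Connect"
    "HOL-Algebra.QuotRing"
    "HOL-Library.Poly_Mapping"
begin

section \<open>Free unital complex \<open>*\<close>-algebra on \<open>x\<^sub>1,\<dots>,x\<^sub>n,y\<^sub>1,\<dots>,y\<^sub>n\<close>\<close>

datatype letter = LX nat | LY nat | LXadj nat | LYadj nat

primrec letter_index :: "letter \<Rightarrow> nat" where
  "letter_index (LX i) = i"
| "letter_index (LY i) = i"
| "letter_index (LXadj i) = i"
| "letter_index (LYadj i) = i"

primrec letter_adj :: "letter \<Rightarrow> letter" where
  "letter_adj (LX i) = LXadj i"
| "letter_adj (LY i) = LYadj i"
| "letter_adj (LXadj i) = LX i"
| "letter_adj (LYadj i) = LY i"

text \<open>The free monoid is written additively, so that \<open>free_monoid \<Rightarrow>\<^sub>0 complex\<close>, whose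
  multiplication is convolution, is its monoid algebra.\<close>

datatype free_monoid = Word (letters: "letter list")

instantiation free_monoid :: monoid_add
begin

definition zero_free_monoid :: free_monoid where
  "0 = Word []"

definition plus_free_monoid :: "free_monoid \<Rightarrow> free_monoid \<Rightarrow> free_monoid" where
  "u + v = Word (letters u @ letters v)"

instance
  by standard (simp_all add: zero_free_monoid_def plus_free_monoid_def)

end

type_synonym free_alg = "free_monoid \<Rightarrow>\<^sub>0 complex"

definition fscale :: "complex \<Rightarrow> free_alg \<Rightarrow> free_alg"  (infixr \<open>\<cdot>\<^sub>f\<close> 75) where
  "c \<cdot>\<^sub>f a = Poly_Mapping.single 0 c * a"

definition word_adj :: "free_monoid \<Rightarrow> free_monoid" where
  "word_adj w = Word (rev (map letter_adj (letters w)))"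

text \<open>The antilinear antimultiplicative involution.\<close>

definition adj :: "free_alg \<Rightarrow> free_alg" where
  "adj a = (\<Sum>w\<in>Poly_Mapping.keys a.
      Poly_Mapping.single (word_adj w) (cnj (Poly_Mapping.lookup a w)))"

definition gx :: "nat \<Rightarrow> free_alg" where
  "gx i = Poly_Mapping.single (Word [LX i]) 1"

definition gy :: "nat \<Rightarrow> free_alg" where
  "gy i = Poly_Mapping.single (Word [LY i]) 1"

definition gxs :: "nat \<Rightarrow> free_alg" where
  "gxs i = adj (gx i)"

definition gys :: "nat \<Rightarrow> free_alg" where
  "gys i = adj (gy i)"

text \<open>Letters of arbitrary index exist in the type; \<open>free_ring n\<close> is the subalgebra on those
  with index in \<open>{1..n}\<close>.\<close>

definition free_ring :: "nat \<Rightarrow> free_alg ring" where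
  "free_ring n = \<lparr>carrier = {a. \<forall>w\<in>Poly_Mapping.keys a. letter_index ` set (letters w) \<subseteq> {1..n}},
     mult = (*), one = 1, zero = 0, add = (+)\<rparr>"


section \<open>The algebra \<open>\<O>(S\<^sub>q\<^bsup>4n-1\<^esup>)\<close>\<close>

text \<open>Each relation \<open>l = r\<close> is represented by \<open>l - r\<close>.\<close>

definition sphere_relators :: "real \<Rightarrow> nat \<Rightarrow> free_alg set" where
  "sphere_relators q n = (let Q = complex_of_real q in
     {gx i * gx j - inverse Q \<cdot>\<^sub>f (gx j * gx i) | i j. i \<in> {1..n} \<and> j \<in> {1..n} \<and> i < j}
   \<union> {gy i * gy j - Q \<cdot>\<^sub>f (gy j * gy i) | i j. i \<in> {1..n} \<and> j \<in> {1..n} \<and> j > i}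
   \<union> {gy j * gx i - Q \<cdot>\<^sub>f (gx i * gy j) | i j. i \<in> {1..n} \<and> j \<in> {1..n} \<and> i \<noteq> j}
   \<union> {gy i * gx i - (Q^2 \<cdot>\<^sub>f (gx i * gy i)
        + (Q^2 - 1) \<cdot>\<^sub>f (\<Sum>k\<in>{1..<i}. Q^(i-k) \<cdot>\<^sub>f (gx k * gy k))) | i. i \<in> {1..n}}
   \<union> {gx i * gxs i - (gxs i * gx i + (1 - Q^2) \<cdot>\<^sub>f (\<Sum>k\<in>{1..<i}. gxs k * gx k)) | i. i \<in> {1..n}}
   \<union> {gy i * gys i - (gys i * gy i + (1 - Q^2) \<cdot>\<^sub>f
        (Q^(2*(n+1-i)) \<cdot>\<^sub>f (gxs i * gx i) + (\<Sum>k\<in>{1..n}. gxs k * gx k)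
         + (\<Sum>k\<in>{i+1..n}. gys k * gy k))) | i. i \<in> {1..n}}
   \<union> {gx i * gys i - Q^2 \<cdot>\<^sub>f (gys i * gx i) | i. i \<in> {1..n}}
   \<union> {gx i * gxs j - Q \<cdot>\<^sub>f (gxs j * gx i) | i j. i \<in> {1..n} \<and> j \<in> {1..n} \<and> i \<noteq> j}
   \<union> {gy i * gys j - (Q \<cdot>\<^sub>f (gys j * gy i) - ((Q^2 - 1) * Q^(2*n+2-i-j)) \<cdot>\<^sub>f (gxs i * gx j))
        | i j. i \<in> {1..n} \<and> j \<in> {1..n} \<and> i \<noteq> j}
   \<union> {gx i * gys j - Q \<cdot>\<^sub>f (gys j * gx i) | i j. i \<in> {1..n} \<and> j \<in> {1..n} \<and> i < j}
   \<union> {gx i * gys j - (Q \<cdot>\<^sub>f (gys j * gx i) + ((Q^2 - 1) * Q^(i-j)) \<cdot>\<^sub>f (gys i * gx j))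
        | i j. i \<in> {1..n} \<and> j \<in> {1..n} \<and> i > j}
   \<union> {(\<Sum>i\<in>{1..n}. gxs i * gx i + gys i * gy i) - 1})"

text \<open>A two-sided ideal of a unital algebra is closed under scalars, so the ring ideal generated by
  the relators and their adjoints is the \<open>*\<close>-ideal generated by the relators.\<close>

definition sphere_ideal :: "real \<Rightarrow> nat \<Rightarrow> free_alg set" where
  "sphere_ideal q n =
     genideal (free_ring n) (sphere_relators q n \<union> adj ` sphere_relators q n)"

definition sphere_class :: "real \<Rightarrow> nat \<Rightarrow> free_alg \<Rightarrow> free_alg set" where
  "sphere_class q n a = sphere_ideal q n +>\<^bsub>free_ring n\<^esub> a"

definition sphere_alg :: "real \<Rightarrow> nat \<Rightarrow> (complex, free_alg set) module" where
  "sphere_alg q n = (let A = free_ring n Quot sphere_ideal q n in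
     \<lparr>carrier = carrier A, mult = mult A, one = one A, zero = zero A, add = add A,
      smult = (\<lambda>c S. \<Union>a\<in>S. sphere_class q n (c \<cdot>\<^sub>f a))\<rparr>)"

definition sphere_adj :: "real \<Rightarrow> nat \<Rightarrow> free_alg set \<Rightarrow> free_alg set" where
  "sphere_adj q n S = (\<Union>a\<in>S. sphere_class q n (adj a))"

subsection \<open>The quotient is a complex \<open>*\<close>-algebra\<close>

lemma letter_adj_adj [simp]: "letter_adj (letter_adj l) = l"
  by (cases l) simp_all

lemma letter_index_adj [simp]: "letter_index (letter_adj l) = letter_index l"
  by (cases l) simp_all

lemma word_adj_adj [simp]: "word_adj (word_adj w) = w"
  by (simp add: word_adj_def rev_map comp_def)

lemma word_adj_plus: "word_adj (u + v) = word_adj v + word_adj u"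
  by (simp add: word_adj_def plus_free_monoid_def)

lemma lookup_adj: "Poly_Mapping.lookup (adj a) w = cnj (Poly_Mapping.lookup a (word_adj w))"
proof -
  have "Poly_Mapping.lookup (adj a) w =
      (\<Sum>v\<in>Poly_Mapping.keys a. if v = word_adj w then cnj (Poly_Mapping.lookup a v) else 0)"
    unfolding adj_def lookup_sum lookup_single
    by (intro sum.cong refl) (auto simp: when_def)
  also have "\<dots> = cnj (Poly_Mapping.lookup a (word_adj w))"
    by (simp add: in_keys_iff)
  finally show ?thesis .
qed

lemma adj_adj [simp]: "adj (adj a) = a"
  by (rule poly_mapping_eqI) (simp add: lookup_adj)

lemma adj_zero [simp]: "adj 0 = 0"
  by (rule poly_mapping_eqI) (simp add: lookup_adj)

lemma adj_plus: "adj (a + b) = adj a + adj b"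
  by (rule poly_mapping_eqI) (simp add: lookup_adj lookup_add)

lemma adj_minus: "adj (a - b) = adj a - adj b"
  by (rule poly_mapping_eqI) (simp add: lookup_adj lookup_minus)

lemma adj_single: "adj (Poly_Mapping.single w c) = Poly_Mapping.single (word_adj w) (cnj c)"
  by (rule poly_mapping_eqI)
    (metis (no_types, lifting) lookup_adj lookup_single_eq lookup_single_not_eq complex_cnj_zero word_adj_adj)

lemma free_alg_induct [case_names zero single plus]:
  fixes a :: free_alg
  assumes "P 0" "\<And>w c. P (Poly_Mapping.single w c)" "\<And>a b. P a \<Longrightarrow> P b \<Longrightarrow> P (a + b)"
  shows "P a"
proof (induction a rule: update_induct)
  case const
  then show ?case by (rule assms)
next
  case (update f w c)
  have "Poly_Mapping.update w c f = Poly_Mapping.single w c + f"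
    by (rule poly_mapping_eqI)
      (use update.hyps in \<open>auto simp: lookup_update lookup_add lookup_single in_keys_iff when_def\<close>)
  then show ?case using assms update.IH by simp
qed

lemma adj_mult: "adj (a * b) = adj b * adj a"
proof (induction a rule: free_alg_induct)
  case (single u c)
  then show ?case
  proof (induction b rule: free_alg_induct)
    case (single v d)
    then show ?case by (simp add: mult_single adj_single word_adj_plus mult.commute)
  qed (simp_all add: adj_plus algebra_simps)
qed (simp_all add: adj_plus algebra_simps)

lemma adj_fscale: "adj (c \<cdot>\<^sub>f a) = cnj c \<cdot>\<^sub>f adj a"
proof -
  have "word_adj 0 = 0" by (simp add: word_adj_def zero_free_monoid_def)
  moreover have "Poly_Mapping.single 0 d * b = b * Poly_Mapping.single 0 d"
    for d :: complex and b :: free_alg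
    by (induction b rule: free_alg_induct) (simp_all add: mult_single algebra_simps)
  ultimately show ?thesis
    by (simp add: fscale_def adj_mult adj_single)
qed

lemma free_ring_sel [simp]:
  "mult (free_ring n) = (*)" "one (free_ring n) = 1"
  "zero (free_ring n) = 0" "add (free_ring n) = (+)"
  by (simp_all add: free_ring_def)

lemma mem_free_ring:
  "a \<in> carrier (free_ring n) \<longleftrightarrow>
     (\<forall>w\<in>Poly_Mapping.keys a. letter_index ` set (letters w) \<subseteq> {1..n})"
  by (simp add: free_ring_def)

lemma free_ring_closed:
  "0 \<in> carrier (free_ring n)" "1 \<in> carrier (free_ring n)"
  "a \<in> carrier (free_ring n) \<Longrightarrow> b \<in> carrier (free_ring n) \<Longrightarrow> a + b \<in> carrier (free_ring n)"
  "a \<in> carrier (free_ring n) \<Longrightarrow> b \<in> carrier (free_ring n) \<Longrightarrow> a * b \<in> carrier (free_ring n)"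
  "a \<in> carrier (free_ring n) \<Longrightarrow> - a \<in> carrier (free_ring n)"
  "a \<in> carrier (free_ring n) \<Longrightarrow> b \<in> carrier (free_ring n) \<Longrightarrow> a - b \<in> carrier (free_ring n)"
  "a \<in> carrier (free_ring n) \<Longrightarrow> c \<cdot>\<^sub>f a \<in> carrier (free_ring n)"
  "(\<And>k. k \<in> K \<Longrightarrow> f k \<in> carrier (free_ring n)) \<Longrightarrow> sum f K \<in> carrier (free_ring n)"
  "a \<in> carrier (free_ring n) \<Longrightarrow> adj a \<in> carrier (free_ring n)"
  "i \<in> {1..n} \<Longrightarrow> gx i \<in> carrier (free_ring n)"
  "i \<in> {1..n} \<Longrightarrow> gy i \<in> carrier (free_ring n)"
  "i \<in> {1..n} \<Longrightarrow> gxs i \<in> carrier (free_ring n)"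
  "i \<in> {1..n} \<Longrightarrow> gys i \<in> carrier (free_ring n)"
proof -
  show 0: "0 \<in> carrier (free_ring n)" by (simp add: mem_free_ring)
  show "1 \<in> carrier (free_ring n)" by (simp add: mem_free_ring zero_free_monoid_def)
  show add: "a + b \<in> carrier (free_ring n)"
    if "a \<in> carrier (free_ring n)" "b \<in> carrier (free_ring n)" for a b
    using that keys_add[of a b] unfolding mem_free_ring by blast
  show mul: "a * b \<in> carrier (free_ring n)"
    if "a \<in> carrier (free_ring n)" "b \<in> carrier (free_ring n)" for a b
    unfolding mem_free_ring
  proof
    fix w assume "w \<in> Poly_Mapping.keys (a * b)"
    with keys_mult[of a b] obtain u v
      where "w = u + v" "u \<in> Poly_Mapping.keys a" "v \<in> Poly_Mapping.keys b" by blast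
    with that show "letter_index ` set (letters w) \<subseteq> {1..n}"
      by (auto simp: mem_free_ring plus_free_monoid_def image_Un)
  qed
  show uminus: "- a \<in> carrier (free_ring n)" if "a \<in> carrier (free_ring n)" for a
    using that by (simp add: mem_free_ring in_keys_iff)
  show "a - b \<in> carrier (free_ring n)"
    if "a \<in> carrier (free_ring n)" "b \<in> carrier (free_ring n)" for a b
    using add[OF that(1) uminus[OF that(2)]] by simp
  have "Poly_Mapping.single 0 c \<in> carrier (free_ring n)" for c
    by (auto simp: mem_free_ring zero_free_monoid_def)
  then show "c \<cdot>\<^sub>f a \<in> carrier (free_ring n)" if "a \<in> carrier (free_ring n)" for a c
    using that by (simp add: fscale_def mul)
  show "sum f K \<in> carrier (free_ring n)" if "\<And>k. k \<in> K \<Longrightarrow> f k \<in> carrier (free_ring n)" for f K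
    using that by (induction K rule: infinite_finite_induct) (auto intro: 0 add)
  show adj: "adj a \<in> carrier (free_ring n)" if "a \<in> carrier (free_ring n)" for a
    unfolding mem_free_ring
  proof
    fix w assume "w \<in> Poly_Mapping.keys (adj a)"
    then have "word_adj w \<in> Poly_Mapping.keys a" by (simp add: in_keys_iff lookup_adj)
    with that have "letter_index ` set (letters (word_adj w)) \<subseteq> {1..n}"
      by (simp add: mem_free_ring)
    then show "letter_index ` set (letters w) \<subseteq> {1..n}"
      by (simp add: word_adj_def image_image)
  qed
  show x: "gx i \<in> carrier (free_ring n)" if "i \<in> {1..n}" for i
    using that by (auto simp: mem_free_ring gx_def)
  show y: "gy i \<in> carrier (free_ring n)" if "i \<in> {1..n}" for i
    using that by (auto simp: mem_free_ring gy_def)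
  show "gxs i \<in> carrier (free_ring n)" if "i \<in> {1..n}" for i
    using that by (simp add: gxs_def adj x)
  show "gys i \<in> carrier (free_ring n)" if "i \<in> {1..n}" for i
    using that by (simp add: gys_def adj y)
qed

lemma ring_free_ring: "ring (free_ring n)"
proof (rule ringI)
  show "abelian_group (free_ring n)"
  proof (rule abelian_groupI)
    fix a assume "a \<in> carrier (free_ring n)"
    then show "\<exists>b\<in>carrier (free_ring n). b \<oplus>\<^bsub>free_ring n\<^esub> a = \<zero>\<^bsub>free_ring n\<^esub>"
      by (intro bexI[of _ "- a"]) (simp_all add: free_ring_closed)
  qed (simp_all add: free_ring_closed algebra_simps)
  show "Group.monoid (free_ring n)"
    by (rule monoidI) (simp_all add: free_ring_closed mult.assoc)
qed (simp_all add: algebra_simps)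

lemma sphere_relators_closed: "sphere_relators q n \<subseteq> carrier (free_ring n)"
  unfolding sphere_relators_def Let_def
  by (intro Un_least subsetI) (auto intro!: free_ring_closed)

lemma ideal_sphere_ideal: "ideal (sphere_ideal q n) (free_ring n)"
  unfolding sphere_ideal_def
  using sphere_relators_closed
  by (intro ring.genideal_ideal[OF ring_free_ring]) (auto intro: free_ring_closed)

lemma adj_sphere_ideal:
  assumes "a \<in> sphere_ideal q n"
  shows "adj a \<in> sphere_ideal q n"
proof -
  let ?R = "free_ring n" and ?S = "sphere_relators q n \<union> adj ` sphere_relators q n"
  interpret R: ring ?R by (rule ring_free_ring)
  interpret I: ideal "sphere_ideal q n" ?R by (rule ideal_sphere_ideal)
  have S: "?S \<subseteq> carrier ?R"
    using sphere_relators_closed by (auto intro: free_ring_closed)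
  have sub: "?S \<subseteq> sphere_ideal q n"
    unfolding sphere_ideal_def using R.genideal_self[OF S] .
  let ?J = "{b \<in> carrier ?R. adj b \<in> sphere_ideal q n}"
  have zero: "0 \<in> sphere_ideal q n" using I.zero_closed by simp
  have plus: "u + v \<in> sphere_ideal q n" if "u \<in> sphere_ideal q n" "v \<in> sphere_ideal q n" for u v
    using I.a_closed[OF that] by simp
  have l: "u * v \<in> sphere_ideal q n" if "v \<in> sphere_ideal q n" "u \<in> carrier ?R" for u v
    using I.I_l_closed[OF that] by simp
  have r: "v * u \<in> sphere_ideal q n" if "v \<in> sphere_ideal q n" "u \<in> carrier ?R" for u v
    using I.I_r_closed[OF that] by simp
  have inv: "\<ominus>\<^bsub>?R\<^esub> b = - b" if "b \<in> carrier ?R" for b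
    by (rule R.minus_equality[symmetric, THEN sym]) (simp_all add: that free_ring_closed)
  have neg: "adj (- b) = - adj b" for b
    using adj_minus[of 0 b] by simp
  have "ideal ?J ?R"
  proof (rule idealI[OF ring_free_ring])
    show "subgroup ?J (add_monoid ?R)"
    proof (rule group.subgroupI[OF R.a_group])
      show "?J \<noteq> {}" using zero free_ring_closed(1) by force
      fix b assume b: "b \<in> ?J"
      then have "- adj b \<in> sphere_ideal q n"
        using l[of "adj b" "- 1"] by (simp add: free_ring_closed)
      with b show "inv\<^bsub>add_monoid ?R\<^esub> b \<in> ?J"
        using inv[of b] by (simp add: a_inv_def neg free_ring_closed)
    qed (auto simp: adj_plus intro: free_ring_closed plus)
  qed (auto simp: adj_mult intro: free_ring_closed l r)
  moreover have "?S \<subseteq> ?J"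
    using S sub by auto
  ultimately have "sphere_ideal q n \<subseteq> ?J"
    unfolding sphere_ideal_def by (rule R.genideal_minimal)
  with assms show ?thesis by blast
qed

lemma sphere_class_eq_iff:
  assumes "a \<in> carrier (free_ring n)" "b \<in> carrier (free_ring n)"
  shows "sphere_class q n a = sphere_class q n b \<longleftrightarrow> a - b \<in> sphere_ideal q n"
proof -
  interpret R: ring "free_ring n" by (rule ring_free_ring)
  have inv: "\<ominus>\<^bsub>free_ring n\<^esub> b = - b"
    using assms by (intro R.minus_equality) (simp_all add: free_ring_closed)
  show ?thesis
    unfolding sphere_class_def
    using R.quotient_eq_iff_same_a_r_cos[OF ideal_sphere_ideal assms]
    by (auto simp: a_minus_def inv)
qed

lemma mem_sphere_class:
  assumes "b \<in> sphere_class q n a" "a \<in> carrier (free_ring n)"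
  shows "b \<in> carrier (free_ring n)" "b - a \<in> sphere_ideal q n"
proof -
  interpret I: ideal "sphere_ideal q n" "free_ring n" by (rule ideal_sphere_ideal)
  from assms(1) obtain h where "h \<in> sphere_ideal q n" "b = h + a"
    by (auto simp: sphere_class_def a_r_coset_def')
  with assms(2) I.a_Hcarr show "b \<in> carrier (free_ring n)" "b - a \<in> sphere_ideal q n"
    by (auto intro: free_ring_closed)
qed

lemma self_mem_sphere_class: "a \<in> carrier (free_ring n) \<Longrightarrow> a \<in> sphere_class q n a"
proof -
  interpret I: ideal "sphere_ideal q n" "free_ring n" by (rule ideal_sphere_ideal)
  assume "a \<in> carrier (free_ring n)"
  then show ?thesis unfolding sphere_class_def by (rule I.a_rcos_self)
qed

lemma fscale_sphere_ideal: "a \<in> sphere_ideal q n \<Longrightarrow> c \<cdot>\<^sub>f a \<in> sphere_ideal q n"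
proof -
  interpret I: ideal "sphere_ideal q n" "free_ring n" by (rule ideal_sphere_ideal)
  assume "a \<in> sphere_ideal q n"
  moreover have "c \<cdot>\<^sub>f 1 \<in> carrier (free_ring n)" by (intro free_ring_closed)
  ultimately show ?thesis using I.I_l_closed by (fastforce simp: fscale_def)
qed

lemma sphere_alg_class:
  assumes "a \<in> carrier (free_ring n)"
  shows "b \<in> carrier (free_ring n) \<Longrightarrow>
      mult (sphere_alg q n) (sphere_class q n a) (sphere_class q n b) = sphere_class q n (a * b)"
    and "b \<in> carrier (free_ring n) \<Longrightarrow>
      add (sphere_alg q n) (sphere_class q n a) (sphere_class q n b) = sphere_class q n (a + b)"
    and "smult (sphere_alg q n) c (sphere_class q n a) = sphere_class q n (c \<cdot>\<^sub>f a)"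
    and "sphere_adj q n (sphere_class q n a) = sphere_class q n (adj a)"
proof -
  interpret I: ideal "sphere_ideal q n" "free_ring n" by (rule ideal_sphere_ideal)
  show "mult (sphere_alg q n) (sphere_class q n a) (sphere_class q n b) = sphere_class q n (a * b)"
    if "b \<in> carrier (free_ring n)"
    using I.rcoset_mult_add[OF assms that]
    by (simp add: sphere_alg_def sphere_class_def FactRing_def Let_def)
  show "add (sphere_alg q n) (sphere_class q n a) (sphere_class q n b) = sphere_class q n (a + b)"
    if "b \<in> carrier (free_ring n)"
    using I.a_rcos_sum[OF assms that]
    by (simp add: sphere_alg_def sphere_class_def FactRing_def Let_def)
  have sc: "d \<cdot>\<^sub>f u - d \<cdot>\<^sub>f v = d \<cdot>\<^sub>f (u - v)" for d u v
    by (simp add: fscale_def algebra_simps)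
  have "sphere_class q n (c \<cdot>\<^sub>f u) = sphere_class q n (c \<cdot>\<^sub>f a)" if "u \<in> sphere_class q n a" for u
    using mem_sphere_class[OF that assms] assms
    by (subst sphere_class_eq_iff) (auto simp: sc intro: free_ring_closed fscale_sphere_ideal)
  then show "smult (sphere_alg q n) c (sphere_class q n a) = sphere_class q n (c \<cdot>\<^sub>f a)"
    unfolding sphere_alg_def Let_def module.simps
    using self_mem_sphere_class[OF assms] by (intro SUP_eq_const) blast+
  have "sphere_class q n (adj u) = sphere_class q n (adj a)" if "u \<in> sphere_class q n a" for u
    using mem_sphere_class[OF that assms] assms
    by (subst sphere_class_eq_iff)
      (simp_all add: free_ring_closed(9) adj_sphere_ideal flip: adj_minus)
  then show "sphere_adj q n (sphere_class q n a) = sphere_class q n (adj a)"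
    unfolding sphere_adj_def
    using self_mem_sphere_class[OF assms] by (intro SUP_eq_const) blast+
qed

lemma carrier_sphere_alg: "carrier (sphere_alg q n) = sphere_class q n ` carrier (free_ring n)"
  by (auto simp: sphere_alg_def FactRing_def Let_def sphere_class_def A_RCOSETS_def')

lemma ring_sphere_alg: "ring (sphere_alg q n)"
proof -
  interpret Q: ring "free_ring n Quot sphere_ideal q n"
    by (rule ideal.quotient_is_ring[OF ideal_sphere_ideal])
  show ?thesis
  proof (rule ringI)
    show "abelian_group (sphere_alg q n)"
    proof (rule abelian_groupI)
      fix u v w
      assume "u \<in> carrier (sphere_alg q n)" "v \<in> carrier (sphere_alg q n)"
        "w \<in> carrier (sphere_alg q n)"
      then show "(u \<oplus>\<^bsub>sphere_alg q n\<^esub> v) \<oplus>\<^bsub>sphere_alg q n\<^esub> w =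
          u \<oplus>\<^bsub>sphere_alg q n\<^esub> (v \<oplus>\<^bsub>sphere_alg q n\<^esub> w)"
        using Q.a_assoc by (simp add: sphere_alg_def Let_def)
    next
      fix u v
      assume "u \<in> carrier (sphere_alg q n)" "v \<in> carrier (sphere_alg q n)"
      then show "u \<oplus>\<^bsub>sphere_alg q n\<^esub> v = v \<oplus>\<^bsub>sphere_alg q n\<^esub> u"
        using Q.a_comm by (simp add: sphere_alg_def Let_def)
    next
      fix u
      assume "u \<in> carrier (sphere_alg q n)"
      then show "\<exists>v\<in>carrier (sphere_alg q n). v \<oplus>\<^bsub>sphere_alg q n\<^esub> u = \<zero>\<^bsub>sphere_alg q n\<^esub>"
        using Q.l_neg Q.a_inv_closed by (auto simp: sphere_alg_def Let_def)
    qed (simp_all add: sphere_alg_def Let_def)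
    show "Group.monoid (sphere_alg q n)"
      by (rule monoidI) (simp_all add: sphere_alg_def Let_def Q.m_assoc)
  qed (simp_all add: sphere_alg_def Let_def Q.l_distr Q.r_distr)
qed

lemma vectorspace_sphere_alg: "vectorspace class_ring (sphere_alg q n)"
proof -
  interpret A: ring "sphere_alg q n" by (rule ring_sphere_alg)
  have fscale: "(c + d) \<cdot>\<^sub>f a = c \<cdot>\<^sub>f a + d \<cdot>\<^sub>f a" "c \<cdot>\<^sub>f (a + b) = c \<cdot>\<^sub>f a + c \<cdot>\<^sub>f b"
    "(c * d) \<cdot>\<^sub>f a = c \<cdot>\<^sub>f d \<cdot>\<^sub>f a" "1 \<cdot>\<^sub>f a = a" for a b c d
    by (simp_all add: fscale_def single_add distrib_left distrib_right mult_single mult.assoc[symmetric])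
  note simps = carrier_sphere_alg sphere_alg_class free_ring_closed(3,7)
  have "module class_ring (sphere_alg q n)"
  proof (rule moduleI)
    show "cring (class_ring :: complex ring)" by (rule class_cring.cring_axioms)
    show "abelian_group (sphere_alg q n)" by (rule A.abelian_group_axioms)
    fix c d :: complex and u v
    assume "u \<in> carrier (sphere_alg q n)"
    then obtain a where a: "a \<in> carrier (free_ring n)" "u = sphere_class q n a"
      by (auto simp: carrier_sphere_alg)
    show "c \<odot>\<^bsub>sphere_alg q n\<^esub> u \<in> carrier (sphere_alg q n)"
      using a by (simp add: simps)
    show "\<one>\<^bsub>class_ring\<^esub> \<odot>\<^bsub>sphere_alg q n\<^esub> u = u"
      using a by (simp add: simps fscale(4))
    show "(c \<oplus>\<^bsub>class_ring\<^esub> d) \<odot>\<^bsub>sphere_alg q n\<^esub> u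
        = c \<odot>\<^bsub>sphere_alg q n\<^esub> u \<oplus>\<^bsub>sphere_alg q n\<^esub> d \<odot>\<^bsub>sphere_alg q n\<^esub> u"
      using a by (simp add: simps fscale(1))
    show "(c \<otimes>\<^bsub>class_ring\<^esub> d) \<odot>\<^bsub>sphere_alg q n\<^esub> u
        = c \<odot>\<^bsub>sphere_alg q n\<^esub> (d \<odot>\<^bsub>sphere_alg q n\<^esub> u)"
      using a by (simp add: simps fscale(3))
    assume "v \<in> carrier (sphere_alg q n)"
    then obtain b where b: "b \<in> carrier (free_ring n)" "v = sphere_class q n b"
      by (auto simp: carrier_sphere_alg)
    show "c \<odot>\<^bsub>sphere_alg q n\<^esub> (u \<oplus>\<^bsub>sphere_alg q n\<^esub> v)
        = c \<odot>\<^bsub>sphere_alg q n\<^esub> u \<oplus>\<^bsub>sphere_alg q n\<^esub> c \<odot>\<^bsub>sphere_alg q n\<^esub> v"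
      using a b by (simp add: simps fscale(2))
  qed
  then show ?thesis
    using class_field by (simp add: vectorspace_def)
qed


section \<open>Monomials\<close>

definition monomial1 ::
  "nat \<Rightarrow> (nat \<Rightarrow> nat) \<Rightarrow> (nat \<Rightarrow> nat) \<Rightarrow> (nat \<Rightarrow> nat) \<Rightarrow> (nat \<Rightarrow> nat) \<Rightarrow> free_alg" where
  "monomial1 n m k s t =
     prod_list (map (\<lambda>j. gys j ^ m j) [1..<n+1]) * prod_list (map (\<lambda>j. gxs j ^ k j) [1..<n+1])
   * prod_list (map (\<lambda>j. gx j ^ s j) (rev [1..<n])) * prod_list (map (\<lambda>j. gy j ^ t j) (rev [1..<n+1]))"

definition monomial2 ::
  "nat \<Rightarrow> (nat \<Rightarrow> nat) \<Rightarrow> (nat \<Rightarrow> nat) \<Rightarrow> (nat \<Rightarrow> nat) \<Rightarrow> (nat \<Rightarrow> nat) \<Rightarrow> free_alg" where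
  "monomial2 n m k s t =
     prod_list (map (\<lambda>j. gys j ^ m j) [1..<n+1]) * prod_list (map (\<lambda>j. gxs j ^ k j) [1..<n])
   * prod_list (map (\<lambda>j. gx j ^ s j) (rev [1..<n+1])) * prod_list (map (\<lambda>j. gy j ^ t j) (rev [1..<n+1]))"

text \<open>Different exponents (at the indices that occur) give different words, so this set counts a
  monomial twice neither within a family nor across the two.\<close>

definition monomials :: "nat \<Rightarrow> free_alg set" where
  "monomials n = {monomial1 n m k s t | m k s t. True} \<union> {monomial2 n m k s t | m k s t. True}"

end

theory Submission
  imports Defs
begin

text \<open>Put \<open>z\<^sub>i = x\<^sub>i\<close>, \<open>z\<^bsub>2n+1-i\<^esub> = y\<^sub>i\<close>, \<open>w\<^sub>i = q\<^sup>i y\<^sub>i\<^sup>*\<close> and \<open>w\<^bsub>2n+1-i\<^esub> = - q\<^bsup>2n+2-i\<^esup> x\<^sub>i\<^sup>*\<close>. The \<open>z\<^sub>a\<close>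
  and the \<open>w\<^sub>a\<close> then generate two copies of one quantum symplectic space, and the mixed relations
  straighten \<open>z\<^sub>a w\<^sub>c\<close> by a multiple of the symplectic R-matrix. Yang-Baxter type identities make this
  compatible with the relations inside both copies, so that without the sphere relation the algebra
  is a braided tensor product. Each factor embeds into a quantum torus by
  \<open>y\<^sub>i = q\<^sup>i x\<^sub>i\<^sup>-\<^sup>1 (\<omega>\<^sub>i - \<omega>\<^bsub>i-1\<^esub>)\<close>, where ordered monomials have distinct leading terms. The sphere
  element \<open>c = \<Sum>\<^sub>i (x\<^sub>i\<^sup>* x\<^sub>i + y\<^sub>i\<^sup>* y\<^sub>i)\<close> is central, and for a suitable weight the leading term of \<open>c m\<close> is
  that of \<open>x\<^sub>n\<^sup>* x\<^sub>n m\<close>. Hence a nonzero element of the ideal of \<open>c - 1\<close> has a leading term that no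
  combination of monomials free of \<open>x\<^sub>n\<^sup>* x\<^sub>n\<close> can have.\<close>

section \<open>The braiding of two quantum symplectic spaces\<close>

text \<open>Checking confluence of a rewriting system directly would mean resolving overlaps of four
  kinds of letters with every coincidence of indices, and those with the sphere relation on top.
  Instead, w_a is \<open>wt a\<close> times the adjoint of z_{bar a}, and
  \<open>wt a * wt (bar a)\<close> is the constant \<open>- (Q ^ (2 * n + 2))\<close>. One formula,
  \<open>cross\<close>, then covers all mixed relations, and up to a scalar c is the symplectic
  pairing, the sum of \<open>wt a\<close> w_{bar a} z_a, whence its centrality. The work is done
  dually: no tensor product of quotients is built, but the free algebra acts on functions of two
  index words that respect the relations of each copy (\<open>good\<close>). Spanning needs only
  termination of the rewriting; independence comes from leading terms. The torus arises because
  every omega_i commutes with each x_j up to a power of q, whereas y_i x_i involves a whole sum.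
  Centrality of c puts every element of the sphere ideal, modulo the quadratic relations, in the
  form (c - 1) g, so one comparison of leading terms settles the sphere relation.\<close>

locale qsphere =
  fixes Q :: complex and n :: nat
  assumes Q_nonzero [simp]: "Q \<noteq> 0"
begin

definition bar :: "nat \<Rightarrow> nat" where "bar a = 2 * n + 1 - a"

abbreviation idx :: "nat set" where "idx \<equiv> {1..2 * n}"

definition wt :: "nat \<Rightarrow> complex" where "wt a = (if a \<le> n then Q ^ a else - (Q ^ (a + 1)))"

text \<open>Up to the overall factor Q these are the diagonal entries Q, 1/Q and 1 of the symplectic
  R-matrix.\<close>

definition lam :: "nat \<Rightarrow> nat \<Rightarrow> complex" where
  "lam a c = (if c = a then Q^2 else if c = bar a then 1 else Q)"

text \<open>\<open>cross a c G\<close> is the straightened form of \<open>z\<^sub>a w\<^sub>c\<close>, with \<open>w\<^sub>d z\<^sub>x\<close> replaced by \<open>G d x\<close>. The guard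
  \<open>0 < c\<close> lets indices outside \<open>idx\<close> pass through harmlessly.\<close>

definition cross :: "nat \<Rightarrow> nat \<Rightarrow> (nat \<Rightarrow> nat \<Rightarrow> complex) \<Rightarrow> complex" where
  "cross a c G = lam a c * G c a
     + (if 0 < c \<and> c < a then (Q^2 - 1) * G a c else 0)
     + (if c = bar a then (1 - Q^2) * (\<Sum>k\<in>{1..<a}. wt k / wt a * G (bar k) k) else 0)"

text \<open>The relations of the \<open>z\<^sub>a\<close> with \<open>P a b\<close> in the place of \<open>z\<^sub>a z\<^sub>b\<close>. Differences of consecutive
  relations for \<open>y\<^sub>i x\<^sub>i\<close> are used, which contain no sum.\<close>

definition qrel :: "(nat \<Rightarrow> nat \<Rightarrow> complex) \<Rightarrow> bool" where
  "qrel P \<longleftrightarrow> (\<forall>a\<in>idx. \<forall>b\<in>idx. a < b \<longrightarrow> b \<noteq> bar a \<longrightarrow> P b a = Q * P a b) \<and>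
     (\<forall>i\<in>{1..n}. P (bar i) i = Q^2 * P i (bar i)
        + (if i = 1 then 0 else Q * (P (bar (i - 1)) (i - 1) - P (i - 1) (bar (i - 1)))))"

lemma bar_bar [simp]: "a \<in> idx \<Longrightarrow> bar (bar a) = a"
  by (auto simp: bar_def)

lemma bar_idx [simp]: "a \<in> idx \<Longrightarrow> bar a \<in> idx"
  by (auto simp: bar_def)

lemma bar_simps [simp]:
  "a \<le> 2 * n + 1 \<Longrightarrow> bar (bar a) = a"
  "a \<le> 2 * n \<Longrightarrow> Suc 0 \<le> bar a" "a \<le> 2 * n \<Longrightarrow> 0 < bar a"
  "0 < a \<Longrightarrow> bar a \<le> 2 * n"
  by (auto simp: bar_def)

lemma bar_neq_self: "bar a \<noteq> a"
  by (auto simp: bar_def; presburger)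

lemma wt_nonzero [simp]: "wt a \<noteq> 0"
  by (simp add: wt_def)

lemma qrel_less: "qrel P \<Longrightarrow> a \<in> idx \<Longrightarrow> b \<in> idx \<Longrightarrow> a < b \<Longrightarrow> b \<noteq> bar a \<Longrightarrow> P b a = Q * P a b"
  by (auto simp: qrel_def)

lemma qrel_bar: "qrel P \<Longrightarrow> i \<in> {1..n} \<Longrightarrow> P (bar i) i = Q^2 * P i (bar i)
        + (if i = 1 then 0 else Q * (P (bar (i - 1)) (i - 1) - P (i - 1) (bar (i - 1))))"
  unfolding qrel_def by blast

lemma qrelI:
  assumes "\<And>a b. a \<in> idx \<Longrightarrow> b \<in> idx \<Longrightarrow> a < b \<Longrightarrow> b \<noteq> bar a \<Longrightarrow> P b a = Q * P a b"
    and "0 < n \<Longrightarrow> P (bar 1) 1 = Q^2 * P 1 (bar 1)"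
    and "\<And>i. i \<in> {1..<n} \<Longrightarrow> P (bar (Suc i)) (Suc i) = Q^2 * P (Suc i) (bar (Suc i))
        + Q * (P (bar i) i - P i (bar i))"
  shows "qrel P"
  unfolding qrel_def
proof (intro conjI ballI impI)
  fix i assume i: "i \<in> {1..n}"
  then obtain j where j: "i = Suc j" by (metis atLeastAtMost_iff not_one_le_zero old.nat.exhaust)
  show "P (bar i) i = Q^2 * P i (bar i)
        + (if i = 1 then 0 else Q * (P (bar (i - 1)) (i - 1) - P (i - 1) (bar (i - 1))))"
    using assms(2) assms(3)[of j] i unfolding j by (cases "j = 0") auto
qed (use assms in auto)

lemma qrel_add: "qrel P \<Longrightarrow> qrel R \<Longrightarrow> qrel (\<lambda>a b. P a b + R a b)"
  unfolding qrel_def by (auto simp: algebra_simps)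

lemma qrel_zero: "qrel (\<lambda>a b. 0)"
  unfolding qrel_def by auto

lemma qrel_scale: "qrel P \<Longrightarrow> qrel (\<lambda>a b. x * P a b)"
  unfolding qrel_def by (auto simp: algebra_simps)

lemma qrel_sum: "(\<And>d. d \<in> D \<Longrightarrow> qrel (P d)) \<Longrightarrow> qrel (\<lambda>a b. \<Sum>d\<in>D. P d a b)"
  by (induction D rule: infinite_finite_induct) (auto intro: qrel_add qrel_zero)

lemma bar_less_bar: "a \<in> idx \<Longrightarrow> b \<in> idx \<Longrightarrow> bar a < bar b \<longleftrightarrow> b < a"
  by (auto simp: bar_def)

lemma bar_eq_bar: "a \<in> idx \<Longrightarrow> b \<in> idx \<Longrightarrow> bar a = bar b \<longleftrightarrow> a = b"
  by (auto simp: bar_def)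

text \<open>The map \<open>bar\<close> reverses the order of the indices, and reversing the product
  undoes this; the relations between \<open>i\<close> and \<open>bar i\<close> are literally
  fixed.\<close>

lemma qrel_bar_swap:
  assumes "qrel P" shows "qrel (\<lambda>a b. P (bar b) (bar a))"
proof (rule qrelI)
  fix a b assume *: "a \<in> idx" "b \<in> idx" "a < b" "b \<noteq> bar a"
  then have "bar a \<noteq> bar (bar b)" by (metis bar_bar)
  with * show "P (bar a) (bar b) = Q * P (bar b) (bar a)"
    by (intro qrel_less[OF assms]) (auto simp: bar_less_bar simp del: bar_bar)
next
  assume "0 < n"
  then show "P (bar 1) (bar (bar 1)) = Q^2 * P (bar (bar 1)) (bar 1)"
    using qrel_bar[OF assms, of 1] by simp
next
  fix i assume "i \<in> {1..<n}"
  then show "P (bar (Suc i)) (bar (bar (Suc i))) = Q^2 * P (bar (bar (Suc i))) (bar (Suc i)) +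
         Q * (P (bar i) (bar (bar i)) - P (bar (bar i)) (bar i))"
    using qrel_bar[OF assms, of "Suc i"] by simp
qed

text \<open>\<open>lam\<close> and the conditions \<open>c < a\<close> and \<open>c = bar a\<close>
  are invariant under (a, c) going to (bar c, bar a). This symmetry exchanges the roles of the
  z-copy and the w-copy.\<close>

lemma cross_dual:
  assumes "a \<in> idx" "c \<in> idx"
  shows "cross a c G = cross (bar c) (bar a) (\<lambda>d x. G (bar x) (bar d))"
proof -
  have 1: "lam (bar c) (bar a) = lam a c"
    using assms bar_bar[of a] bar_bar[of c] unfolding lam_def by (auto simp del: bar_bar bar_simps; metis)
  have 2: "0 < bar a \<and> bar a < bar c \<longleftrightarrow> 0 < c \<and> c < a"
    using assms by (auto simp: bar_def)
  have 3: "bar a = bar (bar c) \<longleftrightarrow> c = bar a"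
    using assms by (metis bar_bar)
  have 4: "(\<Sum>k\<in>{1..<a}. wt k / wt a * G (bar k) k)
      = (\<Sum>k\<in>{1..<a}. wt k / wt a * G (bar k) (bar (bar k)))"
    using assms by (intro sum.cong) auto
  show ?thesis
    unfolding cross_def 1 2 3 using assms 4 by auto
qed

lemma cross_add: "cross a c (\<lambda>d x. G d x + H d x) = cross a c G + cross a c H"
  by (simp add: cross_def algebra_simps sum.distrib sum_distrib_left)

lemma cross_scale: "cross a c (\<lambda>d x. u * G d x) = u * cross a c G"
  by (simp add: cross_def algebra_simps sum_distrib_left)

lemma cross_sum: "cross a c (\<lambda>d x. \<Sum>j\<in>J. G j d x) = (\<Sum>j\<in>J. cross a c (G j))"
proof (induction J rule: infinite_finite_induct)
  case (insert j J)
  then show ?case by (simp add: cross_add)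
qed (simp_all add: cross_def)

lemma cross_cong:
  assumes "a \<in> idx" "\<And>d x. x \<in> idx \<Longrightarrow> d = c \<or> d \<in> idx \<Longrightarrow> G d x = H d x"
  shows "cross a c G = cross a c H"
proof -
  have "(\<Sum>k\<in>{1..<a}. wt k / wt a * G (bar k) k) = (\<Sum>k\<in>{1..<a}. wt k / wt a * H (bar k) k)"
    using assms by (intro sum.cong refl) auto
  moreover have "bar a \<in> idx" "0 < bar a" using assms(1) by auto
  moreover have "G c a = H c a" "0 < c \<and> c < a \<Longrightarrow> G a c = H a c"
    using assms by auto
  ultimately show ?thesis by (auto simp: cross_def)
qed

section \<open>Partial sums of the symplectic form on one copy\<close>

definition psum :: "(nat \<Rightarrow> nat \<Rightarrow> complex) \<Rightarrow> nat \<Rightarrow> complex" where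
  "psum P m = (\<Sum>e\<in>{1..m}. wt (bar e) * P e (bar e))"

lemma psum_Suc: "psum P (Suc m) = psum P m + wt (bar (Suc m)) * P (Suc m) (bar (Suc m))"
  by (simp add: psum_def)

lemma wt_bar: "i \<in> {1..n} \<Longrightarrow> wt (bar i) = - (Q ^ (2 * n + 2 - i))"
  by (auto simp: wt_def bar_def Suc_diff_le)

text \<open>Solves the recursion in \<open>qrel\<close>: the relation at i + 1 contains Q times the
  commutator at i, and the ratio of \<open>wt (bar i)\<close> to \<open>wt (bar (Suc i))\<close>
  absorbs this Q.\<close>

lemma psum_low:
  assumes P: "qrel P" and "i \<in> {1..n}"
  shows "wt (bar i) * (P (bar i) i - P i (bar i)) = (Q^2 - 1) * psum P i"
  using assms(2)
proof (induction i)
  case (Suc i)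
  show ?case
  proof (cases "i = 0")
    case True
    then show ?thesis using qrel_bar[OF P, of 1] Suc.prems by (simp add: psum_def algebra_simps)
  next
    case False
    then have i: "i \<in> {1..n}" and si: "Suc i \<in> {1..n}" using Suc.prems by auto
    have w: "wt (bar (Suc i)) * Q = wt (bar i)"
    proof -
      have "2 * n + 2 - i = Suc (2 * n + 2 - Suc i)" using si by auto
      then show ?thesis using wt_bar[OF i] wt_bar[OF si] by simp
    qed
    have "wt (bar (Suc i)) * (P (bar (Suc i)) (Suc i) - P (Suc i) (bar (Suc i)))
      = (Q^2 - 1) * (wt (bar (Suc i)) * P (Suc i) (bar (Suc i)))
        + wt (bar i) * (P (bar i) i - P i (bar i))"
      using qrel_bar[OF P si] False w by simp Groebner_Basis.algebra
    with Suc.IH[OF i] show ?thesis by (simp add: psum_Suc distrib_left)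
  qed
qed simp

text \<open>Sums reaching past the middle reduce to short ones; for i = 1 the full sum vanishes,
  that is, the symplectic form is zero on a single copy. The induction runs down from i = n, because
  the sum up to \<open>bar i\<close> has just one term more than the sum up to
  \<open>bar (Suc i)\<close>.\<close>

lemma psum_bar:
  assumes P: "qrel P" and "i \<in> {1..n}"
  shows "wt (bar i) * psum P (bar i) = - wt i * psum P (i - 1)"
proof -
  have "i \<le> n \<Longrightarrow> 0 < i \<Longrightarrow> ?thesis"
  proof (induction i rule: inc_induct)
    case base
    have n: "n \<in> {1..n}" using base by auto
    obtain m where m: "n = Suc m" using base gr0_implies_Suc by blast
    have b: "bar n = Suc n" by (simp add: bar_def)
    have "psum P (bar n) = psum P n + wt n * P (bar n) n"
      using n by (subst b, subst psum_Suc) (auto simp: b[symmetric])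
    also have "psum P n = psum P (n - 1) + wt (bar n) * P n (bar n)"
      using psum_Suc[of P m] m by simp
    finally have e: "psum P (bar n) = psum P (n - 1) + wt (bar n) * P n (bar n) + wt n * P (bar n) n" .
    have l: "wt (bar n) * (P (bar n) n - P n (bar n))
       = (Q^2 - 1) * (psum P (n - 1) + wt (bar n) * P n (bar n))"
      using psum_low[OF P n] psum_Suc[of P m] m by simp
    have w: "wt (bar n) = - (Q^2) * wt n"
      using n by (simp add: wt_bar) (simp add: wt_def add.commute mult_2 flip: power_add)
    show ?case using e l w wt_nonzero[of n] by Groebner_Basis.algebra
  next
    case (step i)
    have i: "i \<in> {1..n}" "Suc i \<in> {1..n}" using step by auto
    obtain m where m: "i = Suc m" using i by (metis atLeastAtMost_iff not_one_le_zero old.nat.exhaust)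
    have b: "bar i = Suc (bar (Suc i))" using i by (auto simp: bar_def)
    have IH: "wt (bar (Suc i)) * psum P (bar (Suc i)) = - wt (Suc i) * psum P i"
      using step by simp
    have e: "psum P (bar i) = psum P (bar (Suc i)) + wt i * P (bar i) i"
      using i by (subst b, subst psum_Suc) (auto simp: b[symmetric])
    have l: "wt (bar i) * (P (bar i) i - P i (bar i)) = (Q^2 - 1) * psum P i"
      using psum_low[OF P i(1)] .
    have l2: "psum P i = psum P (i - 1) + wt (bar i) * P i (bar i)"
      using psum_Suc[of P m] m by simp
    have w: "wt (bar i) = Q * wt (bar (Suc i))" "wt (Suc i) = Q * wt i"
    proof -
      have "2 * n + 2 - i = Suc (2 * n + 2 - Suc i)" using i by auto
      then show "wt (bar i) = Q * wt (bar (Suc i))" using wt_bar[OF i(1)] wt_bar[OF i(2)] by simp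
      show "wt (Suc i) = Q * wt i" using i by (simp add: wt_def)
    qed
    show ?case using e l l2 w IH by Groebner_Basis.algebra
  qed
  with assms(2) show ?thesis by auto
qed

text \<open>One identity for both halves of the index set, for use in the computations with matrix
  entries. In the lower half it is \<open>psum_low\<close>; in the upper half
  \<open>psum_bar\<close> first shortens the sum.\<close>

lemma psum_reflect:
  assumes P: "qrel P" and x: "x \<in> idx"
  shows "wt (bar x) * P x (bar x) + (Q^2 - 1) * psum P x
    = (if x \<le> n then 1 else Q^2) * (wt (bar x) * P (bar x) x)"
proof (cases "x \<le> n")
  case True
  then show ?thesis using psum_low[OF P, of x] x by (simp add: algebra_simps)
next
  case False
  define i where "i = bar x"
  have i: "i \<in> {1..n}" "x = bar i" "x \<in> idx" using False x by (auto simp: i_def bar_def)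
  have bb: "bar (bar i) = i" using i by auto
  obtain m where m: "i = Suc m" using i by (metis atLeastAtMost_iff not_one_le_zero old.nat.exhaust)
  have l: "wt (bar i) * (P (bar i) i - P i (bar i)) = (Q^2 - 1) * psum P i"
    using psum_low[OF P i(1)] .
  have l2: "psum P i = psum P (i - 1) + wt (bar i) * P i (bar i)"
    using psum_Suc[of P m] m by simp
  have "wt (bar i) * (wt i * P (bar i) i + (Q^2 - 1) * psum P (bar i))
     = wt (bar i) * (Q^2 * (wt i * P i (bar i)))"
    using l l2 psum_bar[OF P i(1)] by Groebner_Basis.algebra
  then show ?thesis using False unfolding i(2) bb by simp
qed


section \<open>Matrix entries of the straightening of z_a z_b w_c\<close>

lemma bar_eq_iff: "a \<in> idx \<Longrightarrow> d \<in> idx \<Longrightarrow> bar a = d \<longleftrightarrow> a = bar d"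
  by (metis bar_bar)

text \<open>Testing with functions supported on one \<open>d\<close> reads off the coefficient of
  w_d. Of the sum in \<open>cross\<close> only k = bar d survives.\<close>

lemma cross_pick:
  assumes "a \<in> idx" "d \<in> idx"
  shows "cross a c (\<lambda>d' x. if d' = d then F x else 0) =
     (if c = d then lam a c * F a else 0) + (if d = a \<and> 0 < c \<and> c < a then (Q^2 - 1) * F c else 0)
     + (if c = bar a \<and> bar d < a then (1 - Q^2) * (wt (bar d) / wt a * F (bar d)) else 0)"
proof -
  have "(\<Sum>k\<in>{1..<a}. wt k / wt a * (if bar k = d then F k else 0))
      = (\<Sum>k\<in>{1..<a}. if k = bar d then wt (bar d) / wt a * F (bar d) else 0)"
  proof (intro sum.cong refl)
    fix k assume "k \<in> {1..<a}"
    then have "bar k = d \<longleftrightarrow> k = bar d" using assms by (intro bar_eq_iff) auto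
    then show "wt k / wt a * (if bar k = d then F k else 0)
        = (if k = bar d then wt (bar d) / wt a * F (bar d) else 0)" by simp
  qed
  also have "\<dots> = (if bar d \<in> {1..<a} then wt (bar d) / wt a * F (bar d) else 0)"
    by (rule sum.delta) simp
  also have "bar d \<in> {1..<a} \<longleftrightarrow> bar d < a" using assms by simp
  finally show ?thesis unfolding cross_def by (simp only: if_distrib[of "(*) _"] mult_zero_right) simp
qed
text \<open>Straightening \<open>z\<^sub>a z\<^sub>b w\<^sub>c\<close> gives \<open>\<Sum>\<^sub>d w\<^sub>d (M\<^sub>a M\<^sub>b)\<^bsub>d c\<^esub>\<close> for matrices \<open>M\<^sub>a\<close> over the \<open>z\<^sub>x\<close>; this is the
  entry at \<open>(d, c)\<close>. Compatibility of the braiding with the \<open>z\<close>-relations says that the \<open>M\<^sub>a\<close> satisfy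
  them too.\<close>

definition entry :: "nat \<Rightarrow> nat \<Rightarrow> nat \<Rightarrow> nat \<Rightarrow> (nat \<Rightarrow> nat \<Rightarrow> complex) \<Rightarrow> complex" where
  "entry c d a b P = cross b c (\<lambda>e y. cross a e (\<lambda>d' x. if d' = d then P x y else 0))"

lemma if_zero_of_bool: "(if A then x else 0) = of_bool A * (x :: complex)"
  by simp

lemmas entry_simps = if_zero_of_bool of_bool_conj algebra_simps power2_eq_square
  add_divide_distrib diff_divide_distrib

text \<open>For \<open>c\<close> other than \<open>bar b\<close> the first crossing either keeps or
  exchanges the indices; the second has the three outcomes of \<open>cross_pick\<close>. This gives
  the six summands.\<close>

lemma entry_generic:
  assumes "a \<in> idx" "b \<in> idx" "c \<in> idx" "d \<in> idx" "c \<noteq> bar b"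
  shows "entry c d a b P =
     (if c = d then lam b c * lam a c * P a b else 0)
   + (if d = a \<and> c < a then lam b c * (Q^2 - 1) * P c b else 0)
   + (if c = bar a \<and> bar d < a then lam b c * (1 - Q^2) * (wt (bar d) / wt a) * P (bar d) b else 0)
   + (if b = d \<and> c < b then (Q^2 - 1) * lam a b * P a c else 0)
   + (if d = a \<and> b < a \<and> c < b then (Q^2 - 1)\<^sup>2 * P b c else 0)
   + (if b = bar a \<and> bar d < a \<and> c < b then (Q^2 - 1) * (1 - Q^2) * (wt (bar d) / wt a) * P (bar d) c else 0)"
  unfolding entry_def cross_def[of b] cross_pick[OF assms(1,4)]
  using assms by (simp add: entry_simps split del: if_split)

text \<open>Substituting e = bar k turns the sum into the stretch of \<open>psum\<close> strictly
  between \<open>bar b\<close> and \<open>a\<close>.\<close>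

lemma wt_pair_sum:
  assumes "a \<in> idx" "b \<in> idx"
  shows "(\<Sum>k\<in>{1..<b}. if bar k < a then wt k / wt b * P (bar k) k else 0)
       = (if bar b < a then (psum P (a - 1) - psum P (bar b)) / wt b else 0)"
proof -
  have "(\<Sum>k\<in>{1..<b}. if bar k < a then wt k / wt b * P (bar k) k else 0)
      = (\<Sum>k\<in>{k\<in>{1..<b}. bar k < a}. wt k / wt b * P (bar k) k)"
    by (rule sum.inter_filter[symmetric]) simp
  also have "\<dots> = (\<Sum>e\<in>{bar b<..<a}. wt (bar e) / wt b * P e (bar e))"
    using assms by (intro sum.reindex_bij_witness[of _ bar bar]) (auto simp: bar_def)
  also have "\<dots> = (if bar b < a then (psum P (a - 1) - psum P (bar b)) / wt b else 0)"
  proof (cases "bar b < a")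
    case True
    then have "{1..a - 1} = {1..bar b} \<union> {bar b<..<a}" by auto
    then have "psum P (a - 1) = psum P (bar b) + (\<Sum>e\<in>{bar b<..<a}. wt (bar e) * P e (bar e))"
      unfolding psum_def by (simp add: sum.union_disjoint disjoint_iff)
    with True show ?thesis by (simp add: sum_divide_distrib)
  qed auto
  finally show ?thesis .
qed

text \<open>For \<open>c = bar b\<close> the first crossing also produces a sum, so there are nine
  summands. Its terms either pick one \<open>k\<close>, or are exchanged with \<open>a\<close>; the
  latter accumulate to a difference of two values of \<open>psum\<close>.\<close>

lemma entry_bar:
  assumes "a \<in> idx" "b \<in> idx" "d \<in> idx"
  shows "entry (bar b) d a b P =
     (if bar b = d then lam a (bar b) * P a b else 0)
   + (if d = a \<and> bar b < a then (Q^2 - 1) * P (bar b) b else 0)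
   + (if a = b \<and> bar d < a then (1 - Q^2) * (wt (bar d) / wt a) * P (bar d) b else 0)
   + (if b = d \<and> bar b < b then (Q^2 - 1) * lam a b * P a (bar b) else 0)
   + (if d = a \<and> b < a \<and> bar b < b then (Q^2 - 1)\<^sup>2 * P b (bar b) else 0)
   + (if b = bar a \<and> bar d < a \<and> a < b then (Q^2 - 1) * (1 - Q^2) * (wt (bar d) / wt a) * P (bar d) a else 0)
   + (if bar d < b then (1 - Q^2) * (wt (bar d) / wt b) * lam a d * P a (bar d) else 0)
   + (if d = a \<and> bar b < a then (1 - Q^2) * (Q^2 - 1) * (psum P (a - 1) - psum P (bar b)) / wt b else 0)
   + (if a < b \<and> bar d < a then (1 - Q^2)\<^sup>2 * (wt (bar d) / wt b) * P (bar d) a else 0)"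
proof -
  have s1: "(\<Sum>k\<in>{1..<b}. wt k / wt b * (if bar k = d then lam a (bar k) * P a k else 0))
     = (if bar d < b then wt (bar d) / wt b * (lam a d * P a (bar d)) else 0)"
  proof -
    have "(\<Sum>k\<in>{1..<b}. wt k / wt b * (if bar k = d then lam a (bar k) * P a k else 0))
      = (\<Sum>k\<in>{1..<b}. if k = bar d then wt (bar d) / wt b * (lam a d * P a (bar d)) else 0)"
    proof (intro sum.cong refl)
      fix k assume "k \<in> {1..<b}"
      then have "bar k = d \<longleftrightarrow> k = bar d" using assms by (intro bar_eq_iff) auto
      moreover have "bar (bar d) = d" using assms by simp
      ultimately show "wt k / wt b * (if bar k = d then lam a (bar k) * P a k else 0)
        = (if k = bar d then wt (bar d) / wt b * (lam a d * P a (bar d)) else 0)" by simp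
    qed
    also have "\<dots> = (if bar d \<in> {1..<b} then wt (bar d) / wt b * (lam a d * P a (bar d)) else 0)"
      by (rule sum.delta) simp
    also have "bar d \<in> {1..<b} \<longleftrightarrow> bar d < b" using assms by simp
    finally show ?thesis .
  qed
  have s2: "(\<Sum>k\<in>{1..<b}. wt k / wt b * (if d = a \<and> 0 < bar k \<and> bar k < a then (Q^2 - 1) * P (bar k) k else 0))
     = (if d = a \<and> bar b < a then (Q^2 - 1) * (psum P (a - 1) - psum P (bar b)) / wt b else 0)"
  proof (cases "d = a")
    case True
    have "(\<Sum>k\<in>{1..<b}. wt k / wt b * (if d = a \<and> 0 < bar k \<and> bar k < a then (Q^2 - 1) * P (bar k) k else 0))
      = (Q^2 - 1) * (\<Sum>k\<in>{1..<b}. if bar k < a then wt k / wt b * P (bar k) k else 0)"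
      unfolding sum_distrib_left using assms True by (intro sum.cong refl) (auto simp: bar_def)
    then show ?thesis unfolding wt_pair_sum[OF assms(1,2)] using True by auto
  qed simp
  have s3: "(\<Sum>k\<in>{1..<b}. wt k / wt b * (if bar k = bar a \<and> bar d < a then (1 - Q^2) * (wt (bar d) / wt a * P (bar d) k) else 0))
     = (if a < b \<and> bar d < a then (1 - Q^2) * (wt (bar d) / wt b * P (bar d) a) else 0)"
  proof -
    have "(\<Sum>k\<in>{1..<b}. wt k / wt b * (if bar k = bar a \<and> bar d < a then (1 - Q^2) * (wt (bar d) / wt a * P (bar d) k) else 0))
      = (\<Sum>k\<in>{1..<b}. if k = a then (if bar d < a then (1 - Q^2) * (wt (bar d) / wt b * P (bar d) a) else 0) else 0)"
    proof (intro sum.cong refl)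
      fix k assume "k \<in> {1..<b}"
      then have "bar k = bar a \<longleftrightarrow> k = a" using assms by (intro bar_eq_bar) auto
      then show "wt k / wt b * (if bar k = bar a \<and> bar d < a then (1 - Q^2) * (wt (bar d) / wt a * P (bar d) k) else 0)
        = (if k = a then (if bar d < a then (1 - Q^2) * (wt (bar d) / wt b * P (bar d) a) else 0) else 0)"
        by simp
    qed
    also have "\<dots> = (if a \<in> {1..<b} then (if bar d < a then (1 - Q^2) * (wt (bar d) / wt b * P (bar d) a) else 0) else 0)"
      by (rule sum.delta) simp
    also have "a \<in> {1..<b} \<longleftrightarrow> a < b" using assms by simp
    finally show ?thesis by simp
  qed
  have l: "lam b (bar b) = 1" using bar_neq_self[of b] by (simp add: lam_def)
  have eqs: "bar b = bar a \<longleftrightarrow> a = b" "0 < bar b" "bar b \<noteq> b" "0 < b"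
    using assms bar_eq_bar[of a b] bar_neq_self by auto
  show ?thesis
    unfolding entry_def cross_def[of b] cross_pick[OF assms(1,3)]
    unfolding sum.distrib distrib_left s1 s2 s3 l
    using eqs assms by (simp add: entry_simps split del: if_split)
qed


section \<open>The matrices satisfy the q-commutation relations\<close>

lemma entry_qcomm_generic:
  assumes P: "qrel P" and a: "a \<in> idx" and b: "b \<in> idx" and c: "c \<in> idx" and d: "d \<in> idx"
    and ab: "a < b" "b \<noteq> bar a" and ca: "c \<noteq> bar a" "c \<noteq> bar b"
  shows "entry c d b a P = Q * entry c d a b P"
proof -
  note e = entry_generic[OF b a c d ca(1)] entry_generic[OF a b c d ca(2)]
  have ba: "a \<noteq> bar b" "bar a \<noteq> b" "bar b \<noteq> a" using ab a b by (auto simp: bar_eq_iff)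
  have cb: "bar c \<noteq> a" "bar c \<noteq> b" using ca a b c by (auto simp: bar_eq_iff)
  have Pab: "P b a = Q * P a b" using qrel_less[OF P a b ab] .
  have Pac: "a < c \<Longrightarrow> P c a = Q * P a c" "b < c \<Longrightarrow> P c b = Q * P b c"
    using qrel_less[OF P a c] qrel_less[OF P b c] ca by auto
  have Pca: "c < a \<Longrightarrow> P a c = Q * P c a" "c < b \<Longrightarrow> P b c = Q * P c b"
    using qrel_less[OF P c a] qrel_less[OF P c b] cb by auto
  consider "c < a" | "c = a" | "a < c" "c < b" | "c = b" | "b < c" by linarith
  then show ?thesis
  proof cases
    case 1
    then have "c < b" "c \<noteq> a" "c \<noteq> b" using ab by auto
    with 1 show ?thesis unfolding e using ba ca cb ab
      by (auto simp: lam_def Pab Pca algebra_simps power2_eq_square)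
  next
    case 2
    with ab show ?thesis unfolding e using ba ca cb Pab
      by (auto simp: lam_def algebra_simps power2_eq_square)
  next
    case 3
    then show ?thesis unfolding e using ba ca cb ab
      by (auto simp: lam_def Pab Pca Pac algebra_simps power2_eq_square)
  next
    case 4
    with ab show ?thesis unfolding e using ba ca cb Pab
      by (auto simp: lam_def algebra_simps power2_eq_square)
  next
    case 5
    with ab show ?thesis unfolding e using ba ca cb
      by (auto simp: lam_def Pab algebra_simps power2_eq_square)
  qed
qed
lemma psum_pred: "b \<in> idx \<Longrightarrow> psum P b = psum P (b - 1) + wt (bar b) * P b (bar b)"
  using psum_Suc[of P "b - 1"] by simp

text \<open>All entries except \<open>d = b\<close> follow from q-commutation of single pairs. At
  \<open>d = b\<close> the product of \<open>b\<close> with \<open>bar b\<close> meets that of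
  \<open>a\<close> with \<open>bar a\<close>, and partial sums appear.\<close>

lemma entry_qcomm_bar_left:
  assumes P: "qrel P" and a: "a \<in> idx" and b: "b \<in> idx" and d: "d \<in> idx"
    and ab: "a < b" "b \<noteq> bar a"
  shows "entry (bar a) d b a P = Q * entry (bar a) d a b P"
proof -
  have c: "bar a \<in> idx" using a by simp
  have ba: "a \<noteq> bar b" "bar b \<noteq> a" "bar a \<noteq> b" "bar a \<noteq> bar b" "\<not> b < a" "b \<noteq> a"
    using ab a b by (auto simp: bar_eq_iff bar_eq_bar)
  note e = entry_bar[OF b a d, of P] entry_generic[OF a b c d ba(4), of P]
  have Pab: "P b a = Q * P a b" using qrel_less[OF P a b ab] .
  have l: "lam b (bar a) = Q" "lam a (bar a) = 1" "lam b a = Q" "lam a b = Q" "lam b b = Q^2"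
    using ba ab bar_neq_self[of a] by (auto simp: lam_def)
  show ?thesis
  proof (cases "d = b")
    case False
    have 1: "P b (bar d) = Q * P (bar d) b \<and> lam b d = Q" if "bar d < a"
    proof -
      have "b \<noteq> bar (bar d)" "d \<noteq> bar b" using that ab d b False by auto
      with that show ?thesis
        using qrel_less[OF P _ b, of "bar d"] d ab False by (auto simp: lam_def)
    qed
    have 2: "P b (bar a) = Q * P (bar a) b" if "bar a < a"
      using that qrel_less[OF P c b] ab a ba by auto
    have aa: "bar (bar a) = a" "bar a \<noteq> a" using a bar_neq_self by auto
    consider "d = a" | "d = bar a" | "d \<noteq> a" "d \<noteq> bar a" by blast
    then show ?thesis
    proof cases
      case 1
      show ?thesis unfolding e unfolding 1 using False ba l Pab 2 ab aa
        by (simp add: algebra_simps power2_eq_square)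
    next
      case 2
      show ?thesis unfolding e unfolding 2 using False ba l Pab ab aa
        by (simp add: algebra_simps power2_eq_square)
    next
      case 3
      show ?thesis unfolding e using False ba l 1 3
        by (auto simp: algebra_simps power2_eq_square)
    qed
  next
    case True
    show ?thesis
    proof (cases "bar a < b")
      case False
      then have "\<not> bar b < a" "\<not> bar a < a" using a b ab by (auto simp: bar_def)
      then show ?thesis unfolding e using True ba False by simp
    next
      case less: True
      then have bn: "bar b < a" "\<not> b \<le> n" and an: "bar a < a \<longleftrightarrow> bar a \<le> n"
        using a b ab by (auto simp: bar_def)
      \<comment> \<open>What has to cancel is the stretch of \<open>psum\<close> between
        \<open>bar a\<close> and \<open>b\<close>: R1 handles its end at \<open>b\<close>, R2 its
        end at \<open>bar a\<close>.\<close>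
      have R1: "wt (bar b) * P b (bar b) + (Q^2 - 1) * psum P b = Q^2 * (wt (bar b) * P (bar b) b)"
        using psum_reflect[OF P b] bn by simp
      have R2: "wt a * P (bar a) a + (Q^2 - 1) * psum P (bar a) = (if bar a < a then 1 else Q^2) * (wt a * P a (bar a))"
        using psum_reflect[OF P c] a unfolding an by simp
      have R3: "psum P b = psum P (b - 1) + wt (bar b) * P b (bar b)" by (rule psum_pred[OF b])
      define X where "X = inverse (wt a)"
      have R4: "wt a * X = 1" by (simp add: X_def)
      have p: "P (bar a) a = (if bar a < a then 1 else Q^2) * P a (bar a) - (Q^2 - 1) * psum P (bar a) * X"
        using R2 R4 by Groebner_Basis.algebra
      have g: "(1 - Q^2) * X * (wt (bar b) * P b (bar b) + (Q^2 - 1) * (psum P (b - Suc 0) + wt (bar b) * P b (bar b)) - Q^2 * (wt (bar b) * P (bar b) b)) = 0"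
        using R1 R3 by simp
      show ?thesis
      proof (cases "bar a < a")
        case t: True
        show ?thesis
          unfolding e unfolding True divide_inverse X_def[symmetric] p
          by (simp add: ba ab less_imp_neq[OF ab(1)] l less bn(1) t) (use g in Groebner_Basis.algebra)
      next
        case t: False
        show ?thesis
          unfolding e unfolding True divide_inverse X_def[symmetric] p
          by (simp add: ba ab less_imp_neq[OF ab(1)] l less bn(1) t) (use g in Groebner_Basis.algebra)
      qed
    qed
  qed
qed

text \<open>Mirror image of the preceding case: the critical entry is now \<open>d = a\<close>, and
  the stretch of \<open>psum\<close> runs from \<open>bar b\<close> to \<open>a\<close>.\<close>

lemma entry_qcomm_bar_right:
  assumes P: "qrel P" and a: "a \<in> idx" and b: "b \<in> idx" and d: "d \<in> idx"
    and ab: "a < b" "b \<noteq> bar a"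
  shows "entry (bar b) d b a P = Q * entry (bar b) d a b P"
proof -
  have c: "bar b \<in> idx" using b by simp
  have ba: "a \<noteq> bar b" "bar b \<noteq> a" "bar a \<noteq> b" "bar b \<noteq> bar a" "\<not> b < a" "b \<noteq> a"
    using ab a b by (auto simp: bar_eq_iff bar_eq_bar)
  note e = entry_generic[OF b a c d ba(4), of P] entry_bar[OF a b d, of P]
  have Pab: "P b a = Q * P a b" using qrel_less[OF P a b ab] .
  have l: "lam a (bar b) = Q" "lam b (bar b) = 1" "lam b a = Q" "lam a b = Q" "lam a a = Q^2"
    using ba ab bar_neq_self[of b] by (auto simp: lam_def)
  show ?thesis
  proof (cases "d = a")
    case False
    have 0: "bar d = a \<longleftrightarrow> d = bar a" using a d by (auto simp: bar_eq_iff)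
    have f1: "P a (bar d) = Q * P (bar d) a" "lam a d = Q" if "bar d < a"
      using that qrel_less[OF P _ a, of "bar d"] d ab False 0 a by (auto simp: lam_def)
    have f2: "P (bar d) a = Q * P a (bar d)" "lam a d = Q" if "a < bar d"
      using that qrel_less[OF P a, of "bar d"] d ab False 0 a by (auto simp: lam_def bar_eq_bar)
    consider "bar d < a" | "bar d = a" | "a < bar d" by linarith
    then show ?thesis
    proof cases
      case 1
      then have "bar b \<noteq> d" using ab b by auto
      then have db: "bar b \<noteq> d" .
      show ?thesis
      proof (cases "d = b")
        case True
        show ?thesis unfolding e unfolding True using ba l ab 1 f1[OF 1] db True
          by (simp add: algebra_simps power2_eq_square add_divide_distrib diff_divide_distrib)
      next
        case neq: False
        then show ?thesis unfolding e using False ba l ab 1 f1[OF 1] db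
          by (simp add: algebra_simps power2_eq_square add_divide_distrib diff_divide_distrib)
      qed
    next
      case 2
      then have d: "d = bar a" using 0 by simp
      have "bar (bar a) = a" "lam a (bar a) = 1" "bar a \<noteq> a" "a \<noteq> bar a"
        using a bar_neq_self[of a] by (auto simp: lam_def)
      then show ?thesis unfolding e unfolding d using ba l ab
        by (simp add: algebra_simps power2_eq_square)
    next
      case 3
      show ?thesis
      proof (cases "d = bar b")
        case True
        have "bar (bar b) = b" "bar b \<noteq> b" "b \<noteq> bar b" using b bar_neq_self[of b] by auto
        then show ?thesis unfolding e unfolding True using ba l ab Pab f2[OF 3] True
          by (simp add: algebra_simps power2_eq_square)
      next
        case neq: False
        show ?thesis
        proof (cases "d = b")
          case True
          show ?thesis unfolding e unfolding True using ba l ab 3 f2[OF 3] neq True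
            by (simp add: algebra_simps power2_eq_square)
        next
          case False
          then show ?thesis unfolding e using \<open>d \<noteq> a\<close> ba l ab 3 f2[OF 3] neq
            by (simp add: algebra_simps power2_eq_square)
        qed
      qed
    qed
  next
    case True
    show ?thesis
    proof (cases "bar b < a")
      case False
      then have "\<not> bar a < b" "\<not> bar a < a" using a b ab by (auto simp: bar_def)
      then show ?thesis unfolding e using True ba False by simp
    next
      case less: True
      then have bn: "bar a < b" "bar b \<le> n" "bar b < b" and an: "bar a < a \<longleftrightarrow> \<not> a \<le> n"
        using a b ab by (auto simp: bar_def)
      have R1: "wt (bar a) * P a (bar a) + (Q^2 - 1) * psum P a = (if bar a < a then Q^2 else 1) * (wt (bar a) * P (bar a) a)"
        using psum_reflect[OF P a] unfolding an by simp
      have R2: "wt b * P (bar b) b + (Q^2 - 1) * psum P (bar b) = wt b * P b (bar b)"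
        using psum_reflect[OF P c] b bn by simp
      have R3: "psum P a = psum P (a - 1) + wt (bar a) * P a (bar a)" by (rule psum_pred[OF a])
      define X where "X = inverse (wt b)"
      have R4: "wt b * X = 1" by (simp add: X_def)
      have p: "P (bar b) b = P b (bar b) - (Q^2 - 1) * psum P (bar b) * X"
        using R2 R4 by Groebner_Basis.algebra
      have g: "(1 - Q^2) * X * (wt (bar a) * P a (bar a) + (Q^2 - 1) * (psum P (a - Suc 0) + wt (bar a) * P a (bar a)) - (if bar a < a then Q^2 else 1) * (wt (bar a) * P (bar a) a)) = 0"
        using R1 R3 by simp
      show ?thesis
      proof (cases "bar a < a")
        case t: True
        show ?thesis
          unfolding e unfolding True divide_inverse X_def[symmetric] p
          by (simp add: ba ab less_imp_neq[OF ab(1)] l less bn(1,3) t) (use g[unfolded if_P[OF t]] in Groebner_Basis.algebra)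
      next
        case t: False
        show ?thesis
          unfolding e unfolding True divide_inverse X_def[symmetric] p
          by (simp add: ba ab less_imp_neq[OF ab(1)] l less bn(1,3) t) (use g[unfolded if_not_P[OF t]] in Groebner_Basis.algebra)
      qed
    qed
  qed
qed

section \<open>The matrices satisfy the relations between x_i and y_i\<close>

text \<open>Writing the row index as \<open>bar e\<close> and multiplying by
  \<open>wt (bar i)\<close> turns every summand after the first into a multiple of
  \<open>P e c\<close> or \<open>P c e\<close>, so that off the line \<open>c = bar e\<close> only
  coefficients have to be compared.\<close>

lemma entry_low:
  assumes i: "i \<in> {1..n}" and c: "c \<in> idx" and e: "e \<in> idx"
  shows "wt (bar i) * entry c (bar e) i (bar i) P =
     (if c = bar e then Q^2 * wt (bar i) * P i (bar i) else 0)
   + (if e = i \<and> c < bar i then (Q^2 - 1) * wt (bar e) * P e c else 0)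
   + (if c = i \<and> e < bar i then (1 - Q^2) * wt e * lam c (bar e) * P c e else 0)
   + (if e = bar i \<and> c < i then (Q^2 - 1) * Q * wt e * P c e else 0)
   + (if c = bar i \<and> e < i then (1 - Q^2) * Q^2 * (wt (bar i) / wt i) * wt e * P e c else 0)
   + (if c < bar i \<and> e < i then (Q^2 - 1) * (1 - Q^2) * (wt (bar i) / wt i) * wt e * P e c else 0)
   + (if c = i \<and> e < i then (1 - Q^2)\<^sup>2 * wt e * P e c else 0)"
proof -
  have I: "i \<in> idx" "bar i \<in> idx" "bar e \<in> idx" using i e by auto
  have less: "i < bar i" "\<not> bar i < i" "i \<noteq> bar i" using i by (auto simp: bar_def)
  have bb: "bar (bar i) = i" "bar (bar e) = e" using i e by auto
  have eq: "bar i = bar e \<longleftrightarrow> e = i" "bar e = bar i \<longleftrightarrow> e = i" "bar e = i \<longleftrightarrow> e = bar i" "i = bar e \<longleftrightarrow> e = bar i" using i e by (auto simp: bar_def)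
  consider "c = i" | "c = bar i" | "c \<noteq> i" "c \<noteq> bar i" by blast
  then show ?thesis
  proof cases
    case 1
    have l: "lam i (bar i) = 1" "lam i i = Q^2" using less by (auto simp: lam_def)
    show ?thesis
      unfolding 1 entry_bar[OF I(1,2,3), of P, unfolded bb(1)] using less eq bb l
      by (simp add: entry_simps split del: if_split)
  next
    case 2
    have l: "lam (bar i) (bar i) = Q^2" "lam i (bar i) = 1" using less by (auto simp: lam_def)
    have cb: "bar i \<noteq> bar (bar i)" using less bb by simp
    show ?thesis
      unfolding 2 entry_generic[OF I(1,2) I(2) I(3) cb] using less eq bb l
      by (simp add: entry_simps split del: if_split)
  next
    case 3
    have cb: "c \<noteq> bar (bar i)" using 3 bb by simp
    have l: "lam (bar i) c = Q" "lam i (bar i) = 1" "lam i c = Q" using 3 less bb by (auto simp: lam_def)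
    have ci: "c < i \<Longrightarrow> c < bar i" using less by simp
    show ?thesis
      unfolding entry_generic[OF I(1,2) c I(3) cb] using less eq bb l 3
      by (simp add: entry_simps split del: if_split)
  qed
qed

lemma entry_high:
  assumes i: "i \<in> {1..n}" and c: "c \<in> idx" and e: "e \<in> idx"
  shows "wt (bar i) * entry c (bar e) (bar i) i P =
     (if c = bar e then Q^2 * wt (bar i) * P (bar i) i else 0)
   + (if e = bar i \<and> c < i then (Q^2 - 1) * wt e * P e c else 0)
   + (if c = bar i \<and> e < i then (1 - Q^2) * (wt (bar i) / wt i) * wt e * lam c (bar e) * P c e else 0)
   + (if e = i \<and> c < bar i then (Q^2 - 1) * lam e c * wt (bar e) * P c e else 0)
   + (if e = i \<and> c < i then (Q^2 - 1)\<^sup>2 * wt (bar e) * P e c else 0)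
   + (if c = i \<and> e < bar i then (1 - Q^2) * Q^2 * wt e * P e c else 0)
   + (if c < i \<and> e < bar i then (Q^2 - 1) * (1 - Q^2) * wt e * P e c else 0)"
proof -
  have I: "i \<in> idx" "bar i \<in> idx" "bar e \<in> idx" using i e by auto
  have less: "i < bar i" "\<not> bar i < i" "i \<noteq> bar i" using i by (auto simp: bar_def)
  have bb: "bar (bar i) = i" "bar (bar e) = e" using i e by auto
  have eq: "bar i = bar e \<longleftrightarrow> e = i" "bar e = bar i \<longleftrightarrow> e = i" "bar e = i \<longleftrightarrow> e = bar i" "i = bar e \<longleftrightarrow> e = bar i" using i e by (auto simp: bar_def)
  consider "c = i" | "c = bar i" | "c \<noteq> i" "c \<noteq> bar i" by blast
  then show ?thesis
  proof cases
    case 1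
    have l: "lam i i = Q^2" "lam (bar i) i = 1" using less bb by (auto simp: lam_def)
    show ?thesis
      unfolding 1 entry_generic[OF I(2,1) I(1) I(3) less(3)] using less eq bb l
      by (simp add: entry_simps split del: if_split)
  next
    case 2
    have l: "lam (bar i) i = 1" "lam (bar i) (bar i) = Q^2" using less bb by (auto simp: lam_def)
    show ?thesis
      unfolding 2 entry_bar[OF I(2,1,3), of P] using less eq bb l
      by (simp add: entry_simps split del: if_split)
  next
    case 3
    have l: "lam (bar i) c = Q" "lam (bar i) i = 1" "lam i c = Q" using 3 less bb by (auto simp: lam_def)
    show ?thesis
      unfolding entry_generic[OF I(2,1) c I(3) 3(2)] using less eq bb l 3
      by (simp add: entry_simps split del: if_split)
  qed
qed

text \<open>Off the line \<open>c = bar e\<close> the defects of \<open>y\<^sub>i x\<^sub>i = q\<^sup>2 x\<^sub>i y\<^sub>i\<close> and of \<open>y\<^sub>i x\<^sub>i = x\<^sub>i y\<^sub>i\<close> for the matrices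
  are multiples of one \<open>P e c\<close>, and the latter at \<open>i\<close> is the former at \<open>i + 1\<close>.\<close>

definition defect :: "nat \<Rightarrow> nat \<Rightarrow> nat \<Rightarrow> (nat \<Rightarrow> nat \<Rightarrow> complex) \<Rightarrow> complex" where
  "defect c e i P = - ((Q^2 - 1)\<^sup>2 * wt e * P e c * ((if c < i \<and> e \<le> bar i then 1 else 0)
     - Q^2 * (wt (bar i) / wt i) * (if c \<le> bar i \<and> e < i then 1 else 0)))"

definition defect_next :: "nat \<Rightarrow> nat \<Rightarrow> nat \<Rightarrow> (nat \<Rightarrow> nat \<Rightarrow> complex) \<Rightarrow> complex" where
  "defect_next c e i P = - ((Q^2 - 1)\<^sup>2 * wt e * P e c * ((if c \<le> i \<and> e < bar i then 1 else 0)
     - (wt (bar i) / wt i) * (if c < bar i \<and> e \<le> i then 1 else 0)))"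

lemma qrel_order:
  assumes "qrel P" "c \<in> idx" "e \<in> idx" "c \<noteq> bar e"
  shows "e < c \<Longrightarrow> P c e = Q * P e c" "c < e \<Longrightarrow> P e c = Q * P c e"
proof -
  have ec: "e \<noteq> bar c" using assms(2-4) by (auto simp: bar_eq_iff)
  show "e < c \<Longrightarrow> P c e = Q * P e c" by (rule qrel_less[OF assms(1,3,2) _ assms(4)])
  show "c < e \<Longrightarrow> P e c = Q * P c e" by (rule qrel_less[OF assms(1,2,3) _ ec])
qed

text \<open>As \<open>c\<close> differs from \<open>bar e\<close>, the factors z_c and z_e coincide
  or q-commute, and everything is a multiple of one product. The coefficient depends only on the
  relative order of \<open>c\<close>, \<open>e\<close>, \<open>i\<close> and \<open>bar i\<close>,
  which the cases enumerate.\<close>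

lemma entry_defect:
  assumes P: "qrel P" and i: "i \<in> {1..n}" and c: "c \<in> idx" and e: "e \<in> idx" and ce: "c \<noteq> bar e"
  shows "wt (bar i) * (entry c (bar e) (bar i) i P - Q^2 * entry c (bar e) i (bar i) P) = defect c e i P"
    and "wt (bar i) * (entry c (bar e) (bar i) i P - entry c (bar e) i (bar i) P) = defect_next c e i P"
proof -
  have less: "i < bar i" "\<not> bar i < i" "i \<noteq> bar i" "bar i \<noteq> i" using i by (auto simp: bar_def)
  define u where "u = wt (bar i) / wt i"
  have w: "wt (bar i) = u * wt i" by (simp add: u_def)
  have bb: "bar (bar i) = i" "bar (bar e) = e" using i e by auto
  have ece: "bar e = c \<Longrightarrow> False" using ce by simp
  note E = entry_low[OF i c e, of P] entry_high[OF i c e, of P]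
  have "wt (bar i) * entry c (bar e) (bar i) i P - Q^2 * (wt (bar i) * entry c (bar e) i (bar i) P) = defect c e i P
      \<and> wt (bar i) * entry c (bar e) (bar i) i P - wt (bar i) * entry c (bar e) i (bar i) P = defect_next c e i P"
  proof -
    consider "e < c" | "e = c" | "c < e" by linarith
    then show ?thesis
    proof cases
      case 1
      have Pce: "P c e = Q * P e c" using qrel_order(1)[OF P c e ce 1] .
      have l: "lam c (bar e) = Q" "lam e c = Q" using 1 ce bb c e by (auto simp: lam_def bar_eq_bar)
      have l: "x = c \<Longrightarrow> y = bar e \<Longrightarrow> lam x y = Q" "x = e \<Longrightarrow> y = c \<Longrightarrow> lam x y = Q"
        and Pce: "x = c \<Longrightarrow> y = e \<Longrightarrow> P x y = Q * P y x" for x y using l Pce by auto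
      consider "e < i" | "e = i" | "i < e" "e < bar i" | "bar i \<le> e" by linarith
      then show ?thesis
      proof cases
        case 1
        consider "c < i" | "c = i" | "i < c" "c < bar i" | "c = bar i" | "bar i < c" by linarith
        then show ?thesis unfolding E unfolding defect_def defect_next_def w
          by cases (use 1 less ce ece in \<open>simp add: Pce l w; simp add: field_simps power2_eq_square\<close>)+
      next
        case 2
        consider "i < c" "c < bar i" | "bar i \<le> c" using 2 \<open>e < c\<close> by linarith
        then show ?thesis unfolding E unfolding defect_def defect_next_def w
          by cases (use 2 less ce ece in \<open>simp add: Pce l w; simp add: field_simps power2_eq_square\<close>)+
      next
        case 3
        then show ?thesis unfolding E unfolding defect_def defect_next_def w using \<open>e < c\<close> less ce ece
          by (simp add: Pce l w; simp add: field_simps power2_eq_square)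
      next
        case 4
        then show ?thesis unfolding E unfolding defect_def defect_next_def w using \<open>e < c\<close> less ce ece
          by (simp add: Pce l w; simp add: field_simps power2_eq_square)
      qed
    next
      case 2
      have l: "lam x (bar x) = 1" "lam x x = Q^2" for x using bar_neq_self[of x] by (auto simp: lam_def)
      consider "c < i" | "c = i" | "i < c" "c < bar i" | "c = bar i" | "bar i < c" by linarith
      then show ?thesis unfolding E unfolding defect_def defect_next_def w
        by cases (use 2 less bb ce ece in \<open>simp add: l w; simp add: field_simps power2_eq_square\<close>)+
    next
      case 3
      have Pec: "P e c = Q * P c e" using qrel_order(2)[OF P c e ce 3] .
      have l: "lam c (bar e) = Q" "lam e c = Q" using 3 ce bb c e by (auto simp: lam_def bar_eq_bar)
      have l: "x = c \<Longrightarrow> y = bar e \<Longrightarrow> lam x y = Q" "x = e \<Longrightarrow> y = c \<Longrightarrow> lam x y = Q"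
        and Pec: "x = e \<Longrightarrow> y = c \<Longrightarrow> P x y = Q * P y x" for x y using l Pec by auto
      consider "c < i" | "c = i" | "i < c" by linarith
      then show ?thesis
      proof cases
        case 1
        consider "e < i" | "e = i" | "i < e" "e < bar i" | "e = bar i" | "bar i < e" by linarith
        then show ?thesis unfolding E unfolding defect_def defect_next_def w
          by cases (use 1 3 less bb ce ece in \<open>simp add: Pec l w; simp add: field_simps power2_eq_square\<close>)+
      next
        case 2
        consider "e < bar i" | "bar i \<le> e" by linarith
        then show ?thesis unfolding E unfolding defect_def defect_next_def w
          by cases (use 2 \<open>c < e\<close> less bb ce ece in \<open>simp add: Pec l w; simp add: field_simps power2_eq_square\<close>)+
      next
        case 3
        then show ?thesis unfolding E unfolding defect_def defect_next_def w using \<open>c < e\<close> less ce ece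
          by (simp add: Pec l w; simp add: field_simps power2_eq_square)
      qed
    qed
  qed
  then show "wt (bar i) * (entry c (bar e) (bar i) i P - Q^2 * entry c (bar e) i (bar i) P) = defect c e i P"
    "wt (bar i) * (entry c (bar e) (bar i) i P - entry c (bar e) i (bar i) P) = defect_next c e i P"
    unfolding right_diff_distrib mult.left_commute[of "wt (bar i)" "Q^2"] by blast+
qed

lemma qrel_cong:
  assumes "\<And>a b. a \<in> idx \<Longrightarrow> b \<in> idx \<Longrightarrow> P a b = R a b"
  shows "qrel P \<longleftrightarrow> qrel R"
proof -
  have "qrel R" if P: "qrel P" and eq: "\<And>a b. a \<in> idx \<Longrightarrow> b \<in> idx \<Longrightarrow> P a b = R a b" for P R
  proof (rule qrelI)
    fix a b assume "a \<in> idx" "b \<in> idx" "a < b" "b \<noteq> bar a"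
    then show "R b a = Q * R a b" using qrel_less[OF P] eq by metis
  next
    assume "0 < n"
    then show "R (bar 1) 1 = Q^2 * R 1 (bar 1)"
      using qrel_bar[OF P, of 1] eq[of "bar 1" 1] eq[of 1 "bar 1"] by auto
  next
    fix i assume "i \<in> {1..<n}"
    then show "R (bar (Suc i)) (Suc i) = Q^2 * R (Suc i) (bar (Suc i)) + Q * (R (bar i) i - R i (bar i))"
      using qrel_bar[OF P, of "Suc i"] eq[of "bar (Suc i)" "Suc i"] eq[of "Suc i" "bar (Suc i)"]
        eq[of "bar i" i] eq[of i "bar i"] by auto
  qed
  from this[of P R] this[of R P] assms show ?thesis by metis
qed

lemma wt_bar_Suc: "i \<in> {1..<n} \<Longrightarrow> wt (bar (Suc i)) * Q = wt (bar i)"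
proof -
  assume i: "i \<in> {1..<n}"
  then have "2 * n + 2 - i = Suc (2 * n + 2 - Suc i)" by auto
  with i show ?thesis by (simp add: wt_bar)
qed

lemma defect_Suc: "i \<in> {1..<n} \<Longrightarrow> defect c e (Suc i) P = defect_next c e i P"
proof -
  assume i: "i \<in> {1..<n}"
  have "wt (Suc i) = Q * wt i" using i by (auto simp: wt_def)
  then have "Q^2 * (wt (bar (Suc i)) / wt (Suc i)) = wt (bar i) / wt i"
    using wt_bar_Suc[OF i] by (simp add: field_simps power2_eq_square)
  moreover have "c < Suc i \<longleftrightarrow> c \<le> i" "e < Suc i \<longleftrightarrow> e \<le> i"
    "e \<le> bar (Suc i) \<longleftrightarrow> e < bar i" "c \<le> bar (Suc i) \<longleftrightarrow> c < bar i"
    using i by (auto simp: bar_def)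
  ultimately show ?thesis by (simp only: defect_def defect_next_def)
qed

lemma entry_same:
  assumes i: "i \<in> {1..n}" and c: "c \<in> idx"
  shows "entry c c i (bar i) P = Q^2 * P i (bar i)" "entry c c (bar i) i P = Q^2 * P (bar i) i"
proof -
  have bb: "bar (bar c) = c" and ec: "bar c \<in> idx" using c by auto
  have less: "i < bar i" using i by (auto simp: bar_def)
  have z: "\<not> (bar c = i \<and> c < bar i)" "\<not> (c = i \<and> bar c < bar i)" "\<not> (bar c = bar i \<and> c < i)"
     "\<not> (c = bar i \<and> bar c < i)" "\<not> (c < bar i \<and> bar c < i)" "\<not> (c = i \<and> bar c < i)"
     "\<not> (bar c = i \<and> c < i)" "\<not> (c < i \<and> bar c < bar i)"
    using i c by (auto simp: bar_def)
  have "wt (bar i) * entry c c i (bar i) P = wt (bar i) * (Q^2 * P i (bar i))"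
    using entry_low[OF i c ec, of P] unfolding bb by (simp only: z if_False if_True simp_thms add_0_right) simp
  then show "entry c c i (bar i) P = Q^2 * P i (bar i)" by simp
  have "wt (bar i) * entry c c (bar i) i P = wt (bar i) * (Q^2 * P (bar i) i)"
    using entry_high[OF i c ec, of P] unfolding bb by (simp only: z if_False if_True simp_thms add_0_right) simp
  then show "entry c c (bar i) i P = Q^2 * P (bar i) i" by simp
qed

lemma qrel_entry:
  assumes P: "qrel P" and c: "c \<in> idx" and d: "d \<in> idx"
  shows "qrel (\<lambda>a b. entry c d a b P)"
proof (rule qrelI)
  fix a b assume ab: "a \<in> idx" "b \<in> idx" "a < b" "b \<noteq> bar a"
  show "entry c d b a P = Q * entry c d a b P"
    using entry_qcomm_bar_left[OF P ab(1,2) d ab(3,4)] entry_qcomm_bar_right[OF P ab(1,2) d ab(3,4)]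
      entry_qcomm_generic[OF P ab(1,2) c d ab(3,4)] by blast
next
  assume "0 < n"
  then have i: "1 \<in> {1..n}" by auto
  show "entry c d (bar 1) 1 P = Q^2 * entry c d 1 (bar 1) P"
  proof (cases "c = d")
    case True
    then show ?thesis using entry_same[OF i c, of P] qrel_bar[OF P i] by simp
  next
    case False
    have e: "bar d \<in> idx" "bar (bar d) = d" using d by auto
    \<comment> \<open>No index lies below 1, so both conditions in \<open>defect\<close>
      fail.\<close>
    have "defect c (bar d) 1 P = 0" using c e by (auto simp: defect_def)
    moreover have "c \<noteq> bar (bar d)" using False e by simp
    ultimately show ?thesis using entry_defect(1)[OF P i c e(1)] unfolding e(2) by simp
  qed
next
  fix i assume i0: "i \<in> {1..<n}"
  then have i: "i \<in> {1..n}" "Suc i \<in> {1..n}" by auto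
  show "entry c d (bar (Suc i)) (Suc i) P = Q^2 * entry c d (Suc i) (bar (Suc i)) P
      + Q * (entry c d (bar i) i P - entry c d i (bar i) P)"
  proof (cases "c = d")
    case True
    then show ?thesis
      using entry_same[OF i(1) c, of P] entry_same[OF i(2) c, of P] qrel_bar[OF P i(2)] i0
      by (simp add: algebra_simps)
  next
    case False
    have e: "bar d \<in> idx" "bar (bar d) = d" using d by auto
    have ne: "c \<noteq> bar (bar d)" using False e by simp
    \<comment> \<open>The first defect at i + 1 equals the second defect at i, which is why the
      telescoped form of the relations suits the matrices.\<close>
    have "wt (bar (Suc i)) * (entry c d (bar (Suc i)) (Suc i) P - Q^2 * entry c d (Suc i) (bar (Suc i)) P)
       = wt (bar (Suc i)) * (Q * (entry c d (bar i) i P - entry c d i (bar i) P))"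
      using entry_defect(1)[OF P i(2) c e(1) ne] entry_defect(2)[OF P i(1) c e(1) ne]
      unfolding e(2) defect_Suc[OF i0] wt_bar_Suc[OF i0, symmetric]
      by (simp add: mult.assoc)
    then have "entry c d (bar (Suc i)) (Suc i) P - Q^2 * entry c d (Suc i) (bar (Suc i)) P
       = Q * (entry c d (bar i) i P - entry c d i (bar i) P)" by simp
    then show ?thesis by (simp add: algebra_simps)
  qed
qed

lemma sum_pick: "d \<in> idx \<Longrightarrow> (\<Sum>d0\<in>idx. if d = d0 then f d0 else 0) = (f d :: complex)"
  by simp

text \<open>The Yang-Baxter type compatibility with the z-relations, summed over all rows
  \<open>d\<close>. For \<open>c\<close> outside \<open>idx\<close> each crossing is just
  multiplication by Q.\<close>

lemma qrel_cross:
  assumes G: "\<And>d. qrel (G d)"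
  shows "qrel (\<lambda>a b. cross b c (\<lambda>e y. cross a e (\<lambda>d x. G d x y)))"
proof (cases "c \<in> idx")
  case True
  have "cross b c (\<lambda>e y. cross a e (\<lambda>d x. G d x y)) = (\<Sum>d\<in>idx. entry c d a b (G d))"
    if ab: "a \<in> idx" "b \<in> idx" for a b
  proof -
    have "cross b c (\<lambda>e y. cross a e (\<lambda>d x. G d x y))
       = cross b c (\<lambda>e y. cross a e (\<lambda>d x. \<Sum>d0\<in>idx. if d = d0 then G d0 x y else 0))"
    proof (rule cross_cong[OF ab(2)], rule cross_cong[OF ab(1)])
      fix e y d x assume "d = e \<or> d \<in> idx" "e = c \<or> e \<in> idx"
      then have "d \<in> idx" using True by auto
      then show "G d x y = (\<Sum>d0\<in>idx. if d = d0 then G d0 x y else 0)" by (rule sum_pick[symmetric])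
    qed
    then show ?thesis by (simp only: cross_sum entry_def)
  qed
  then show ?thesis
    by (subst qrel_cong) (auto intro!: qrel_sum qrel_entry[OF G] True)
next
  case False
  have l: "cross a c F = Q * F c a" if "a \<in> idx" for a F
  proof -
    have "c \<noteq> a" "c \<noteq> bar a" "\<not> (0 < c \<and> c < a)" using that False bar_idx[OF that] by auto
    then show ?thesis by (auto simp: cross_def lam_def)
  qed
  have "cross b c (\<lambda>e y. cross a e (\<lambda>d x. G d x y)) = Q * (Q * G c a b)"
    if "a \<in> idx" "b \<in> idx" for a b
    using that by (simp only: l)
  then show ?thesis
    by (subst qrel_cong) (auto intro!: qrel_scale G)
qed

text \<open>The elements \<open>w\<^sub>a\<close> satisfy the same relations as the \<open>z\<^sub>a\<close>, and reversing products while
  replacing \<open>a\<close> by \<open>bar a\<close> exchanges the two roles; hence the second compatibility is the first.\<close>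

lemma qrel_cross_dual:
  assumes G: "\<And>b. qrel (\<lambda>d1 d2. G d1 d2 b)" and a: "a \<in> idx"
  shows "qrel (\<lambda>c1 c2. cross a c1 (\<lambda>d1 e. cross e c2 (\<lambda>d2 b. G d1 d2 b)))"
proof -
  define H where "H b x y = G (bar y) (bar x) (bar b)" for b x y
  have H: "qrel (H b)" for b
    unfolding H_def using qrel_bar_swap[OF G[of "bar b"]] .
  have "cross a c1 (\<lambda>d1 e. cross e c2 (\<lambda>d2 b. G d1 d2 b))
     = cross (bar c1) (bar a) (\<lambda>e y. cross (bar c2) e (\<lambda>d x. H d x y))"
    if c: "c1 \<in> idx" "c2 \<in> idx" for c1 c2
  proof -
    have "cross a c1 (\<lambda>d1 e. cross e c2 (\<lambda>d2 b. G d1 d2 b))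
       = cross a c1 (\<lambda>d1 e. cross (bar c2) (bar e) (\<lambda>d2 b. G d1 (bar b) (bar d2)))"
      using c(2) by (intro cross_cong[OF a] cross_dual) auto
    also have "\<dots> = cross (bar c1) (bar a) (\<lambda>d1 e. cross (bar c2) (bar (bar d1)) (\<lambda>d2 b. G (bar e) (bar b) (bar d2)))"
      by (rule cross_dual[OF a c(1)])
    also have "\<dots> = cross (bar c1) (bar a) (\<lambda>e y. cross (bar c2) e (\<lambda>d x. H d x y))"
    proof (rule cross_cong)
      show "bar c1 \<in> idx" using c by simp
      fix d x assume "d = bar a \<or> d \<in> idx"
      then have "bar (bar d) = d" using a by auto
      then show "cross (bar c2) (bar (bar d)) (\<lambda>d2 b. G (bar x) (bar b) (bar d2)) = cross (bar c2) d (\<lambda>d xa. H d xa x)"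
        by (simp add: H_def)
    qed
    finally show ?thesis .
  qed
  moreover have "qrel (\<lambda>c1 c2. cross (bar c1) (bar a) (\<lambda>e y. cross (bar c2) e (\<lambda>d x. H d x y)))"
    using qrel_bar_swap[OF qrel_cross[OF H, of "bar a"]] .
  ultimately show ?thesis by (subst qrel_cong)
qed

section \<open>Centrality of the symplectic pairing\<close>

text \<open>Compares the coefficients of w_d in z_a C and C z_a, where C is the sum of
  \<open>wt b\<close> w_{bar b} z_b. At \<open>d = a\<close> the exchange terms add up to
  \<open>psum P (a - 1)\<close> and \<open>psum_reflect\<close> applies; elsewhere one q-commutation
  suffices.\<close>

lemma center_pick:
  assumes P: "qrel P" and a: "a \<in> idx" and d: "d \<in> idx"
  shows "(\<Sum>b\<in>idx. wt b * cross a (bar b) (\<lambda>d' x. if d' = d then P x b else 0)) = wt (bar d) * P (bar d) a"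
proof -
  have s1: "(\<Sum>b\<in>idx. wt b * (if bar b = d then lam a (bar b) * P a b else 0)) = wt (bar d) * (lam a d * P a (bar d))"
  proof -
    have "(\<Sum>b\<in>idx. wt b * (if bar b = d then lam a (bar b) * P a b else 0))
      = (\<Sum>b\<in>idx. if b = bar d then wt (bar d) * (lam a d * P a (bar d)) else 0)"
    proof (rule sum.cong[OF refl])
      fix b assume b: "b \<in> idx"
      have "bar b = d \<longleftrightarrow> b = bar d" using bar_eq_iff[OF b d] .
      moreover have "bar (bar d) = d" using d by simp
      ultimately show "wt b * (if bar b = d then lam a (bar b) * P a b else 0) =
         (if b = bar d then wt (bar d) * (lam a d * P a (bar d)) else 0)" by simp
    qed
    then show ?thesis using d by simp
  qed
  have s2: "(\<Sum>b\<in>idx. wt b * (if d = a \<and> 0 < bar b \<and> bar b < a then (Q^2 - 1) * P (bar b) b else 0))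
     = (if d = a then (Q^2 - 1) * psum P (a - 1) else 0)"
  proof -
    have "(\<Sum>b\<in>idx. if 0 < bar b \<and> bar b < a then wt b * P (bar b) b else 0)
       = (\<Sum>b\<in>{b \<in> idx. 0 < bar b \<and> bar b < a}. wt b * P (bar b) b)"
      by (rule sum.inter_filter[symmetric]) simp
    also have "\<dots> = psum P (a - 1)"
      unfolding psum_def using a
      by (intro sum.reindex_bij_witness[of _ bar bar]) (auto simp: bar_def)
    finally have *: "(\<Sum>b\<in>idx. if 0 < bar b \<and> bar b < a then wt b * P (bar b) b else 0) = psum P (a - 1)" .
    have "(\<Sum>b\<in>idx. wt b * (if a = a \<and> 0 < bar b \<and> bar b < a then (Q^2 - 1) * P (bar b) b else 0))
      = (Q^2 - 1) * psum P (a - 1)"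
      unfolding *[symmetric] sum_distrib_left by (intro sum.cong) auto
    then show ?thesis by auto
  qed
  have s3: "(\<Sum>b\<in>idx. wt b * (if bar b = bar a \<and> bar d < a then (1 - Q^2) * (wt (bar d) / wt a * P (bar d) b) else 0))
     = (if bar d < a then (1 - Q^2) * (wt (bar d) * P (bar d) a) else 0)"
  proof -
    have "(\<Sum>b\<in>idx. wt b * (if bar b = bar a \<and> bar d < a then (1 - Q^2) * (wt (bar d) / wt a * P (bar d) b) else 0))
      = (\<Sum>b\<in>idx. if b = a then (if bar d < a then (1 - Q^2) * (wt (bar d) * P (bar d) a) else 0) else 0)"
    proof (rule sum.cong[OF refl])
      fix b assume b: "b \<in> idx"
      have "bar b = bar a \<longleftrightarrow> b = a" using bar_eq_bar[OF b a] .
      then show "wt b * (if bar b = bar a \<and> bar d < a then (1 - Q^2) * (wt (bar d) / wt a * P (bar d) b) else 0) =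
         (if b = a then (if bar d < a then (1 - Q^2) * (wt (bar d) * P (bar d) a) else 0) else 0)" by simp
    qed
    then show ?thesis using a by simp
  qed
  have e: "(\<Sum>b\<in>idx. wt b * cross a (bar b) (\<lambda>d' x. if d' = d then P x b else 0)) =
      wt (bar d) * (lam a d * P a (bar d)) + (if d = a then (Q^2 - 1) * psum P (a - 1) else 0)
      + (if bar d < a then (1 - Q^2) * (wt (bar d) * P (bar d) a) else 0)"
    unfolding cross_pick[OF a d] distrib_left sum.distrib s1 s2 s3 ..
  consider "d = a" | "d = bar a" "d \<noteq> a" | "d \<noteq> a" "d \<noteq> bar a" by blast
  then show ?thesis
  proof cases
    case 1
    have R1: "wt (bar a) * P a (bar a) + (Q^2 - 1) * psum P a = (if bar a < a then Q^2 else 1) * (wt (bar a) * P (bar a) a)"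
      using psum_reflect[OF P a] a by (auto simp: bar_def)
    have R2: "psum P a = psum P (a - 1) + wt (bar a) * P a (bar a)" using psum_Suc[of P "a - 1"] a by simp
    have l: "lam a a = Q^2" by (simp add: lam_def)
    show ?thesis unfolding e unfolding 1 l using R1 unfolding R2 by (auto simp: algebra_simps)
  next
    case 2
    have "bar (bar a) = a" "lam a (bar a) = 1" using a bar_neq_self[of a] by (auto simp: lam_def)
    then show ?thesis unfolding e unfolding 2(1) using bar_neq_self[of a] by simp
  next
    case 3
    have l: "lam a d = Q" using 3 by (simp add: lam_def)
    have ne: "bar d \<noteq> a" "a \<noteq> bar (bar d)" "bar d \<noteq> bar a" using 3 a d by (auto simp: bar_eq_iff bar_eq_bar)
    have "bar d < a \<Longrightarrow> P a (bar d) = Q * P (bar d) a"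
      using qrel_less[OF P bar_idx[OF d] a] ne by simp
    moreover have "\<not> bar d < a \<Longrightarrow> P (bar d) a = Q * P a (bar d)"
      using qrel_less[OF P a bar_idx[OF d]] ne by simp
    ultimately show ?thesis unfolding e l using 3
      by (auto simp: algebra_simps power2_eq_square)
  qed
qed

lemma center_cross:
  assumes P: "\<And>d. qrel (P d)" and a: "a \<in> idx"
  shows "(\<Sum>b\<in>idx. wt b * cross a (bar b) (\<lambda>d x. P d x b)) = (\<Sum>b\<in>idx. wt b * P (bar b) b a)"
proof -
  have "(\<Sum>b\<in>idx. wt b * cross a (bar b) (\<lambda>d x. P d x b))
     = (\<Sum>b\<in>idx. \<Sum>d0\<in>idx. wt b * cross a (bar b) (\<lambda>d x. if d = d0 then P d0 x b else 0))"
  proof (rule sum.cong[OF refl])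
    fix b assume b: "b \<in> idx"
    have "cross a (bar b) (\<lambda>d x. P d x b)
        = cross a (bar b) (\<lambda>d x. \<Sum>d0\<in>idx. if d = d0 then P d0 x b else 0)"
    proof (rule cross_cong[OF a])
      fix d x assume "d = bar b \<or> d \<in> idx"
      then have "d \<in> idx" using b by auto
      then show "P d x b = (\<Sum>d0\<in>idx. if d = d0 then P d0 x b else 0)" by (rule sum_pick[symmetric])
    qed
    then show "wt b * cross a (bar b) (\<lambda>d x. P d x b)
      = (\<Sum>d0\<in>idx. wt b * cross a (bar b) (\<lambda>d x. if d = d0 then P d0 x b else 0))"
      by (simp only: cross_sum sum_distrib_left)
  qed
  also have "\<dots> = (\<Sum>d0\<in>idx. \<Sum>b\<in>idx. wt b * cross a (bar b) (\<lambda>d x. if d = d0 then P d0 x b else 0))"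
    by (rule sum.swap)
  also have "\<dots> = (\<Sum>d\<in>idx. wt (bar d) * P d (bar d) a)"
    using center_pick[OF P a] by (intro sum.cong) auto
  also have "\<dots> = (\<Sum>b\<in>idx. wt b * P (bar b) b a)"
    by (intro sum.reindex_bij_witness[of _ bar bar]) auto
  finally show ?thesis .
qed

lemma center_cross_dual:
  assumes P: "\<And>e. qrel (\<lambda>x y. P x y e)" and g: "g \<in> idx"
  shows "(\<Sum>b\<in>idx. wt b * cross b g (\<lambda>d e. P (bar b) d e)) = (\<Sum>b\<in>idx. wt b * P g (bar b) b)"
proof -
  have "(\<Sum>b\<in>idx. wt b * cross b g (\<lambda>d e. P (bar b) d e))
     = (\<Sum>b\<in>idx. wt b * cross (bar g) (bar b) (\<lambda>d x. P (bar b) (bar x) (bar d)))"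
    using g by (intro sum.cong refl) (simp add: cross_dual[of _ g])
  also have "\<dots> = (\<Sum>b\<in>idx. wt b * P (bar (bar g)) (bar b) (bar (bar b)))"
    using center_cross[of "\<lambda>d x b. P (bar b) (bar x) (bar d)" "bar g"] qrel_bar_swap[OF P] g by simp
  also have "\<dots> = (\<Sum>b\<in>idx. wt b * P g (bar b) b)"
    using g by (intro sum.cong) auto
  finally show ?thesis .
qed

end

section \<open>The quantum torus\<close>

type_synonym torus = "(nat \<Rightarrow> int) \<times> (nat \<Rightarrow> int)"

definition bump :: "nat \<Rightarrow> int \<Rightarrow> (nat \<Rightarrow> int) \<Rightarrow> nat \<Rightarrow> int" where
  "bump k d f = f(k := f k + d)"

lemma bump_commute: "bump k d (bump l e f) = bump l e (bump k d f)"
  by (auto simp: bump_def fun_eq_iff)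

lemma bump_bump: "bump k d (bump k e f) = bump k (d + e) f" "bump k 0 f = f"
  by (auto simp: bump_def fun_eq_iff)

context qsphere begin

definition tail_sum :: "nat \<Rightarrow> (nat \<Rightarrow> int) \<Rightarrow> int" where
  "tail_sum i \<alpha> = (\<Sum>j\<in>{i<..n}. \<alpha> j)"

definition init_sum :: "nat \<Rightarrow> (nat \<Rightarrow> int) \<Rightarrow> int" where
  "init_sum i \<alpha> = (\<Sum>j\<in>{1..i}. \<alpha> j)"

lemma tail_sum_bump: "tail_sum i (bump j d \<alpha>) = tail_sum i \<alpha> + (if i < j \<and> j \<le> n then d else 0)"
proof -
  have "tail_sum i (bump j d \<alpha>) = (\<Sum>k\<in>{i<..n}. \<alpha> k + (if k = j then d else 0))"
    unfolding tail_sum_def bump_def by (intro sum.cong) auto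
  then show ?thesis by (simp add: tail_sum_def sum.distrib)
qed

lemma init_sum_bump: "init_sum i (bump j d \<alpha>) = init_sum i \<alpha> + (if 1 \<le> j \<and> j \<le> i then d else 0)"
proof -
  have "init_sum i (bump j d \<alpha>) = (\<Sum>k\<in>{1..i}. \<alpha> k + (if k = j then d else 0))"
    unfolding init_sum_def bump_def by (intro sum.cong) auto
  then show ?thesis by (simp add: init_sum_def sum.distrib)
qed

text \<open>The point \<open>(\<alpha>, \<beta>)\<close> stands for \<open>x\<^sub>n\<^bsup>\<alpha> n\<^esup> \<dots> x\<^sub>1\<^bsup>\<alpha> 1\<^esup> \<omega>\<^sub>1\<^bsup>\<beta> 1\<^esup> \<dots> \<omega>\<^sub>n\<^bsup>\<beta> n\<^esup>\<close>, where \<open>\<omega>\<^sub>i = \<Sum>\<^bsub>k \<le> i\<^esub> q\<^sup>-\<^sup>k x\<^sub>k y\<^sub>k\<close>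
  satisfies \<open>\<omega>\<^sub>j x\<^sub>i = q\<^sup>2 x\<^sub>i \<omega>\<^sub>j\<close> for \<open>i \<le> j\<close> and commutes with \<open>x\<^sub>i\<close> otherwise. The operators act on
  functions of points, that is, dually.\<close>

definition opx :: "nat \<Rightarrow> (torus \<Rightarrow> complex) \<Rightarrow> torus \<Rightarrow> complex" where
  "opx i \<phi> = (\<lambda>(\<alpha>, \<beta>). inverse (Q powi tail_sum i \<alpha>) * \<phi> (bump i 1 \<alpha>, \<beta>))"

text \<open>Left multiplication by y_i: the squared powers arise from moving omega_i and omega_{i-1}
  past the x-part, the power of \<open>tail_sum\<close> from inserting the inverse of x_i. The case
  distinction encodes omega_0 = 0.\<close>

definition opy :: "nat \<Rightarrow> (torus \<Rightarrow> complex) \<Rightarrow> torus \<Rightarrow> complex" where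
  "opy i \<phi> = (\<lambda>(\<alpha>, \<beta>). Q ^ i * Q powi tail_sum i \<alpha>
     * ((Q powi init_sum i \<alpha>)\<^sup>2 * \<phi> (bump i (- 1) \<alpha>, bump i 1 \<beta>)
        - (if i = 1 then 0 else
            (Q powi init_sum (i - 1) \<alpha>)\<^sup>2 * \<phi> (bump i (- 1) \<alpha>, bump (i - 1) 1 \<beta>))))"

definition opz :: "nat \<Rightarrow> (torus \<Rightarrow> complex) \<Rightarrow> torus \<Rightarrow> complex" where
  "opz a = (if a \<le> n then opx a else opy (bar a))"

lemma powi_Suc: "Q powi (k + 1) = Q powi k * Q" "Q powi (1 + k) = Q powi k * Q" "Q powi (k - 1) = Q powi k * inverse Q" "Q powi (k + - 1) = Q powi k * inverse Q"
  by (simp_all add: power_int_add power_int_diff field_simps)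

lemma opx_opx: "i < j \<Longrightarrow> j \<le> n \<Longrightarrow> opx i (opx j \<phi>) p = Q * opx j (opx i \<phi>) p"
  by (cases p) (simp add: opx_def tail_sum_bump powi_Suc bump_commute field_simps)

lemma opx_opy:
  assumes "i \<in> {1..n}" "j \<in> {1..n}" "i \<noteq> j"
  shows "opx j (opy i \<phi>) p = Q * opy i (opx j \<phi>) p"
proof (cases "i < j")
  case True
  then have "\<not> j \<le> i - 1" by simp
  with True assms show ?thesis
    by (cases p) (simp add: opx_def opy_def tail_sum_bump init_sum_bump powi_Suc bump_commute field_simps power2_eq_square)
next
  case False
  then have "j < i" "j \<le> i - 1" using assms by auto
  with False assms show ?thesis
    by (cases p) (simp add: opx_def opy_def tail_sum_bump init_sum_bump powi_Suc bump_commute field_simps power2_eq_square)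
qed

lemma opy_opy:
  assumes "i < j" "1 \<le> i" "j \<le> n"
  shows "opy j (opy i \<phi>) p = Q * opy i (opy j \<phi>) p"
proof -
  have "\<not> j \<le> i" "\<not> j \<le> i - 1" "i \<le> j - 1" "j \<noteq> 1" "\<not> j < i" using assms by auto
  with assms show ?thesis
    by (cases p) (simp add: opy_def tail_sum_bump init_sum_bump powi_Suc bump_commute field_simps power2_eq_square)
qed

text \<open>The two products differ by Q^i (Q^2 - 1) omega_i, and y_i x_i - Q^2 x_i y_i is Q^i (Q^2
  - 1) omega_{i-1}. This yields the telescoped relation at once.\<close>

lemma opx_opy_same:
  assumes "i \<in> {1..n}"
  shows "opx i (opy i \<phi>) (\<alpha>, \<beta>) = Q ^ i * (Q^2 * (Q powi init_sum i \<alpha>)\<^sup>2 * \<phi> (\<alpha>, bump i 1 \<beta>)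
        - (if i = 1 then 0 else (Q powi init_sum (i - 1) \<alpha>)\<^sup>2 * \<phi> (\<alpha>, bump (i - 1) 1 \<beta>)))"
    and "opy i (opx i \<phi>) (\<alpha>, \<beta>) = Q ^ i * ((Q powi init_sum i \<alpha>)\<^sup>2 * \<phi> (\<alpha>, bump i 1 \<beta>)
        - (if i = 1 then 0 else (Q powi init_sum (i - 1) \<alpha>)\<^sup>2 * \<phi> (\<alpha>, bump (i - 1) 1 \<beta>)))"
proof -
  have "\<not> i \<le> i - 1" using assms by auto
  then show "opx i (opy i \<phi>) (\<alpha>, \<beta>) = Q ^ i * (Q^2 * (Q powi init_sum i \<alpha>)\<^sup>2 * \<phi> (\<alpha>, bump i 1 \<beta>)
        - (if i = 1 then 0 else (Q powi init_sum (i - 1) \<alpha>)\<^sup>2 * \<phi> (\<alpha>, bump (i - 1) 1 \<beta>)))"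
    and "opy i (opx i \<phi>) (\<alpha>, \<beta>) = Q ^ i * ((Q powi init_sum i \<alpha>)\<^sup>2 * \<phi> (\<alpha>, bump i 1 \<beta>)
        - (if i = 1 then 0 else (Q powi init_sum (i - 1) \<alpha>)\<^sup>2 * \<phi> (\<alpha>, bump (i - 1) 1 \<beta>)))"
    using assms by (simp_all add: opx_def opy_def tail_sum_bump init_sum_bump powi_Suc bump_bump field_simps power2_eq_square)
qed

text \<open>The order of the operators is reversed because they act on functions: the value at
  \<open>p\<close> is \<phi> at z_a z_b times \<open>p\<close>.\<close>

lemma qrel_opz: "qrel (\<lambda>a b. opz b (opz a \<phi>) p)"
proof (rule qrelI)
  fix a b assume ab: "a \<in> idx" "b \<in> idx" "a < b" "b \<noteq> bar a"
  consider "b \<le> n" | "a \<le> n" "\<not> b \<le> n" | "\<not> a \<le> n" by linarith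
  then show "opz a (opz b \<phi>) p = Q * opz b (opz a \<phi>) p"
  proof cases
    case 1
    then show ?thesis using ab opx_opx[of a b] by (simp add: opz_def)
  next
    case 2
    then have "bar b \<in> {1..n}" "a \<in> {1..n}" "bar b \<noteq> a" using ab by (auto simp: bar_def)
    then show ?thesis using 2 opx_opy[of "bar b" a] by (simp add: opz_def)
  next
    case 3
    then have "bar b < bar a" "1 \<le> bar b" "bar a \<le> n" "\<not> b \<le> n" using ab by (auto simp: bar_def)
    then show ?thesis using 3 opy_opy[of "bar b" "bar a"] by (simp add: opz_def)
  qed
next
  assume "0 < n"
  then have 1: "1 \<in> {1..n}" "\<not> bar 1 \<le> n" "bar (bar 1) = 1" by (auto simp: bar_def)
  obtain \<alpha> \<beta> where p: "p = (\<alpha>, \<beta>)" by fastforce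
  show "opz 1 (opz (bar 1) \<phi>) p = Q^2 * opz (bar 1) (opz 1 \<phi>) p"
    using 1 opx_opy_same[OF 1(1), of \<phi> \<alpha> \<beta>] by (simp add: opz_def p)
next
  fix i assume i0: "i \<in> {1..<n}"
  then have i: "i \<in> {1..n}" "Suc i \<in> {1..n}" "\<not> bar i \<le> n" "\<not> bar (Suc i) \<le> n"
    "bar (bar i) = i" "bar (bar (Suc i)) = Suc i" by (auto simp: bar_def)
  obtain \<alpha> \<beta> where p: "p = (\<alpha>, \<beta>)" by fastforce
  show "opz (Suc i) (opz (bar (Suc i)) \<phi>) p = Q^2 * opz (bar (Suc i)) (opz (Suc i) \<phi>) p
      + Q * (opz i (opz (bar i) \<phi>) p - opz (bar i) (opz i \<phi>) p)"
    using i i0 opx_opy_same[OF i(1), of \<phi> \<alpha> \<beta>] opx_opy_same[OF i(2), of \<phi> \<alpha> \<beta>]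
    by (simp add: opz_def p) (simp add: field_simps power2_eq_square)
qed

primrec ev :: "nat list \<Rightarrow> (torus \<Rightarrow> complex) \<Rightarrow> torus \<Rightarrow> complex" where
  "ev [] \<phi> = \<phi>"
| "ev (a # f) \<phi> = ev f (opz a \<phi>)"

lemma ev_append: "ev (u @ v) \<phi> = ev v (ev u \<phi>)"
  by (induction u arbitrary: \<phi>) simp_all

lemma opz_add: "opz a (\<lambda>p. \<phi> p + \<psi> p) = (\<lambda>p. opz a \<phi> p + opz a \<psi> p)"
  by (auto simp: fun_eq_iff opz_def opx_def opy_def algebra_simps)

lemma opz_scale: "opz a (\<lambda>p. x * \<phi> p) = (\<lambda>p. x * opz a \<phi> p)"
  by (auto simp: fun_eq_iff opz_def opx_def opy_def algebra_simps)

lemma ev_add: "ev f (\<lambda>p. \<phi> p + \<psi> p) = (\<lambda>p. ev f \<phi> p + ev f \<psi> p)"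
  by (induction f arbitrary: \<phi> \<psi>) (simp_all add: opz_add)

lemma ev_scale: "ev f (\<lambda>p. x * \<phi> p) = (\<lambda>p. x * ev f \<phi> p)"
  by (induction f arbitrary: \<phi>) (simp_all add: opz_scale)

lemma qrel_linear:
  assumes add: "\<And>f g. L (\<lambda>p. f p + g p) = L f + L g" and scale: "\<And>x f. L (\<lambda>p. x * f p) = x * L f"
    and F: "\<And>p. qrel (\<lambda>a b. F a b p)"
  shows "qrel (\<lambda>a b. L (F a b) :: complex)"
proof (rule qrelI)
  fix a b assume "a \<in> idx" "b \<in> idx" "a < b" "b \<noteq> bar a"
  then have "F b a = (\<lambda>p. Q * F a b p)" using qrel_less[OF F] by blast
  then show "L (F b a) = Q * L (F a b)" by (simp add: scale)
next
  assume "0 < n"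
  then have "F (bar 1) 1 = (\<lambda>p. Q^2 * F 1 (bar 1) p)"
    using qrel_bar[OF F, of 1] by (auto simp: fun_eq_iff)
  then show "L (F (bar 1) 1) = Q^2 * L (F 1 (bar 1))" by (simp add: scale)
next
  fix i assume "i \<in> {1..<n}"
  then have "F (bar (Suc i)) (Suc i) = (\<lambda>p. Q^2 * F (Suc i) (bar (Suc i)) p
     + (Q * F (bar i) i p + (- Q) * F i (bar i) p))"
    using qrel_bar[OF F, of "Suc i"] by (auto simp: fun_eq_iff algebra_simps)
  then show "L (F (bar (Suc i)) (Suc i)) = Q^2 * L (F (Suc i) (bar (Suc i)))
      + Q * (L (F (bar i) i) - L (F i (bar i)))"
    by (simp only: add scale) (simp add: algebra_simps)
qed

lemma qrel_ev: "qrel (\<lambda>a b. ev (u @ a # b # v) \<phi> p)"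
proof -
  have "qrel (\<lambda>a b. ev v (opz b (opz a (ev u \<phi>))) p)"
    by (rule qrel_linear[of "\<lambda>f. ev v f p"]) (simp_all add: ev_add ev_scale qrel_opz)
  then show ?thesis by (simp add: ev_append)
qed

section \<open>Leading terms in the torus\<close>

text \<open>The weights make \<open>\<omega>\<^sub>i\<close> dominate \<open>\<omega>\<^bsub>i-1\<^esub>\<close> in \<open>y\<^sub>i\<close>, and \<open>x\<^sub>n\<close> dominate all other generators and \<open>1\<close>.\<close>

definition level :: "torus \<Rightarrow> int" where
  "level = (\<lambda>(\<alpha>, \<beta>). (int n + 1) * \<alpha> n + (\<Sum>i\<in>{1..n}. int i * \<beta> i))"

definition shift :: "nat \<Rightarrow> torus \<Rightarrow> torus" where
  "shift a = (\<lambda>(\<alpha>, \<beta>). if a \<le> n then (bump a 1 \<alpha>, \<beta>)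
     else (bump (bar a) (- 1) \<alpha>, bump (bar a) 1 \<beta>))"

text \<open>For y_n the inverse of x_n contributes - (n + 1) and omega_n contributes n, hence - 1.
  Every generator other than x_n stays below n + 1.\<close>

definition level_of :: "nat \<Rightarrow> int" where
  "level_of a = (if a = n then int n + 1 else if a \<le> n then 0 else if bar a = n then - 1 else int (bar a))"

lemma weighted_sum_upd:
  "j \<in> {1..n} \<Longrightarrow> (\<Sum>i\<in>{1..n}. int i * bump j 1 \<beta> i) = (\<Sum>i\<in>{1..n}. int i * \<beta> i) + int j"
proof -
  assume j: "j \<in> {1..n}"
  have "(\<Sum>i\<in>{1..n}. int i * bump j 1 \<beta> i) = (\<Sum>i\<in>{1..n}. int i * \<beta> i + (if i = j then int j else 0))"
    by (intro sum.cong) (auto simp: bump_def algebra_simps)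
  then show ?thesis using j by (simp add: sum.distrib)
qed

lemma level_shift: "a \<in> idx \<Longrightarrow> level (shift a p) = level p + level_of a"
proof (cases p)
  case (Pair \<alpha> \<beta>)
  assume a: "a \<in> idx"
  show ?thesis
  proof (cases "a \<le> n")
    case True
    then show ?thesis by (auto simp: Pair level_def shift_def level_of_def bump_def algebra_simps)
  next
    case False
    then have "bar a \<in> {1..n}" using a by (auto simp: bar_def)
    then show ?thesis using False weighted_sum_upd[of "bar a" \<beta>]
      unfolding Pair level_def shift_def level_of_def split
      by (auto simp: bump_def[of _ _ \<alpha>] algebra_simps)
  qed
qed

text \<open>Leading terms in dual form: a function vanishing below the level of
  \<open>shift a p\<close> sees only the top term of z_a times \<open>p\<close>, with a coefficient
  that does not depend on the function.\<close>

lemma opz_leading: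
  assumes a: "a \<in> idx"
  shows "\<exists>u. u \<noteq> 0 \<and> (\<forall>\<phi>. (\<forall>p'. level p' < level (shift a p) \<longrightarrow> \<phi> p' = 0) \<longrightarrow> opz a \<phi> p = u * \<phi> (shift a p))"
proof (cases p)
  case (Pair \<alpha> \<beta>)
  show ?thesis
  proof (cases "a \<le> n")
    case True
    then show ?thesis unfolding Pair
      by (intro exI[of _ "inverse (Q powi tail_sum a \<alpha>)"]) (simp add: opz_def opx_def shift_def)
  next
    case False
    define i where "i = bar a"
    have i: "i \<in> {1..n}" using False a by (auto simp: i_def bar_def)
    have "level (bump i (- 1) \<alpha>, bump (i - 1) 1 \<beta>) < level (shift a p)" if "i \<noteq> 1"
    proof -
      have "i - 1 \<in> {1..n}" using that i by auto
      then show ?thesis using i that False weighted_sum_upd[of i \<beta>] weighted_sum_upd[of "i - 1" \<beta>]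
        unfolding Pair shift_def level_def split i_def[symmetric] by simp
    qed
    then have "opz a \<phi> p = Q ^ i * Q powi tail_sum i \<alpha> * (Q powi init_sum i \<alpha>)\<^sup>2 * \<phi> (shift a p)"
      if "\<forall>p'. level p' < level (shift a p) \<longrightarrow> \<phi> p' = 0" for \<phi>
      using that False by (auto simp: opz_def opy_def Pair i_def[symmetric] shift_def)
    then show ?thesis
      by (intro exI[of _ "Q ^ i * Q powi tail_sum i \<alpha> * (Q powi init_sum i \<alpha>)\<^sup>2"]) simp
  qed
qed

primrec lead :: "nat list \<Rightarrow> torus" where
  "lead [] = (\<lambda>_. 0, \<lambda>_. 0)"
| "lead (a # f) = shift a (lead f)"

lemma ev_leading:
  assumes "set f \<subseteq> idx"
  shows "\<exists>u. u \<noteq> 0 \<and> (\<forall>\<phi>. (\<forall>p'. level p' < level (lead f) \<longrightarrow> \<phi> p' = 0)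
    \<longrightarrow> ev f \<phi> (\<lambda>_. 0, \<lambda>_. 0) = u * \<phi> (lead f))"
  using assms
proof (induction f)
  case Nil
  show ?case by (intro exI[of _ 1]) simp
next
  case (Cons a f)
  then have a: "a \<in> idx" by simp
  from Cons obtain u where u: "u \<noteq> 0"
    "\<And>\<phi>. \<forall>p'. level p' < level (lead f) \<longrightarrow> \<phi> p' = 0 \<Longrightarrow> ev f \<phi> (\<lambda>_. 0, \<lambda>_. 0) = u * \<phi> (lead f)"
    by auto
  from opz_leading[OF a] obtain v where v: "\<And>p. v p \<noteq> 0"
    "\<And>p \<phi>. \<forall>p'. level p' < level (shift a p) \<longrightarrow> \<phi> p' = 0 \<Longrightarrow> opz a \<phi> p = v p * \<phi> (shift a p)"
    by metis
  have "ev (a # f) \<phi> (\<lambda>_. 0, \<lambda>_. 0) = u * v (lead f) * \<phi> (lead (a # f))"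
    if 0: "\<forall>p'. level p' < level (lead (a # f)) \<longrightarrow> \<phi> p' = 0" for \<phi>
  proof -
    \<comment> \<open>A generator raises all levels by the same amount, so the vanishing condition
      passes from \<phi> to \<open>opz a \<phi>\<close>.\<close>
    have "opz a \<phi> p' = 0" if "level p' < level (lead f)" for p'
    proof -
      have "level (shift a p') < level (lead (a # f))" using that a by (simp add: level_shift)
      then show ?thesis using v(2)[of p' \<phi>] 0 by auto
    qed
    then show ?thesis using u(2)[of "opz a \<phi>"] v(2)[of "lead f" \<phi>] 0 by simp
  qed
  then show ?case using u(1) v(1) by (intro exI[of _ "u * v (lead f)"]) simp
qed

text \<open>The coefficient at \<open>p\<close> of the word \<open>f\<close> expanded in the torus,
  the origin being the unit.\<close>

definition coord :: "torus \<Rightarrow> nat list \<Rightarrow> complex" where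
  "coord p f = ev f (\<lambda>p'. if p' = p then 1 else 0) (\<lambda>_. 0, \<lambda>_. 0)"

lemma coord_lead: "set f \<subseteq> idx \<Longrightarrow> coord (lead f) f \<noteq> 0"
  using ev_leading[of f] by (auto simp: coord_def)

lemma coord_eq_0: "set f \<subseteq> idx \<Longrightarrow> level (lead f) \<le> level p \<Longrightarrow> lead f \<noteq> p \<Longrightarrow> coord p f = 0"
  using ev_leading[of f] unfolding coord_def by (smt (verit) mult_not_zero)

text \<open>The leading point thus remembers how often each generator occurs: y_i alone changes the
  second component. Ordered words with the same leading point therefore agree.\<close>

lemma lead_count:
  assumes "set f \<subseteq> idx" "i \<in> {1..n}"
  shows "fst (lead f) i = int (count_list f i) - int (count_list f (bar i)) \<and>
    snd (lead f) i = int (count_list f (bar i))"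
  using assms(1)
proof (induction f)
  case (Cons a f)
  then have a: "a \<in> idx" by simp
  moreover have "bar a = i \<longleftrightarrow> a = bar i" using a assms(2) by (intro bar_eq_iff) auto
  moreover have "\<not> bar i \<le> n" using assms(2) by (auto simp: bar_def)
  ultimately show ?case
    using Cons assms(2) by (auto simp: shift_def bump_def split: prod.splits)
qed auto

section \<open>Functionals on the braided product\<close>

text \<open>A functional gives values to products of a word in the \<open>w\<^sub>a\<close> and a word in the \<open>z\<^sub>a\<close>; the algebra
  acts on functionals from the right.\<close>

type_synonym functional = "nat list \<Rightarrow> nat list \<Rightarrow> complex"

text \<open>Moving z_a through a word of w's creates a linear combination of words. Passing a
  continuation that is evaluated on each outcome avoids formal sums.\<close>

primrec push :: "nat \<Rightarrow> nat list \<Rightarrow> (nat list \<Rightarrow> nat \<Rightarrow> complex) \<Rightarrow> complex" where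
  "push a [] k = k [] a"
| "push a (c # t) k = cross a c (\<lambda>d b. push b t (\<lambda>t' b'. k (d # t') b'))"

lemma push_cong:
  "a \<in> idx \<Longrightarrow> (\<And>t' b. b \<in> idx \<Longrightarrow> k t' b = k' t' b) \<Longrightarrow> push a t k = push a t k'"
proof (induction t arbitrary: a k k')
  case (Cons c t)
  show ?case unfolding push.simps
    using Cons.prems by (intro cross_cong Cons.IH) auto
qed simp

lemma push_add: "push a t (\<lambda>t' b. k t' b + k' t' b) = push a t k + push a t k'"
  by (induction t arbitrary: a k k') (simp_all add: cross_add)

lemma push_scale: "push a t (\<lambda>t' b. x * k t' b) = x * push a t k"
  by (induction t arbitrary: a k) (simp_all add: cross_scale)

lemma push_zero: "push a t (\<lambda>t' b. 0) = 0"
  using push_scale[of a t 0] by simp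

lemma push_sum: "push a t (\<lambda>t' b. \<Sum>j\<in>J. k j t' b) = (\<Sum>j\<in>J. push a t (k j))"
  by (induction J rule: infinite_finite_induct) (simp_all add: push_add push_zero)

lemma push_append:
  "push a (u @ v) k = push a u (\<lambda>u' b. push b v (\<lambda>v' b'. k (u' @ v') b'))"
  by (induction u arbitrary: a k) simp_all

lemma push_cross:
  "push b t (\<lambda>t' b'. cross a e (\<lambda>d x. F t' b' d x)) = cross a e (\<lambda>d x. push b t (\<lambda>t' b'. F t' b' d x))"
  unfolding cross_def if_zero_of_bool by (simp only: push_add push_scale push_sum)

lemma qrel_if: "(C \<Longrightarrow> qrel P) \<Longrightarrow> qrel (\<lambda>x y. if C then P x y else 0)"
  by (cases C) (simp_all only: if_True if_False qrel_zero)

lemma qrel_push: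
  assumes "\<And>t' b. b \<in> idx \<Longrightarrow> qrel (\<lambda>x y. F x y t' b)" and a: "a \<in> idx"
  shows "qrel (\<lambda>x y. push a t (F x y))"
proof -
  \<comment> \<open>\<open>qrel_linear\<close> wants the relations at every argument, while they are
    given only for \<open>b\<close> in \<open>idx\<close>; cutting off elsewhere is harmless by
    \<open>push_cong\<close>.\<close>
  define G where "G x y p = (if snd p \<in> idx then F x y (fst p) (snd p) else 0)" for x y p
  have "qrel (\<lambda>x y. push a t (\<lambda>t' b. G x y (t', b)))"
  proof (rule qrel_linear[of "\<lambda>g. push a t (\<lambda>t' b. g (t', b))"])
    show "qrel (\<lambda>x y. G x y p)" for p
      unfolding G_def by (intro qrel_if assms(1))
  qed (simp_all add: push_add push_scale)
  moreover have "push a t (\<lambda>t' b. G x y (t', b)) = push a t (F x y)" for x y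
    using a by (intro push_cong) (auto simp: G_def)
  ultimately show ?thesis by simp
qed

text \<open>These are the linear functionals on the tensor product of two quantum symplectic spaces,
  described by their values on words.\<close>

definition good :: "functional \<Rightarrow> bool" where
  "good k \<longleftrightarrow> (\<forall>u v f. qrel (\<lambda>a b. k (u @ a # b # v) f)) \<and> (\<forall>t u v. qrel (\<lambda>a b. k t (u @ a # b # v)))"

lemma goodD:
  "good k \<Longrightarrow> qrel (\<lambda>a b. k (u @ a # b # v) f)" "good k \<Longrightarrow> qrel (\<lambda>a b. k t (u @ a # b # v))"
  "good k \<Longrightarrow> qrel (\<lambda>a b. k (a # b # v) f)" "good k \<Longrightarrow> qrel (\<lambda>a b. k t (a # b # v))"
proof -
  assume k: "good k"
  then show 1: "qrel (\<lambda>a b. k (u @ a # b # v) f)" "qrel (\<lambda>a b. k t (u @ a # b # v))" for u v f t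
    by (simp_all add: good_def)
  show "qrel (\<lambda>a b. k (a # b # v) f)" "qrel (\<lambda>a b. k t (a # b # v))"
    using 1(1)[of "[]" v f] 1(2)[of t "[]" v] by simp_all
qed

lemma good_add: "good k \<Longrightarrow> good k' \<Longrightarrow> good (\<lambda>t f. k t f + k' t f)"
  by (simp add: good_def qrel_add)

lemma good_scale: "good k \<Longrightarrow> good (\<lambda>t f. x * k t f)"
  by (simp add: good_def qrel_scale)

lemma good_zero: "good (\<lambda>t f. 0)"
  by (simp add: good_def qrel_zero)

definition Lw :: "nat \<Rightarrow> functional \<Rightarrow> functional" where "Lw c k = (\<lambda>t f. k (c # t) f)"

definition Lz :: "nat \<Rightarrow> functional \<Rightarrow> functional" where
  "Lz a k = (\<lambda>t f. push a t (\<lambda>t' b. k t' (b # f)))"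

lemma good_Lw:
  assumes "good k" shows "good (Lw c k)"
  using goodD(1)[OF assms, of "c # _"] goodD(2)[OF assms] by (simp add: good_def Lw_def)

text \<open>For a relation inside the w-word, z_a passes the prefix, meets the two letters in
  question, where \<open>qrel_cross_dual\<close> applies, and passes the rest. A relation inside the
  z-word only acquires a letter in front.\<close>

lemma good_Lz:
  assumes k: "good k" and a: "a \<in> idx"
  shows "good (Lz a k)"
  unfolding good_def
proof (intro conjI allI)
  fix u v f
  have "qrel (\<lambda>x y. push a u (\<lambda>u' e. push e (x # y # v) (\<lambda>v' b'. k (u' @ v') (b' # f))))"
  proof (rule qrel_push[OF _ a])
    fix u' e assume e: "e \<in> idx"
    have "qrel (\<lambda>x y. cross e x (\<lambda>d1 e1. cross e1 y (\<lambda>d2 b.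
        if b \<in> idx then push b v (\<lambda>v' b'. k (u' @ d1 # d2 # v') (b' # f)) else 0)))"
    proof (rule qrel_cross_dual[OF _ e])
      fix b
      show "qrel (\<lambda>d1 d2. if b \<in> idx then push b v (\<lambda>v' b'. k (u' @ d1 # d2 # v') (b' # f)) else 0)"
        by (intro qrel_if qrel_push goodD(1)[OF k])
    qed
    moreover have "cross e x (\<lambda>d1 e1. cross e1 y (\<lambda>d2 b.
        if b \<in> idx then push b v (\<lambda>v' b'. k (u' @ d1 # d2 # v') (b' # f)) else 0))
      = push e (x # y # v) (\<lambda>v' b'. k (u' @ v') (b' # f))" for x y
      unfolding push.simps using e by (intro cross_cong) auto
    ultimately show "qrel (\<lambda>x y. push e (x # y # v) (\<lambda>v' b'. k (u' @ v') (b' # f)))" by simp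
  qed
  then show "qrel (\<lambda>x y. Lz a k (u @ x # y # v) f)" by (simp only: Lz_def push_append)
next
  fix t u v
  show "qrel (\<lambda>x y. Lz a k t (u @ x # y # v))"
    unfolding Lz_def using goodD(2)[OF k, of _ "_ # u" v] by (intro qrel_push[OF _ a]) simp
qed

text \<open>Two z's cross the word letter by letter: \<open>push_cross\<close> lets the second one
  start before the first has finished, and \<open>qrel_cross\<close> treats one letter.\<close>

lemma qrel_push_push:
  assumes "\<And>t. qrel (G t)"
  shows "qrel (\<lambda>a b. push b t (\<lambda>t' b'. push a t' (\<lambda>t'' a'. G t'' a' b')))"
  using assms
proof (induction t arbitrary: G)
  case (Cons c t)
  have "qrel (\<lambda>a b. cross b c (\<lambda>e b1. cross a e (\<lambda>d a1.
      push b1 t (\<lambda>t' b'. push a1 t' (\<lambda>t'' a'. G (d # t'') a' b')))))"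
    by (rule qrel_cross) (rule Cons.IH, rule Cons.prems)
  then show ?case by (simp only: push.simps push_cross)
qed simp

lemma Lz_Lz: "good k \<Longrightarrow> qrel (\<lambda>a b. Lz b (Lz a k) t f)"
  unfolding Lz_def by (rule qrel_push_push) (rule goodD)

lemma Lw_Lw: "good k \<Longrightarrow> qrel (\<lambda>a b. Lw b (Lw a k) t f)"
  unfolding Lw_def by (rule goodD)

lemma Lw_Lz: "Lw c (Lz a k) t f = cross a c (\<lambda>d b. Lz b (Lw d k) t f)"
  by (simp add: Lw_def Lz_def)

text \<open>Multiplication by the symplectic pairing. Since functionals carry a right action,
  applying \<open>Lw\<close> before \<open>Lz\<close> stands for w_{bar b} z_b.\<close>

definition Lc :: "functional \<Rightarrow> functional" where
  "Lc k t f = (\<Sum>b\<in>idx. wt b * Lz b (Lw (bar b) k) t f)"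

lemma Lc_Lw:
  assumes k: "good k" and g: "g \<in> idx"
  shows "Lc (Lw g k) = Lw g (Lc k)"
proof (intro ext)
  fix t f
  define P where "P x y e = (if e \<in> idx then push e t (\<lambda>t' e'. k (x # y # t') (e' # f)) else 0)" for x y e
  have "qrel (\<lambda>x y. P x y e)" for e
    unfolding P_def by (intro qrel_if qrel_push goodD(3)[OF k])
  from center_cross_dual[OF this g]
  have "(\<Sum>b\<in>idx. wt b * cross b g (\<lambda>d e. P (bar b) d e)) = (\<Sum>b\<in>idx. wt b * P g (bar b) b)" .
  moreover have "cross b g (\<lambda>d e. P (bar b) d e)
      = cross b g (\<lambda>d e. push e t (\<lambda>t' e'. k (bar b # d # t') (e' # f)))" if "b \<in> idx" for b
    using that by (intro cross_cong) (auto simp: P_def)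
  ultimately show "Lc (Lw g k) t f = Lw g (Lc k) t f"
    unfolding Lc_def Lw_def Lz_def push.simps by (simp add: P_def)
qed

lemma Lc_Lz:
  assumes k: "good k" and a: "a \<in> idx"
  shows "Lc (Lz a k) = Lz a (Lc k)"
proof (intro ext)
  fix t f
  define P where "P d x b = push b t (\<lambda>t' e. push x t' (\<lambda>t'' x'. k (d # t'') (x' # e # f)))" for d x b
  have "qrel (P d)" for d
    unfolding P_def by (rule qrel_push_push) (rule goodD(4)[OF k])
  from center_cross[OF this a]
  have "(\<Sum>b\<in>idx. wt b * cross a (bar b) (\<lambda>d x. P d x b)) = (\<Sum>b\<in>idx. wt b * P (bar b) b a)" .
  then show "Lc (Lz a k) t f = Lz a (Lc k) t f"
    unfolding Lc_def Lw_def Lz_def push.simps P_def push_cross push_sum push_scale .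
qed

text \<open>Undoes the telescoping and recovers the relation for y_i x_i as it occurs among the
  relators.\<close>

lemma qrel_bar_sum:
  assumes P: "qrel P" and i: "i \<in> {1..n}"
  shows "P (bar i) i = Q^2 * P i (bar i) + (Q^2 - 1) * (\<Sum>k\<in>{1..<i}. Q ^ (i - k) * P k (bar k))"
proof -
  have w: "wt (bar k) = wt (bar i) * Q ^ (i - k)" if "k \<in> {1..i}" for k
  proof -
    have "2 * n + 2 - k = (2 * n + 2 - i) + (i - k)" using that i by auto
    then show ?thesis using wt_bar[of k] wt_bar[OF i] that i by (simp add: power_add)
  qed
  have "psum P i = wt (bar i) * (\<Sum>k\<in>{1..i}. Q ^ (i - k) * P k (bar k))"
    unfolding psum_def sum_distrib_left by (rule sum.cong[OF refl]) (subst w, simp_all only: mult.assoc)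
  also have "{1..i} = insert i {1..<i}" using i by auto
  finally have "psum P i = wt (bar i) * (P i (bar i) + (\<Sum>k\<in>{1..<i}. Q ^ (i - k) * P k (bar k)))"
    by simp
  with psum_low[OF P i]
  have "wt (bar i) * (P (bar i) i - P i (bar i))
     = wt (bar i) * ((Q^2 - 1) * (P i (bar i) + (\<Sum>k\<in>{1..<i}. Q ^ (i - k) * P k (bar k))))"
    by (simp only: mult.left_commute)
  then have "P (bar i) i - P i (bar i) = (Q^2 - 1) * (P i (bar i) + (\<Sum>k\<in>{1..<i}. Q ^ (i - k) * P k (bar k)))"
    by (simp only: mult_cancel_left wt_nonzero simp_thms)
  then show ?thesis by (simp add: algebra_simps)
qed

end

section \<open>The action of the free algebra on functionals\<close>

abbreviation mon :: "free_monoid \<Rightarrow> free_alg" where "mon w \<equiv> Poly_Mapping.single w 1"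

abbreviation supp :: "free_alg \<Rightarrow> free_monoid set" where "supp \<equiv> Poly_Mapping.keys"

lemma adj_sum: "adj (\<Sum>j\<in>J. a j) = (\<Sum>j\<in>J. adj (a j))"
  by (induction J rule: infinite_finite_induct) (simp_all add: adj_plus)

lemma adj_generators [simp]: "adj (gx i) = gxs i" "adj (gy i) = gys i" "adj (gxs i) = gx i" "adj (gys i) = gy i"
  by (simp_all add: gxs_def gys_def)

lemma adj_one [simp]: "adj 1 = 1"
proof -
  have "word_adj 0 = 0" by (simp add: word_adj_def zero_free_monoid_def)
  then show ?thesis using adj_single[of 0 1] by simp
qed

definition sphere_element :: "nat \<Rightarrow> free_alg" where
  "sphere_element n = (\<Sum>i\<in>{1..n}. gxs i * gx i + gys i * gy i)"

text \<open>All relators except the sphere relation, which is the only inhomogeneous one and is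
  imposed at the very end.\<close>

definition hom_relators :: "real \<Rightarrow> nat \<Rightarrow> free_alg set" where
  "hom_relators q n = (let Q = complex_of_real q in
     {gx i * gx j - inverse Q \<cdot>\<^sub>f (gx j * gx i) | i j. i \<in> {1..n} \<and> j \<in> {1..n} \<and> i < j}
   \<union> {gy i * gy j - Q \<cdot>\<^sub>f (gy j * gy i) | i j. i \<in> {1..n} \<and> j \<in> {1..n} \<and> j > i}
   \<union> {gy j * gx i - Q \<cdot>\<^sub>f (gx i * gy j) | i j. i \<in> {1..n} \<and> j \<in> {1..n} \<and> i \<noteq> j}
   \<union> {gy i * gx i - (Q^2 \<cdot>\<^sub>f (gx i * gy i)
        + (Q^2 - 1) \<cdot>\<^sub>f (\<Sum>k\<in>{1..<i}. Q^(i-k) \<cdot>\<^sub>f (gx k * gy k))) | i. i \<in> {1..n}}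
   \<union> {gx i * gxs i - (gxs i * gx i + (1 - Q^2) \<cdot>\<^sub>f (\<Sum>k\<in>{1..<i}. gxs k * gx k)) | i. i \<in> {1..n}}
   \<union> {gy i * gys i - (gys i * gy i + (1 - Q^2) \<cdot>\<^sub>f
        (Q^(2*(n+1-i)) \<cdot>\<^sub>f (gxs i * gx i) + (\<Sum>k\<in>{1..n}. gxs k * gx k)
         + (\<Sum>k\<in>{i+1..n}. gys k * gy k))) | i. i \<in> {1..n}}
   \<union> {gx i * gys i - Q^2 \<cdot>\<^sub>f (gys i * gx i) | i. i \<in> {1..n}}
   \<union> {gx i * gxs j - Q \<cdot>\<^sub>f (gxs j * gx i) | i j. i \<in> {1..n} \<and> j \<in> {1..n} \<and> i \<noteq> j}
   \<union> {gy i * gys j - (Q \<cdot>\<^sub>f (gys j * gy i) - ((Q^2 - 1) * Q^(2*n+2-i-j)) \<cdot>\<^sub>f (gxs i * gx j))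
        | i j. i \<in> {1..n} \<and> j \<in> {1..n} \<and> i \<noteq> j}
   \<union> {gx i * gys j - Q \<cdot>\<^sub>f (gys j * gx i) | i j. i \<in> {1..n} \<and> j \<in> {1..n} \<and> i < j}
   \<union> {gx i * gys j - (Q \<cdot>\<^sub>f (gys j * gx i) + ((Q^2 - 1) * Q^(i-j)) \<cdot>\<^sub>f (gys i * gx j))
        | i j. i \<in> {1..n} \<and> j \<in> {1..n} \<and> i > j})"

lemma sphere_relators_eq: "sphere_relators q n = hom_relators q n \<union> {sphere_element n - 1}"
  by (simp only: sphere_relators_def hom_relators_def sphere_element_def Let_def Un_assoc)

context qsphere begin

text \<open>The adjoint of z_a is w_{bar a} divided by \<open>wt (bar a)\<close>, and 1 /
  \<open>wt (bar a)\<close> equals - \<open>wt a\<close> / Q^(2n+2).\<close>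

definition Ls :: "nat \<Rightarrow> functional \<Rightarrow> functional" where
  "Ls a k = (\<lambda>t f. - (wt a / Q ^ (2 * n + 2)) * Lw (bar a) k t f)"

primrec act :: "letter \<Rightarrow> functional \<Rightarrow> functional" where
  "act (LX i) = Lz i"
| "act (LY i) = Lz (bar i)"
| "act (LXadj i) = Ls i"
| "act (LYadj i) = Ls (bar i)"

text \<open>A right action, with (k a)(m) = k(a m); hence the first letter acts first.\<close>

primrec act_word :: "letter list \<Rightarrow> functional \<Rightarrow> functional" where
  "act_word [] k = k"
| "act_word (l # w) k = act_word w (act l k)"

definition act_alg :: "free_alg \<Rightarrow> functional \<Rightarrow> functional" where
  "act_alg a k = (\<lambda>t f. \<Sum>w\<in>supp a. Poly_Mapping.lookup a w * act_word (letters w) k t f)"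

lemma Lz_add: "Lz a (\<lambda>t f. k t f + k' t f) = (\<lambda>t f. Lz a k t f + Lz a k' t f)"
  by (simp add: Lz_def push_add)

lemma Lz_scale: "Lz a (\<lambda>t f. x * k t f) = (\<lambda>t f. x * Lz a k t f)"
  by (simp add: Lz_def push_scale)

lemma act_add: "act l (\<lambda>t f. k t f + k' t f) = (\<lambda>t f. act l k t f + act l k' t f)"
  by (cases l) (simp_all add: Lz_add Ls_def Lw_def algebra_simps add_divide_distrib)

lemma act_scale: "act l (\<lambda>t f. x * k t f) = (\<lambda>t f. x * act l k t f)"
  by (cases l) (simp_all add: Lz_scale Ls_def Lw_def algebra_simps)

lemma act_word_add: "act_word w (\<lambda>t f. k t f + k' t f) = (\<lambda>t f. act_word w k t f + act_word w k' t f)"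
  by (induction w arbitrary: k k') (simp_all add: act_add)

lemma act_word_scale: "act_word w (\<lambda>t f. x * k t f) = (\<lambda>t f. x * act_word w k t f)"
  by (induction w arbitrary: k) (simp_all add: act_scale)

lemma act_word_append: "act_word (u @ v) k = act_word v (act_word u k)"
  by (induction u arbitrary: k) simp_all

lemma act_alg_superset:
  assumes "finite S" "supp a \<subseteq> S"
  shows "act_alg a k t f = (\<Sum>w\<in>S. Poly_Mapping.lookup a w * act_word (letters w) k t f)"
  unfolding act_alg_def using assms by (intro sum.mono_neutral_left) (auto simp: in_keys_iff)

lemma act_alg_zero [simp]: "act_alg 0 k = (\<lambda>t f. 0)"
  by (simp add: act_alg_def)

lemma act_alg_plus: "act_alg (a + b) k = (\<lambda>t f. act_alg a k t f + act_alg b k t f)"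
proof (intro ext)
  fix t f
  let ?S = "supp a \<union> supp b"
  have "supp (a + b) \<subseteq> ?S" by (rule keys_add)
  then show "act_alg (a + b) k t f = act_alg a k t f + act_alg b k t f"
    by (simp add: act_alg_superset[of ?S] lookup_add sum.distrib algebra_simps)
qed

lemma act_alg_single: "act_alg (Poly_Mapping.single w c) k = (\<lambda>t f. c * act_word (letters w) k t f)"
  by (intro ext, subst act_alg_superset[of "{w}"]) simp_all

lemma act_alg_add: "act_alg a (\<lambda>t f. k t f + k' t f) = (\<lambda>t f. act_alg a k t f + act_alg a k' t f)"
  by (simp add: act_alg_def act_word_add algebra_simps sum.distrib)

lemma act_alg_scale: "act_alg a (\<lambda>t f. x * k t f) = (\<lambda>t f. x * act_alg a k t f)"
  by (simp add: act_alg_def act_word_scale algebra_simps sum_distrib_left)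

lemma act_alg_zero_right [simp]: "act_alg a (\<lambda>t f. 0) = (\<lambda>t f. 0)"
  using act_alg_scale[of a 0] by simp

lemma act_alg_mult: "act_alg (a * b) k = act_alg b (act_alg a k)"
proof (induction a rule: free_alg_induct)
  case (single u c)
  show ?case
  proof (induction b rule: free_alg_induct)
    case (single v d)
    then show ?case
      by (simp add: mult_single act_alg_single plus_free_monoid_def act_word_append act_word_scale mult_ac)
  qed (simp_all add: act_alg_plus distrib_left)
qed (simp_all add: act_alg_plus act_alg_add distrib_right)

lemma act_alg_one [simp]: "act_alg 1 k = k"
  using act_alg_single[of 0 1 k] by (simp only: single_one) (simp add: zero_free_monoid_def)

lemma act_alg_fscale: "act_alg (x \<cdot>\<^sub>f a) k = (\<lambda>t f. x * act_alg a k t f)"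
  by (simp add: fscale_def act_alg_mult act_alg_single zero_free_monoid_def act_alg_scale)

lemma act_alg_minus: "act_alg (a - b) k = (\<lambda>t f. act_alg a k t f - act_alg b k t f)"
  using act_alg_plus[of "a - b" b k] by (auto simp: fun_eq_iff)

lemma act_alg_sum: "act_alg (\<Sum>j\<in>J. a j) k = (\<lambda>t f. \<Sum>j\<in>J. act_alg (a j) k t f)"
  by (induction J rule: infinite_finite_induct) (simp_all add: act_alg_plus)

lemma act_alg_generators:
  "act_alg (gx i) k = Lz i k" "act_alg (gy i) k = Lz (bar i) k"
  "act_alg (gxs i) k = Ls i k" "act_alg (gys i) k = Ls (bar i) k"
  by (simp_all add: gx_def gy_def gxs_def gys_def adj_single act_alg_single word_adj_def)

lemmas act_alg_simps = act_alg_minus act_alg_plus act_alg_fscale act_alg_sum act_alg_mult act_alg_generators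

lemma Lz_Ls: "Lz a (Ls b k) t f = - (wt b / Q ^ (2 * n + 2)) * Lz a (Lw (bar b) k) t f"
  unfolding Ls_def Lz_scale ..

lemma Ls_Lz: "Ls b (Lz a k) t f = - (wt b / Q ^ (2 * n + 2)) * cross a (bar b) (\<lambda>d x. Lz x (Lw d k) t f)"
  unfolding Ls_def Lw_Lz ..

lemma Ls_Ls: "Ls b (Ls a k) t f = (wt a / Q ^ (2 * n + 2)) * (wt b / Q ^ (2 * n + 2)) * Lw (bar b) (Lw (bar a) k) t f"
  by (simp add: Ls_def Lw_def)

lemma bar_facts:
  assumes "i \<in> {1..n}" "j \<in> {1..n}"
  shows "i < bar i" "j < bar j" "i < bar j" "j < bar i" "bar (bar i) = i" "bar (bar j) = j" "0 < bar j"
    "bar i < bar j \<longleftrightarrow> j < i" "bar j < bar i \<longleftrightarrow> i < j" "bar i = bar j \<longleftrightarrow> i = j" "bar j = bar i \<longleftrightarrow> i = j"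
  using assms by (auto simp: bar_def)

lemma cross_values:
  assumes "i \<in> {1..n}" and "j \<in> {1..n}"
  shows "cross i (bar i) G = G (bar i) i + (1 - Q^2) * (\<Sum>k\<in>{1..<i}. wt k / wt i * G (bar k) k)"
    and "i \<noteq> j \<Longrightarrow> cross i (bar j) G = Q * G (bar j) i"
    and "cross i i G = Q^2 * G i i"
    and "i \<noteq> j \<Longrightarrow> cross i j G = Q * G j i + (if j < i then (Q^2 - 1) * G i j else 0)"
    and "cross (bar i) (bar i) G = Q^2 * G (bar i) (bar i)"
    and "i \<noteq> j \<Longrightarrow> cross (bar i) (bar j) G = Q * G (bar j) (bar i) + (if i < j then (Q^2 - 1) * G (bar i) (bar j) else 0)"
    and "cross (bar i) i G = G i (bar i) + (Q^2 - 1) * G (bar i) i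
        + (1 - Q^2) * (\<Sum>k\<in>{1..<bar i}. wt k / wt (bar i) * G (bar k) k)"
    and "i \<noteq> j \<Longrightarrow> cross (bar i) j G = Q * G j (bar i) + (Q^2 - 1) * G (bar i) j"
  using assms bar_facts[OF assms] by (simp_all add: cross_def lam_def)

lemma wt_mult:
  assumes "i \<in> {1..n}" "j \<in> {1..n}"
  shows "wt (bar i) = - (Q ^ (2 * (n + 1 - i)) * wt i)"
    and "wt (bar j) = - (Q ^ (2 * n + 2 - i - j) * wt i)"
    and "j < i \<Longrightarrow> wt (bar j) = Q ^ (i - j) * wt (bar i)"
    and "j < i \<Longrightarrow> wt i = Q ^ (i - j) * wt j"
proof -
  have "2 * n + 2 - i = 2 * (n + 1 - i) + i" "2 * n + 2 - j = (2 * n + 2 - i - j) + i"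
    "j < i \<Longrightarrow> 2 * n + 2 - j = (i - j) + (2 * n + 2 - i)" "j < i \<Longrightarrow> i = (i - j) + j"
    using assms by auto
  then show "wt (bar i) = - (Q ^ (2 * (n + 1 - i)) * wt i)"
    and "wt (bar j) = - (Q ^ (2 * n + 2 - i - j) * wt i)"
    and "j < i \<Longrightarrow> wt (bar j) = Q ^ (i - j) * wt (bar i)"
    and "j < i \<Longrightarrow> wt i = Q ^ (i - j) * wt j"
    using assms by (simp_all only: wt_bar mult_minus_right power_add[symmetric]) (auto simp: wt_def simp flip: power_add)
qed

section \<open>The quadratic relators act as zero\<close>

abbreviation kills :: "free_alg \<Rightarrow> bool" where
  "kills r \<equiv> (\<forall>k t f. good k \<longrightarrow> act_alg r k t f = 0)"

lemma qrel_generators: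
  assumes "qrel P" "i \<in> {1..n}" "j \<in> {1..n}"
  shows "i < j \<Longrightarrow> P j i = Q * P i j" "i < j \<Longrightarrow> P (bar i) (bar j) = Q * P (bar j) (bar i)"
    "i \<noteq> j \<Longrightarrow> P (bar j) i = Q * P i (bar j)"
proof -
  have "bar i \<in> idx" "bar j \<in> idx" "i \<in> idx" "j \<in> idx" "i < bar j" "bar (bar i) = i" "bar (bar j) = j"
    "i < j \<Longrightarrow> bar j < bar i" "j \<noteq> bar i" "bar j = bar i \<longleftrightarrow> i = j" "bar i \<noteq> j"
    using assms by (auto simp: bar_def)
  then show "i < j \<Longrightarrow> P j i = Q * P i j" "i < j \<Longrightarrow> P (bar i) (bar j) = Q * P (bar j) (bar i)"
    "i \<noteq> j \<Longrightarrow> P (bar j) i = Q * P i (bar j)"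
    using qrel_less[OF assms(1), of i j] qrel_less[OF assms(1), of "bar j" "bar i"]
      qrel_less[OF assms(1), of i "bar j"] by auto
qed

lemma kills_xx:
  assumes "i \<in> {1..n}" "j \<in> {1..n}" "i < j"
  shows "kills (gx i * gx j - inverse Q \<cdot>\<^sub>f (gx j * gx i))" "kills (gxs j * gxs i - inverse Q \<cdot>\<^sub>f (gxs i * gxs j))"
  using assms qrel_generators(1)[OF Lz_Lz assms(1,2)] qrel_generators(2)[OF Lw_Lw assms(1,2)]
  by (auto simp: act_alg_simps Ls_Ls) (simp add: field_simps)

lemma kills_yy:
  assumes "i \<in> {1..n}" "j \<in> {1..n}" "i < j"
  shows "kills (gy i * gy j - Q \<cdot>\<^sub>f (gy j * gy i))" "kills (gys j * gys i - Q \<cdot>\<^sub>f (gys i * gys j))"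
  using assms qrel_generators(2)[OF Lz_Lz assms(1,2)] qrel_generators(1)[OF Lw_Lw assms(1,2)]
  by (auto simp: act_alg_simps Ls_Ls)

lemma kills_yx:
  assumes "i \<in> {1..n}" "j \<in> {1..n}" "i \<noteq> j"
  shows "kills (gy j * gx i - Q \<cdot>\<^sub>f (gx i * gy j))" "kills (gxs i * gys j - Q \<cdot>\<^sub>f (gys j * gxs i))"
  using assms qrel_generators(3)[OF Lz_Lz assms(1,2)] qrel_generators(3)[OF Lw_Lw assms(2,1)]
  by (auto simp: act_alg_simps Ls_Ls)

lemma kills_yx_same:
  assumes i: "i \<in> {1..n}"
  shows "kills (gy i * gx i - (Q^2 \<cdot>\<^sub>f (gx i * gy i)
        + (Q^2 - 1) \<cdot>\<^sub>f (\<Sum>k\<in>{1..<i}. Q^(i-k) \<cdot>\<^sub>f (gx k * gy k))))"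
    and "kills (gxs i * gys i - (Q^2 \<cdot>\<^sub>f (gys i * gxs i)
        + (Q^2 - 1) \<cdot>\<^sub>f (\<Sum>k\<in>{1..<i}. Q^(i-k) \<cdot>\<^sub>f (gys k * gxs k))))"
proof -
  show "kills (gy i * gx i - (Q^2 \<cdot>\<^sub>f (gx i * gy i)
        + (Q^2 - 1) \<cdot>\<^sub>f (\<Sum>k\<in>{1..<i}. Q^(i-k) \<cdot>\<^sub>f (gx k * gy k))))"
    using qrel_bar_sum[OF Lz_Lz i] by (simp add: act_alg_simps)
  have w: "wt k * wt (bar k) = - (Q ^ (2 * n + 2))" if "k \<in> {1..n}" for k
  proof -
    have "k + (2 * n + 2 - k) = 2 * n + 2" using that by auto
    then show ?thesis using that wt_bar[OF that] by (simp add: wt_def flip: power_add)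
  qed
  have L: "Ls (bar k) (Ls k K) t f = - (Lw k (Lw (bar k) K) t f / Q ^ (2 * n + 2))"
    "Ls k (Ls (bar k) K) t f = - (Lw (bar k) (Lw k K) t f / Q ^ (2 * n + 2))" if "k \<in> {1..n}" for k K t f
  proof -
    have "bar (bar k) = k" using that by auto
    then show "Ls (bar k) (Ls k K) t f = - (Lw k (Lw (bar k) K) t f / Q ^ (2 * n + 2))"
    "Ls k (Ls (bar k) K) t f = - (Lw (bar k) (Lw k K) t f / Q ^ (2 * n + 2))"
      using w[OF that] unfolding Ls_Ls by (simp_all add: mult.commute[of "wt (bar k)"])
  qed
  show "kills (gxs i * gys i - (Q^2 \<cdot>\<^sub>f (gys i * gxs i)
        + (Q^2 - 1) \<cdot>\<^sub>f (\<Sum>k\<in>{1..<i}. Q^(i-k) \<cdot>\<^sub>f (gys k * gxs k))))"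
  proof (intro allI impI)
    fix K t f assume "good K"
    have s: "(\<Sum>k\<in>{1..<i}. Q ^ (i - k) * Ls k (Ls (bar k) K) t f)
       = - ((\<Sum>k\<in>{1..<i}. Q ^ (i - k) * Lw (bar k) (Lw k K) t f) / Q ^ (2 * n + 2))"
      unfolding sum_divide_distrib sum_negf[symmetric] using i by (intro sum.cong refl) (simp add: L)
    show "act_alg (gxs i * gys i - (Q^2 \<cdot>\<^sub>f (gys i * gxs i)
        + (Q^2 - 1) \<cdot>\<^sub>f (\<Sum>k\<in>{1..<i}. Q^(i-k) \<cdot>\<^sub>f (gys k * gxs k)))) K t f = 0"
      unfolding act_alg_simps s L[OF i] qrel_bar_sum[OF Lw_Lw[OF \<open>good K\<close>] i]
      by (simp add: algebra_simps add_divide_distrib diff_divide_distrib)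
  qed
qed

lemma kills_xxs_same:
  assumes i: "i \<in> {1..n}"
  shows "kills (gx i * gxs i - (gxs i * gx i + (1 - Q^2) \<cdot>\<^sub>f (\<Sum>k\<in>{1..<i}. gxs k * gx k)))"
proof (intro allI impI)
  fix K t f
  let ?G = "\<lambda>d b. Lz b (Lw d K) t f" and ?N = "Q ^ (2 * n + 2)"
  have "wt i * (\<Sum>k\<in>{1..<i}. wt k / wt i * ?G (bar k) k) = (\<Sum>k\<in>{1..<i}. wt k * ?G (bar k) k)"
    by (simp add: sum_distrib_left mult.assoc)
  then have c: "wt i * cross i (bar i) ?G = wt i * ?G (bar i) i + (1 - Q^2) * (\<Sum>k\<in>{1..<i}. wt k * ?G (bar k) k)"
    unfolding cross_values(1)[OF i i] by (simp add: algebra_simps)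
  have m1: "Ls i (Lz i K) t f = - (wt i * cross i (bar i) ?G / ?N)"
    unfolding Ls_Lz by simp
  have m2: "Lz k (Ls k K) t f = - (wt k * ?G (bar k) k / ?N)" for k
    unfolding Lz_Ls by simp
  have s: "(\<Sum>k\<in>{1..<i}. Lz k (Ls k K) t f) = - ((\<Sum>k\<in>{1..<i}. wt k * ?G (bar k) k) / ?N)"
    unfolding m2 by (simp add: sum_negf sum_divide_distrib)
  show "act_alg (gx i * gxs i - (gxs i * gx i + (1 - Q^2) \<cdot>\<^sub>f (\<Sum>k\<in>{1..<i}. gxs k * gx k))) K t f = 0"
    unfolding act_alg_simps s m1 m2[of i] c by (simp add: algebra_simps add_divide_distrib diff_divide_distrib)
qed

text \<open>The sum over indices below \<open>bar i\<close> runs through all x_k and through the y_k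
  with k > i. The remaining exchange term gives x_i^* x_i, its coefficient being the ratio of
  \<open>wt (bar i)\<close> to \<open>wt i\<close>.\<close>

lemma kills_yys_same:
  assumes i: "i \<in> {1..n}"
  shows "kills (gy i * gys i - (gys i * gy i + (1 - Q^2) \<cdot>\<^sub>f
        (Q^(2*(n+1-i)) \<cdot>\<^sub>f (gxs i * gx i) + (\<Sum>k\<in>{1..n}. gxs k * gx k)
         + (\<Sum>k\<in>{i+1..n}. gys k * gy k))))"
proof (intro allI impI)
  fix K t f
  let ?G = "\<lambda>d b. Lz b (Lw d K) t f" and ?N = "Q ^ (2 * n + 2)"
  have bb: "bar (bar i) = i" using i by auto
  have split: "{1..<bar i} = {1..n} \<union> bar ` {i+1..n}"
  proof (rule subset_antisym; rule subsetI)
    fix k assume "k \<in> {1..<bar i}"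
    then have "k \<in> {1..n} \<or> (k = bar (bar k) \<and> bar k \<in> {i+1..n})" using i by (auto simp: bar_def)
    then show "k \<in> {1..n} \<union> bar ` {i+1..n}" by auto
  qed (use i in \<open>auto simp: bar_def\<close>)
  have "(\<Sum>k\<in>{1..<bar i}. wt k * ?G (bar k) k) = (\<Sum>k\<in>{1..n}. wt k * ?G (bar k) k)
      + (\<Sum>k\<in>bar ` {i+1..n}. wt k * ?G (bar k) k)"
    unfolding split by (intro sum.union_disjoint) (auto simp: bar_def)
  also have "(\<Sum>k\<in>bar ` {i+1..n}. wt k * ?G (bar k) k) = (\<Sum>k\<in>{i+1..n}. wt (bar k) * ?G k (bar k))"
    by (subst sum.reindex) (auto simp: bar_def inj_on_def)
  finally have e: "(\<Sum>k\<in>{1..<bar i}. wt k * ?G (bar k) k)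
     = (\<Sum>k\<in>{1..n}. wt k * ?G (bar k) k) + (\<Sum>k\<in>{i+1..n}. wt (bar k) * ?G k (bar k))" .
  have "wt (bar i) * (\<Sum>k\<in>{1..<bar i}. wt k / wt (bar i) * ?G (bar k) k) = (\<Sum>k\<in>{1..<bar i}. wt k * ?G (bar k) k)"
    by (simp add: sum_distrib_left mult.assoc)
  then have c: "wt (bar i) * cross (bar i) i ?G = wt (bar i) * ?G i (bar i)
     + (Q^2 - 1) * (wt (bar i) * ?G (bar i) i)
     + (1 - Q^2) * ((\<Sum>k\<in>{1..n}. wt k * ?G (bar k) k) + (\<Sum>k\<in>{i+1..n}. wt (bar k) * ?G k (bar k)))"
    unfolding cross_values(7)[OF i i] e[symmetric] by (simp add: algebra_simps)
  have m1: "Ls (bar i) (Lz (bar i) K) t f = - (wt (bar i) * cross (bar i) i ?G / ?N)"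
    unfolding Ls_Lz bb by simp
  have m2: "Lz (bar k) (Ls (bar k) K) t f = - (wt (bar k) * ?G k (bar k) / ?N)" if "k \<in> {1..n}" for k
    using that unfolding Lz_Ls by simp
  have m3: "Lz k (Ls k K) t f = - (wt k * ?G (bar k) k / ?N)" for k
    unfolding Lz_Ls by simp
  have s1: "(\<Sum>k\<in>{1..n}. Lz k (Ls k K) t f) = - ((\<Sum>k\<in>{1..n}. wt k * ?G (bar k) k) / ?N)"
    unfolding m3 by (simp add: sum_negf sum_divide_distrib)
  have s2: "(\<Sum>k\<in>{i+1..n}. Lz (bar k) (Ls (bar k) K) t f) = - ((\<Sum>k\<in>{i+1..n}. wt (bar k) * ?G k (bar k)) / ?N)"
    unfolding sum_divide_distrib sum_negf[symmetric] using i by (intro sum.cong refl m2) auto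
  show "act_alg (gy i * gys i - (gys i * gy i + (1 - Q^2) \<cdot>\<^sub>f
        (Q^(2*(n+1-i)) \<cdot>\<^sub>f (gxs i * gx i) + (\<Sum>k\<in>{1..n}. gxs k * gx k)
         + (\<Sum>k\<in>{i+1..n}. gys k * gy k)))) K t f = 0"
    unfolding act_alg_simps s1 s2 m1 m2[OF i] m3[of i] c unfolding wt_mult(1)[OF i i]
    by (simp add: algebra_simps add_divide_distrib diff_divide_distrib)
qed

lemma kills_xys_same:
  assumes i: "i \<in> {1..n}"
  shows "kills (gx i * gys i - Q^2 \<cdot>\<^sub>f (gys i * gx i))" "kills (gy i * gxs i - Q^2 \<cdot>\<^sub>f (gxs i * gy i))"
proof -
  have bb: "bar (bar i) = i" using i by auto
  show "kills (gx i * gys i - Q^2 \<cdot>\<^sub>f (gys i * gx i))" "kills (gy i * gxs i - Q^2 \<cdot>\<^sub>f (gxs i * gy i))"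
    unfolding act_alg_simps Lz_Ls Ls_Lz bb cross_values[OF i i] by simp_all
qed

lemma kills_xxs:
  assumes i: "i \<in> {1..n}" and j: "j \<in> {1..n}" and ne: "i \<noteq> j"
  shows "kills (gx i * gxs j - Q \<cdot>\<^sub>f (gxs j * gx i))"
  unfolding act_alg_simps Lz_Ls Ls_Lz cross_values(2)[OF i j ne] by simp

lemma kills_yys:
  assumes i: "i \<in> {1..n}" and j: "j \<in> {1..n}" and ne: "i \<noteq> j"
  shows "kills (gy i * gys j - (Q \<cdot>\<^sub>f (gys j * gy i) - ((Q^2 - 1) * Q^(2*n+2-i-j)) \<cdot>\<^sub>f (gxs i * gx j)))"
proof -
  have bb: "bar (bar i) = i" "bar (bar j) = j" using i j by auto
  show ?thesis
    unfolding act_alg_simps Lz_Ls Ls_Lz bb cross_values(8)[OF i j ne] wt_mult(2)[OF i j]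
    by (simp add: algebra_simps add_divide_distrib diff_divide_distrib)
qed

lemma kills_xys_less:
  assumes i: "i \<in> {1..n}" and j: "j \<in> {1..n}" and ne: "i < j"
  shows "kills (gx i * gys j - Q \<cdot>\<^sub>f (gys j * gx i))" "kills (gy j * gxs i - Q \<cdot>\<^sub>f (gxs i * gy j))"
proof -
  have bb: "bar (bar i) = i" "bar (bar j) = j" "i \<noteq> j" "j \<noteq> i" "\<not> j < i" using i j ne by auto
  show "kills (gx i * gys j - Q \<cdot>\<^sub>f (gys j * gx i))" "kills (gy j * gxs i - Q \<cdot>\<^sub>f (gxs i * gy j))"
    unfolding act_alg_simps Lz_Ls Ls_Lz bb cross_values(4)[OF i j bb(3)] cross_values(6)[OF j i bb(4)]
    using bb by simp_all
qed

lemma kills_xys_greater: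
  assumes i: "i \<in> {1..n}" and j: "j \<in> {1..n}" and ne: "j < i"
  shows "kills (gx i * gys j - (Q \<cdot>\<^sub>f (gys j * gx i) + ((Q^2 - 1) * Q^(i-j)) \<cdot>\<^sub>f (gys i * gx j)))"
    "kills (gy j * gxs i - (Q \<cdot>\<^sub>f (gxs i * gy j) + ((Q^2 - 1) * Q^(i-j)) \<cdot>\<^sub>f (gxs j * gy i)))"
proof -
  have bb: "bar (bar i) = i" "bar (bar j) = j" "i \<noteq> j" "j \<noteq> i" "j < i" using i j ne by auto
  show "kills (gx i * gys j - (Q \<cdot>\<^sub>f (gys j * gx i) + ((Q^2 - 1) * Q^(i-j)) \<cdot>\<^sub>f (gys i * gx j)))"
    "kills (gy j * gxs i - (Q \<cdot>\<^sub>f (gxs i * gy j) + ((Q^2 - 1) * Q^(i-j)) \<cdot>\<^sub>f (gxs j * gy i)))"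
    unfolding act_alg_simps Lz_Ls Ls_Lz bb cross_values(4)[OF i j bb(3)] cross_values(6)[OF j i bb(4)]
      wt_mult(3,4)[OF i j ne]
    using bb by (simp_all add: algebra_simps add_divide_distrib diff_divide_distrib)
qed

text \<open>Q is real, so \<open>adj\<close> keeps the coefficients. The relators for x_i x_i^* and
  y_i y_i^* are self-adjoint; those for x_i x_j^* and y_i y_j^* with distinct indices are permuted
  by exchanging i and j.\<close>

lemma kills_hom_relators:
  assumes Q: "Q = complex_of_real q" and r: "r \<in> hom_relators q n \<union> adj ` hom_relators q n"
  shows "kills r"
proof -
  have cnjQ: "cnj Q = Q" using Q by simp
  note kills = kills_xx kills_yy kills_yx kills_yx_same kills_xxs_same kills_yys_same kills_xys_same
    kills_xxs kills_yys kills_xys_less kills_xys_greater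
  have "kills r" "kills (adj r)" if "r \<in> hom_relators q n" for r
  proof -
    have "kills r \<and> kills (adj r)"
      using that unfolding hom_relators_def Let_def Q[symmetric]
    proof (elim UnE CollectE exE conjE)
      fix i j assume r: "r = gy i * gys j - (Q \<cdot>\<^sub>f (gys j * gy i) - ((Q^2 - 1) * Q^(2*n+2-i-j)) \<cdot>\<^sub>f (gxs i * gx j))"
        and ij: "i \<in> {1..n}" "j \<in> {1..n}" "i \<noteq> j"
      \<comment> \<open>The exponent is symmetric in i and j only after reordering truncated
        subtractions.\<close>
      have e: "2*n+2-i-j = 2*n+2-j-i" by simp
      have "adj r = gy j * gys i - (Q \<cdot>\<^sub>f (gys i * gy j) - ((Q^2 - 1) * Q^(2*n+2-j-i)) \<cdot>\<^sub>f (gxs j * gx i))"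
        by (simp only: r e adj_minus adj_fscale adj_mult adj_generators
          complex_cnj_power complex_cnj_diff complex_cnj_mult complex_cnj_one cnjQ)
      then show ?thesis
        using kills_yys[OF ij] kills_yys[OF ij(2,1) ij(3)[symmetric]] unfolding r by metis
    qed (simp only: adj_minus adj_plus adj_fscale adj_mult adj_sum adj_generators complex_cnj_inverse
          complex_cnj_power complex_cnj_diff complex_cnj_mult complex_cnj_one cnjQ,
        intro conjI kills; simp)+
    then show "kills r" "kills (adj r)" by blast+
  qed
  with r show ?thesis by blast
qed

lemma act_sphere_element:
  "act_alg (sphere_element n) k t f = - (Lc k t f / Q ^ (2 * n + 2))"
proof -
  have "{1..2 * n} = {1..n} \<union> bar ` {1..n}"
  proof (rule subset_antisym; rule subsetI)
    fix a assume "a \<in> {1..2 * n}"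
    then have "a \<in> {1..n} \<or> (a = bar (bar a) \<and> bar a \<in> {1..n})" by (auto simp: bar_def)
    then show "a \<in> {1..n} \<union> bar ` {1..n}" by auto
  qed (auto simp: bar_def)
  then have "Lc k t f = (\<Sum>b\<in>{1..n} \<union> bar ` {1..n}. wt b * Lz b (Lw (bar b) k) t f)"
    by (simp only: Lc_def)
  also have "\<dots> = (\<Sum>b\<in>{1..n}. wt b * Lz b (Lw (bar b) k) t f) + (\<Sum>b\<in>bar ` {1..n}. wt b * Lz b (Lw (bar b) k) t f)"
    by (intro sum.union_disjoint) (auto simp: bar_def)
  also have "(\<Sum>b\<in>bar ` {1..n}. wt b * Lz b (Lw (bar b) k) t f) = (\<Sum>b\<in>{1..n}. wt (bar b) * Lz (bar b) (Lw b k) t f)"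
    by (subst sum.reindex) (auto simp: bar_def inj_on_def)
  finally have e: "Lc k t f = (\<Sum>b\<in>{1..n}. wt b * Lz b (Lw (bar b) k) t f)
      + (\<Sum>b\<in>{1..n}. wt (bar b) * Lz (bar b) (Lw b k) t f)" .
  have "act_alg (sphere_element n) k t f = (\<Sum>b\<in>{1..n}. - (wt b * Lz b (Lw (bar b) k) t f / Q ^ (2 * n + 2)))
      + (\<Sum>b\<in>{1..n}. - (wt (bar b) * Lz (bar b) (Lw b k) t f / Q ^ (2 * n + 2)))"
    unfolding sphere_element_def act_alg_simps Lz_Ls sum.distrib
    by (intro arg_cong2[of _ _ _ _ "(+)"] sum.cong refl) auto
  then show ?thesis unfolding e by (simp add: sum_negf sum_divide_distrib add_divide_distrib)
qed

end

section \<open>Straightening\<close>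

primrec inversions :: "nat list \<Rightarrow> nat" where
  "inversions [] = 0"
| "inversions (x # xs) = length (filter (\<lambda>y. y < x) xs) + inversions xs"

lemma inversions_swap: "b < a \<Longrightarrow> inversions (u @ b # a # v) < inversions (u @ a # b # v)"
  by (induction u) auto

lemma inversions_remove: "inversions (u @ v) \<le> inversions (u @ a # b # v)"
  by (induction u) auto

lemma unsorted_adjacent:
  assumes "\<not> sorted (map r w)"
  shows "\<exists>u a b v. w = u @ a # b # v \<and> (r b :: nat) < r a"
  using assms
proof (induction w)
  case (Cons x w)
  show ?case
  proof (cases "sorted (map r w)")
    case True
    then obtain y v where "w = y # v" "r y < r x"
      using Cons.prems by (cases w) (auto simp: not_le order_trans dest: less_le_trans)
    then show ?thesis by (intro exI[of _ "[]"]) auto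
  next
    case False
    then obtain u a b v where "w = u @ a # b # v" "r b < r a" using Cons.IH by blast
    then show ?thesis by (intro exI[of _ "x # u"]) auto
  qed
qed simp

lemma sorted_filter_split:
  assumes "sorted (map r w)" "\<And>x. x \<in> set w \<Longrightarrow> x \<noteq> l \<Longrightarrow> (r l :: nat) < r x"
  shows "w = replicate (count_list w l) l @ filter (\<lambda>x. x \<noteq> l) w"
  using assms
proof (induction w)
  case (Cons x w)
  show ?case
  proof (cases "x = l")
    case True
    then show ?thesis using Cons by auto
  next
    case False
    then have "l \<notin> set (x # w)" using Cons.prems(1) Cons.prems(2)[of x] by fastforce
    moreover from this have "filter (\<lambda>x. x \<noteq> l) w = w" by (auto simp: filter_id_conv)
    ultimately show ?thesis by (simp add: count_list_0_iff)
  qed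
qed simp

lemma sorted_eq_concat_replicate:
  fixes r :: "'a \<Rightarrow> nat"
  assumes "sorted_wrt (<) (map r L)" "sorted (map r w)" "set w \<subseteq> set L"
  shows "w = concat (map (\<lambda>l. replicate (count_list w l) l) L)"
  using assms
proof (induction L arbitrary: w)
  case (Cons l L)
  let ?w = "filter (\<lambda>x. x \<noteq> l) w"
  have "w = replicate (count_list w l) l @ ?w"
    using Cons.prems by (intro sorted_filter_split[of r]) auto
  moreover have "?w = concat (map (\<lambda>l. replicate (count_list ?w l) l) L)"
    using Cons.prems by (intro Cons.IH) (auto intro: sorted_filter)
  moreover have "count_list ?w l' = count_list w l'" if "l' \<in> set L" for l'
  proof -
    have "l' \<noteq> l" using that Cons.prems(1) by auto
    then show ?thesis by (induction w) auto
  qed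
  then have "map (\<lambda>l. replicate (count_list ?w l) l) L = map (\<lambda>l. replicate (count_list w l) l) L"
    by (intro map_cong) auto
  ultimately show ?case by simp
qed simp

definition gen :: "letter \<Rightarrow> free_alg" where "gen l = mon (Word [l])"

lemma gen_simps: "gx i = gen (LX i)" "gy i = gen (LY i)" "gxs i = gen (LXadj i)" "gys i = gen (LYadj i)"
  by (simp_all add: gen_def gx_def gy_def gxs_def gys_def adj_single word_adj_def)

lemma gen_mult: "gen a * gen b = mon (Word [a, b])"
  by (simp add: gen_def mult_single plus_free_monoid_def)

definition letters_in :: "nat \<Rightarrow> letter set" where "letters_in n = {l. letter_index l \<in> {1..n}}"

lemma mem_free_ring': "a \<in> carrier (free_ring n) \<longleftrightarrow> (\<forall>w\<in>supp a. set (letters w) \<subseteq> letters_in n)"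
  unfolding mem_free_ring letters_in_def by (auto simp: image_subset_iff)

primrec half :: "letter \<Rightarrow> nat" where
  "half (LYadj i) = 0" | "half (LXadj i) = 0" | "half (LX i) = 1" | "half (LY i) = 1"

primrec block :: "letter \<Rightarrow> nat" where
  "block (LYadj i) = 0" | "block (LXadj i) = 1" | "block (LX i) = 2" | "block (LY i) = 3"

primrec rank :: "nat \<Rightarrow> letter \<Rightarrow> nat" where
  "rank n (LYadj i) = i" | "rank n (LXadj i) = n + i" | "rank n (LX i) = 3 * n + 1 - i" | "rank n (LY i) = 4 * n + 1 - i"

text \<open>Straightening first moves starred letters to the left, then sorts by block, then inside the
  blocks; eliminating \<open>x\<^sub>n\<^sup>* x\<^sub>n\<close> happens only when the first component is settled.\<close>

definition complexity :: "nat \<Rightarrow> letter list \<Rightarrow> nat \<times> nat \<times> nat \<times> nat" where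
  "complexity n w = (inversions (map half w), count_list w (LXadj n),
     inversions (map block w), inversions (map (rank n) w))"

definition simpler :: "nat \<Rightarrow> (free_monoid \<times> free_monoid) set" where
  "simpler n = inv_image (less_than <*lex*> less_than <*lex*> less_than <*lex*> less_than) (complexity n \<circ> letters)"

lemma wf_simpler: "wf (simpler n)"
  by (auto simp: simpler_def)

text \<open>The words \<open>c d\<close> allowed when \<open>a b\<close> is rewritten. If a star
  moves to the left, nothing else is controlled; y_i y_i^* may even create x_n^* x_n. Inside one
  half, x_n^* must not multiply, and either the blocks are exchanged or the word is exactly
  \<open>b a\<close>.\<close>

definition lower :: "nat \<Rightarrow> letter \<Rightarrow> letter \<Rightarrow> letter \<Rightarrow> letter \<Rightarrow> bool" where
  "lower n a b c d \<longleftrightarrow> c \<in> letters_in n \<and> d \<in> letters_in n \<and>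
     (half b < half a \<and> half c = half b \<and> half d = half a \<or>
      half a = half b \<and> half c = half a \<and> half d = half a
        \<and> count_list [c, d] (LXadj n) \<le> count_list [a, b] (LXadj n)
        \<and> (block b < block a \<and> block c = block b \<and> block d = block a \<or>
           block a = block b \<and> c = b \<and> d = a))"

lemma lower_simpler:
  assumes "lower n a b c d" "rank n b < rank n a"
  shows "(Word (u @ c # d # v), Word (u @ a # b # v)) \<in> simpler n"
proof -
  let ?new = "u @ c # d # v" and ?old = "u @ a # b # v"
  have half: "half b < half a \<Longrightarrow> half c = half b \<Longrightarrow> half d = half a
      \<Longrightarrow> inversions (map half ?new) < inversions (map half ?old)"
    using inversions_swap[of "half b" "half a" "map half u" "map half v"] by simp
  have block: "block b < block a \<Longrightarrow> block c = block b \<Longrightarrow> block d = block a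
      \<Longrightarrow> inversions (map block ?new) < inversions (map block ?old)"
    using inversions_swap[of "block b" "block a" "map block u" "map block v"] by simp
  have rank: "c = b \<Longrightarrow> d = a \<Longrightarrow> inversions (map (rank n) ?new) < inversions (map (rank n) ?old)"
    using inversions_swap[OF assms(2), of "map (rank n) u" "map (rank n) v"] by simp
  have same: "map half ?new = map half ?old" if "half c = half a" "half d = half a" "half a = half b"
    using that by simp
  have same2: "map block ?new = map block ?old" if "c = b" "d = a" "block a = block b"
    using that by simp
  have count: "count_list ?new (LXadj n) \<le> count_list ?old (LXadj n)"
    if "count_list [c, d] (LXadj n) \<le> count_list [a, b] (LXadj n)"
    using that by (simp split: if_splits)
  consider "half b < half a" "half c = half b" "half d = half a"
    | "half a = half b" "half c = half a" "half d = half a"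
      "count_list [c, d] (LXadj n) \<le> count_list [a, b] (LXadj n)"
      "block b < block a" "block c = block b" "block d = block a"
    | "half a = half b" "half c = half a" "half d = half a"
      "count_list [c, d] (LXadj n) \<le> count_list [a, b] (LXadj n)"
      "block a = block b" "c = b" "d = a"
    using assms(1) unfolding lower_def by blast
  then have "(complexity n ?new, complexity n ?old)
     \<in> less_than <*lex*> less_than <*lex*> less_than <*lex*> less_than"
  proof cases
    case 1
    then show ?thesis using half unfolding complexity_def by (simp only: in_lex_prod less_than_iff simp_thms)
  next
    case 2
    then show ?thesis using same count block unfolding complexity_def
      by (simp only: in_lex_prod less_than_iff simp_thms le_less)
  next
    case 3
    then show ?thesis using same[OF 3(2,3,1)] same2[OF 3(6,7,5)] count[OF 3(4)] rank[OF 3(6,7)] unfolding complexity_def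
      by (simp only: in_lex_prod less_than_iff simp_thms le_less)
  qed
  then show ?thesis by (simp add: simpler_def)
qed

definition low :: "nat \<Rightarrow> letter \<Rightarrow> letter \<Rightarrow> free_alg \<Rightarrow> bool" where
  "low n a b e \<longleftrightarrow> supp e \<subseteq> {Word [c, d] | c d. lower n a b c d}"

lemma lookup_fscale: "Poly_Mapping.lookup (x \<cdot>\<^sub>f a) w = x * Poly_Mapping.lookup a w"
proof (induction a rule: free_alg_induct)
  case (single v c)
  show ?case by (simp add: fscale_def mult_single lookup_single when_def)
next
  case (plus a b)
  then show ?case by (simp add: fscale_def distrib_left lookup_add)
qed (simp add: fscale_def)

lemma keys_fscale: "supp (x \<cdot>\<^sub>f a) \<subseteq> supp a"
  by (auto simp: in_keys_iff lookup_fscale)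

lemma low_gen: "lower n a b c d \<Longrightarrow> low n a b (gen c * gen d)"
  by (auto simp: low_def gen_mult)

lemma low_plus: "low n a b e \<Longrightarrow> low n a b e' \<Longrightarrow> low n a b (e + e')"
  unfolding low_def using keys_add[of e e'] by blast

lemma keys_minus: "supp (a - b) \<subseteq> supp a \<union> supp (b :: free_alg)"
  by (auto simp: in_keys_iff lookup_minus)

lemma low_minus: "low n a b e \<Longrightarrow> low n a b e' \<Longrightarrow> low n a b (e - e')"
  unfolding low_def using keys_minus[of e e'] by blast

lemma low_fscale: "low n a b e \<Longrightarrow> low n a b (x \<cdot>\<^sub>f e)"
  unfolding low_def using keys_fscale by blast

lemma low_sum: "(\<And>j. j \<in> J \<Longrightarrow> low n a b (e j)) \<Longrightarrow> low n a b (\<Sum>j\<in>J. e j)"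
proof (induction J rule: infinite_finite_induct)
  case (insert j J)
  then show ?case by (simp add: low_plus)
qed (simp_all add: low_def)

lemmas low_intros = low_plus low_minus low_fscale low_sum low_gen

section \<open>Each pair in wrong order is rewritten by a relator\<close>

lemma hom_relators_members:
  fixes q :: real and n :: nat
  defines "Q \<equiv> complex_of_real q" and "R \<equiv> hom_relators q n \<union> adj ` hom_relators q n"
  assumes i: "i \<in> {1..n}" and j: "j \<in> {1..n}"
  shows "i < j \<Longrightarrow> gx i * gx j - inverse Q \<cdot>\<^sub>f (gx j * gx i) \<in> R"
    "i < j \<Longrightarrow> gy i * gy j - Q \<cdot>\<^sub>f (gy j * gy i) \<in> R"
    "i \<noteq> j \<Longrightarrow> gy j * gx i - Q \<cdot>\<^sub>f (gx i * gy j) \<in> R"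
    "gy i * gx i - (Q^2 \<cdot>\<^sub>f (gx i * gy i) + (Q^2 - 1) \<cdot>\<^sub>f (\<Sum>k\<in>{1..<i}. Q^(i-k) \<cdot>\<^sub>f (gx k * gy k))) \<in> R"
    "gx i * gxs i - (gxs i * gx i + (1 - Q^2) \<cdot>\<^sub>f (\<Sum>k\<in>{1..<i}. gxs k * gx k)) \<in> R"
    "gy i * gys i - (gys i * gy i + (1 - Q^2) \<cdot>\<^sub>f
        (Q^(2*(n+1-i)) \<cdot>\<^sub>f (gxs i * gx i) + (\<Sum>k\<in>{1..n}. gxs k * gx k) + (\<Sum>k\<in>{i+1..n}. gys k * gy k))) \<in> R"
    "gx i * gys i - Q^2 \<cdot>\<^sub>f (gys i * gx i) \<in> R"
    "i \<noteq> j \<Longrightarrow> gx i * gxs j - Q \<cdot>\<^sub>f (gxs j * gx i) \<in> R"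
    "i \<noteq> j \<Longrightarrow> gy i * gys j - (Q \<cdot>\<^sub>f (gys j * gy i) - ((Q^2 - 1) * Q^(2*n+2-i-j)) \<cdot>\<^sub>f (gxs i * gx j)) \<in> R"
    "i < j \<Longrightarrow> gx i * gys j - Q \<cdot>\<^sub>f (gys j * gx i) \<in> R"
    "j < i \<Longrightarrow> gx i * gys j - (Q \<cdot>\<^sub>f (gys j * gx i) + ((Q^2 - 1) * Q^(i-j)) \<cdot>\<^sub>f (gys i * gx j)) \<in> R"
  unfolding R_def hom_relators_def Let_def Q_def[symmetric] using i j by blast+

lemma adj_hom_relators_members:
  fixes q :: real and n :: nat
  defines "Q \<equiv> complex_of_real q" and "R \<equiv> hom_relators q n \<union> adj ` hom_relators q n"
  assumes i: "i \<in> {1..n}" and j: "j \<in> {1..n}"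
  shows "i < j \<Longrightarrow> gxs j * gxs i - inverse Q \<cdot>\<^sub>f (gxs i * gxs j) \<in> R"
    "i < j \<Longrightarrow> gys j * gys i - Q \<cdot>\<^sub>f (gys i * gys j) \<in> R"
    "i \<noteq> j \<Longrightarrow> gxs i * gys j - Q \<cdot>\<^sub>f (gys j * gxs i) \<in> R"
    "gxs i * gys i - (Q^2 \<cdot>\<^sub>f (gys i * gxs i) + (Q^2 - 1) \<cdot>\<^sub>f (\<Sum>k\<in>{1..<i}. Q^(i-k) \<cdot>\<^sub>f (gys k * gxs k))) \<in> R"
    "gy i * gxs i - Q^2 \<cdot>\<^sub>f (gxs i * gy i) \<in> R"
    "i < j \<Longrightarrow> gy j * gxs i - Q \<cdot>\<^sub>f (gxs i * gy j) \<in> R"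
    "j < i \<Longrightarrow> gy j * gxs i - (Q \<cdot>\<^sub>f (gxs i * gy j) + ((Q^2 - 1) * Q^(i-j)) \<cdot>\<^sub>f (gxs j * gy i)) \<in> R"
proof -
  have cnjQ: "cnj Q = Q" by (simp add: Q_def)
  have A: "x \<in> R" if "adj x \<in> hom_relators q n" for x
    using that unfolding R_def by (metis UnCI adj_adj imageI)
  note adj_simps = adj_minus adj_plus adj_fscale adj_mult adj_sum adj_generators complex_cnj_inverse
    complex_cnj_power complex_cnj_diff complex_cnj_mult complex_cnj_one cnjQ
  note H = hom_relators_def[of q n, unfolded Let_def Q_def[symmetric]]
  show "i < j \<Longrightarrow> gxs j * gxs i - inverse Q \<cdot>\<^sub>f (gxs i * gxs j) \<in> R"
    "i < j \<Longrightarrow> gys j * gys i - Q \<cdot>\<^sub>f (gys i * gys j) \<in> R"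
    "i \<noteq> j \<Longrightarrow> gxs i * gys j - Q \<cdot>\<^sub>f (gys j * gxs i) \<in> R"
    "gxs i * gys i - (Q^2 \<cdot>\<^sub>f (gys i * gxs i) + (Q^2 - 1) \<cdot>\<^sub>f (\<Sum>k\<in>{1..<i}. Q^(i-k) \<cdot>\<^sub>f (gys k * gxs k))) \<in> R"
    "gy i * gxs i - Q^2 \<cdot>\<^sub>f (gxs i * gy i) \<in> R"
    "i < j \<Longrightarrow> gy j * gxs i - Q \<cdot>\<^sub>f (gxs i * gy j) \<in> R"
    "j < i \<Longrightarrow> gy j * gxs i - (Q \<cdot>\<^sub>f (gxs i * gy j) + ((Q^2 - 1) * Q^(i-j)) \<cdot>\<^sub>f (gxs j * gy i)) \<in> R"
    by (rule A, simp only: adj_simps, unfold H, use i j in blast)+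
qed

lemma straightening_rule:
  assumes a: "a \<in> letters_in n" and b: "b \<in> letters_in n" and ab: "rank n b < rank n a"
  shows "\<exists>e. low n a b e \<and> gen a * gen b - e \<in> hom_relators q n \<union> adj ` hom_relators q n"
proof -
  let ?R = "hom_relators q n \<union> adj ` hom_relators q n"
  have ex: "gen a * gen b - e \<in> ?R \<Longrightarrow> low n a b e \<Longrightarrow> \<exists>e. low n a b e \<and> gen a * gen b - e \<in> ?R" for a b e
    by blast
  note mem = hom_relators_members[where q = q and n = n, unfolded gen_simps]
  note adj_mem = adj_hom_relators_members[where q = q and n = n, unfolded gen_simps]
  note [intro!] = low_intros and [simp] = lower_def letters_in_def
  show ?thesis
  proof (cases a)
    case (LYadj i)
    then obtain j where 1: "b = LYadj j" "j < i" "i \<in> {1..n}" "j \<in> {1..n}"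
      using a b ab by (cases b) (auto simp: letters_in_def)
    show ?thesis unfolding LYadj 1(1)
      by (rule ex[OF adj_mem(2)[of j i]]) (use 1 in \<open>auto\<close>)
  next
    case (LXadj i)
    then have i: "i \<in> {1..n}" using a by (auto simp: letters_in_def)
    from b ab LXadj i consider j where "b = LXadj j" "j < i" "j \<in> {1..n}" | j where "b = LYadj j" "j \<noteq> i" "j \<in> {1..n}"
      | "b = LYadj i" by (cases b) (auto simp: letters_in_def)
    then show ?thesis
    proof cases
      case 1
      show ?thesis unfolding LXadj 1(1)
        by (rule ex[OF adj_mem(1)[of j i]]) (use i 1 in \<open>auto\<close>)
    next
      case 2
      show ?thesis unfolding LXadj 2(1)
        by (rule ex[OF adj_mem(3)[of i j]]) (use i 2 in \<open>auto\<close>)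
    next
      case 3
      show ?thesis unfolding LXadj 3
        by (rule ex[OF adj_mem(4)[of i i]]) (use i 3 in \<open>auto\<close>)
    qed
  next
    case (LX i)
    then have i: "i \<in> {1..n}" using a by (auto simp: letters_in_def)
    from b ab LX i consider j where "b = LX j" "i < j" "j \<in> {1..n}" | j where "b = LXadj j" "j \<noteq> i" "j \<in> {1..n}"
      | "b = LXadj i" | "b = LYadj i" | j where "b = LYadj j" "j < i" "j \<in> {1..n}"
      | j where "b = LYadj j" "i < j" "j \<in> {1..n}"
      by (cases b) (auto simp: letters_in_def, metis linorder_neqE_nat)
    then show ?thesis
    proof cases
      case 1
      show ?thesis unfolding LX 1(1)
        by (rule ex[OF mem(1)[of i j]]) (use i 1 in \<open>auto\<close>)
    next
      case 2
      show ?thesis unfolding LX 2(1)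
        by (rule ex[OF mem(8)[of i j]]) (use i 2 in \<open>auto\<close>)
    next
      case 3
      show ?thesis unfolding LX 3
        by (rule ex[OF mem(5)[of i i]]) (use i 3 in \<open>auto\<close>)
    next
      case 4
      show ?thesis unfolding LX 4
        by (rule ex[OF mem(7)[of i i]]) (use i 4 in \<open>auto\<close>)
    next
      case 5
      show ?thesis unfolding LX 5(1)
        by (rule ex[OF mem(11)[of i j]]) (use i 5 in \<open>auto\<close>)
    next
      case 6
      show ?thesis unfolding LX 6(1)
        by (rule ex[OF mem(10)[of i j]]) (use i 6 in \<open>auto\<close>)
    qed
  next
    case (LY i)
    then have i: "i \<in> {1..n}" using a by (auto simp: letters_in_def)
    from b ab LY i consider j where "b = LY j" "i < j" "j \<in> {1..n}" | j where "b = LX j" "j \<noteq> i" "j \<in> {1..n}"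
      | "b = LX i" | "b = LXadj i" | j where "b = LXadj j" "j < i" "j \<in> {1..n}"
      | j where "b = LXadj j" "i < j" "j \<in> {1..n}" | "b = LYadj i" | j where "b = LYadj j" "i \<noteq> j" "j \<in> {1..n}"
      by (cases b) (auto simp: letters_in_def, metis linorder_neqE_nat)
    then show ?thesis
    proof cases
      case 1
      show ?thesis unfolding LY 1(1)
        by (rule ex[OF mem(2)[of i j]]) (use i 1 in \<open>auto\<close>)
    next
      case 2
      show ?thesis unfolding LY 2(1)
        by (rule ex[OF mem(3)[of j i]]) (use i 2 in \<open>auto\<close>)
    next
      case 3
      show ?thesis unfolding LY 3
        by (rule ex[OF mem(4)[of i i]]) (use i 3 in \<open>auto\<close>)
    next
      case 4
      show ?thesis unfolding LY 4
        by (rule ex[OF adj_mem(5)[of i i]]) (use i 4 in \<open>auto\<close>)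
    next
      case 5
      show ?thesis unfolding LY 5(1)
        by (rule ex[OF adj_mem(6)[of j i]]) (use i 5 in \<open>auto\<close>)
    next
      case 6
      show ?thesis unfolding LY 6(1)
        by (rule ex[OF adj_mem(7)[of j i]]) (use i 6 in \<open>auto\<close>)
    next
      case 7
      show ?thesis unfolding LY 7
        by (rule ex[OF mem(6)[of i i]]) (use i 7 in \<open>auto\<close>)
    next
      case 8
      show ?thesis unfolding LY 8(1)
        by (rule ex[OF mem(9)[of i j]]) (use i 8 in \<open>auto\<close>)
    qed
  qed
qed

section \<open>Reduction modulo an ideal and spanning\<close>

lemma ideal_free_ring:
  assumes "ideal I (free_ring n)"
  shows "I \<subseteq> carrier (free_ring n)" "0 \<in> I"
    "a \<in> I \<Longrightarrow> b \<in> I \<Longrightarrow> a + b \<in> I"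
    "a \<in> I \<Longrightarrow> u \<in> carrier (free_ring n) \<Longrightarrow> u * a \<in> I"
    "a \<in> I \<Longrightarrow> u \<in> carrier (free_ring n) \<Longrightarrow> a * u \<in> I"
    "a \<in> I \<Longrightarrow> c \<cdot>\<^sub>f a \<in> I" "a \<in> I \<Longrightarrow> - a \<in> I" "a \<in> I \<Longrightarrow> b \<in> I \<Longrightarrow> a - b \<in> I"
    "(\<And>j. j \<in> J \<Longrightarrow> h j \<in> I) \<Longrightarrow> sum h J \<in> I"
proof -
  interpret I: ideal I "free_ring n" by fact
  show "I \<subseteq> carrier (free_ring n)" using I.a_subset by simp
  show zero: "0 \<in> I" using additive_subgroup.zero_closed[OF I.additive_subgroup_axioms] by simp
  show add: "a \<in> I \<Longrightarrow> b \<in> I \<Longrightarrow> a + b \<in> I" for a b using additive_subgroup.a_closed[OF I.additive_subgroup_axioms, of a b] by simp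
  show l: "a \<in> I \<Longrightarrow> u \<in> carrier (free_ring n) \<Longrightarrow> u * a \<in> I" for a u using I.I_l_closed[of a u] by simp
  show "a \<in> I \<Longrightarrow> u \<in> carrier (free_ring n) \<Longrightarrow> a * u \<in> I" using I.I_r_closed[of a u] by simp
  have "c \<cdot>\<^sub>f 1 \<in> carrier (free_ring n)" for c by (intro free_ring_closed)
  then show scale: "a \<in> I \<Longrightarrow> c \<cdot>\<^sub>f a \<in> I" for c a using l[of a "c \<cdot>\<^sub>f 1"] by (simp add: fscale_def)
  show neg: "a \<in> I \<Longrightarrow> - a \<in> I" for a
    using l[of a "- 1"] by (simp add: free_ring_closed)
  show "a \<in> I \<Longrightarrow> b \<in> I \<Longrightarrow> a - b \<in> I" using add[of a "- b"] neg[of b] by simp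
  show "(\<And>j. j \<in> J \<Longrightarrow> h j \<in> I) \<Longrightarrow> sum h J \<in> I"
    by (induction J rule: infinite_finite_induct) (auto intro: zero add)
qed

lemma idealI_free_ring:
  assumes "J \<subseteq> carrier (free_ring n)" "0 \<in> J" "\<And>a b. a \<in> J \<Longrightarrow> b \<in> J \<Longrightarrow> a + b \<in> J"
    and l: "\<And>a u. a \<in> J \<Longrightarrow> u \<in> carrier (free_ring n) \<Longrightarrow> u * a \<in> J"
    and r: "\<And>a u. a \<in> J \<Longrightarrow> u \<in> carrier (free_ring n) \<Longrightarrow> a * u \<in> J"
  shows "ideal J (free_ring n)"
proof -
  interpret R: ring "free_ring n" by (rule ring_free_ring)
  show ?thesis
  proof (rule idealI[OF ring_free_ring])
    show "subgroup J (add_monoid (free_ring n))"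
    proof (rule group.subgroupI[OF R.a_group])
      fix b assume b: "b \<in> J"
      then have c: "b \<in> carrier (free_ring n)" using assms(1) by blast
      have "\<ominus>\<^bsub>free_ring n\<^esub> b = - b"
        using c by (intro R.minus_equality) (simp_all add: free_ring_closed)
      moreover have "- b \<in> J" using l[OF b, of "- 1"] by (simp add: free_ring_closed)
      ultimately show "inv\<^bsub>add_monoid (free_ring n)\<^esub> b \<in> J" by (simp add: a_inv_def)
    qed (use assms in auto)
  qed (use l r in auto)
qed

definition reduces :: "free_alg set \<Rightarrow> free_monoid set \<Rightarrow> free_alg \<Rightarrow> bool" where
  "reduces I N a \<longleftrightarrow> (\<exists>f. supp f \<subseteq> N \<and> a - f \<in> I)"

lemma free_alg_expand:
  "a = (\<Sum>w\<in>supp a. Poly_Mapping.lookup a w \<cdot>\<^sub>f mon w)"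
  by (rule poly_mapping_eqI)
    (auto simp: lookup_sum lookup_fscale lookup_single when_def in_keys_iff if_distrib cong: if_cong)

lemma reduces_linear:
  assumes I: "ideal I (free_ring n)" and w: "\<And>w. w \<in> supp a \<Longrightarrow> reduces I N (mon w)"
  shows "reduces I N a"
proof -
  from w obtain f where f: "\<And>w. w \<in> supp a \<Longrightarrow> supp (f w) \<subseteq> N"
    "\<And>w. w \<in> supp a \<Longrightarrow> mon w - f w \<in> I"
    unfolding reduces_def by metis
  let ?f = "\<Sum>w\<in>supp a. Poly_Mapping.lookup a w \<cdot>\<^sub>f f w"
  have "a - ?f = (\<Sum>w\<in>supp a. Poly_Mapping.lookup a w \<cdot>\<^sub>f (mon w - f w))"
    by (subst (1) free_alg_expand) (simp add: sum_subtractf fscale_def right_diff_distrib)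
  also have "\<dots> \<in> I" by (intro ideal_free_ring[OF I] f)
  finally have "a - ?f \<in> I" .
  moreover have "supp ?f \<subseteq> N"
  proof -
    have "supp ?f \<subseteq> (\<Union>w\<in>supp a. supp (Poly_Mapping.lookup a w \<cdot>\<^sub>f f w))"
      by (rule keys_sum)
    then show ?thesis using f(1) keys_fscale by blast
  qed
  ultimately show ?thesis unfolding reduces_def by blast
qed

lemma reduces_trans:
  assumes I: "ideal I (free_ring n)" and "a - b \<in> I" "reduces I N b"
  shows "reduces I N a"
proof -
  from assms(3) obtain f where "supp f \<subseteq> N" "b - f \<in> I" unfolding reduces_def by blast
  moreover have "a - f = (a - b) + (b - f)" by simp
  ultimately show ?thesis using assms(2) ideal_free_ring(3)[OF I] unfolding reduces_def by metis
qed

definition words_in :: "nat \<Rightarrow> free_monoid set" where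
  "words_in n = {w. set (letters w) \<subseteq> letters_in n}"

lemma carrier_free_ring: "a \<in> carrier (free_ring n) \<longleftrightarrow> supp a \<subseteq> words_in n"
  unfolding mem_free_ring' words_in_def by auto

text \<open>Well-founded induction on words: only the existence of some simpler rewriting is used,
  uniqueness of the result being left to the independence proof.\<close>

lemma reduces_carrier:
  assumes I: "ideal I (free_ring n)" and a: "a \<in> carrier (free_ring n)"
    and step: "\<And>w. w \<in> words_in n \<Longrightarrow> w \<notin> N \<Longrightarrow>
      \<exists>e. supp e \<subseteq> {v \<in> words_in n. (v, w) \<in> simpler n} \<and> mon w - e \<in> I"
  shows "reduces I N a"
proof -
  have "w \<in> words_in n \<longrightarrow> reduces I N (mon w)" for w
  proof (induction w rule: wf_induct_rule[OF wf_simpler[of n]])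
    case (1 w)
    show ?case
    proof (intro impI, cases "w \<in> N")
      case True
      then show "reduces I N (mon w)"
        unfolding reduces_def using ideal_free_ring(2)[OF I]
        by (intro exI[of _ "mon w"]) simp
    next
      case False
      assume "w \<in> words_in n"
      from step[OF this False] obtain e where e: "supp e \<subseteq> {v \<in> words_in n. (v, w) \<in> simpler n}"
        "mon w - e \<in> I" by blast
      have "reduces I N e" by (rule reduces_linear[OF I]) (use e 1 in blast)
      with e show "reduces I N (mon w)" by (metis reduces_trans[OF I])
    qed
  qed
  moreover have "supp a \<subseteq> words_in n" using a by (simp only: carrier_free_ring)
  ultimately show ?thesis using reduces_linear[OF I, of a N] by blast
qed

definition star_part :: "nat \<Rightarrow> (nat \<Rightarrow> nat) \<Rightarrow> (nat \<Rightarrow> nat) \<Rightarrow> letter list" where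
  "star_part n m k = concat (map (\<lambda>j. replicate (m j) (LYadj j)) [1..<n+1])
     @ concat (map (\<lambda>j. replicate (k j) (LXadj j)) [1..<n+1])"

definition plain_part :: "nat \<Rightarrow> (nat \<Rightarrow> nat) \<Rightarrow> (nat \<Rightarrow> nat) \<Rightarrow> letter list" where
  "plain_part n s t = concat (map (\<lambda>j. replicate (s j) (LX j)) (rev [1..<n+1]))
     @ concat (map (\<lambda>j. replicate (t j) (LY j)) (rev [1..<n+1]))"

definition pbw_words :: "nat \<Rightarrow> free_monoid set" where
  "pbw_words n = {Word (star_part n m k @ plain_part n s t) | m k s t. True}"

definition normal_words :: "nat \<Rightarrow> free_monoid set" where
  "normal_words n = {Word (star_part n m k @ plain_part n s t) | m k s t. k n = 0 \<or> s n = 0}"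

lemma sorted_in_pbw_words:
  assumes "sorted (map (rank n) w)" "set w \<subseteq> letters_in n"
  shows "Word w \<in> pbw_words n"
proof -
  let ?L = "map LYadj [1..<n+1] @ map LXadj [1..<n+1] @ map LX (rev [1..<n+1]) @ map LY (rev [1..<n+1])"
  define js where "js = [1..<n+1]"
  have js: "sorted_wrt (<) js" "set js = {1..n}"
    unfolding js_def by (rule sorted_wrt_upt) auto
  have up: "sorted_wrt (\<lambda>x y. rank n (f x) < rank n (f y)) js" if "f = LYadj \<or> f = LXadj" for f
    by (rule sorted_wrt_mono_rel[OF _ js(1)]) (use that in auto)
  have down: "sorted_wrt (\<lambda>x y. rank n (f x) < rank n (f y)) (rev js)" if "f = LX \<or> f = LY" for f
    unfolding sorted_wrt_rev by (rule sorted_wrt_mono_rel[OF _ js(1)]) (use that js(2) in auto)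
  have "sorted_wrt (<) (map (rank n) ?L)"
    unfolding js_def[symmetric] sorted_wrt_map sorted_wrt_append
    using up[of LYadj] up[of LXadj] down[of LX] down[of LY] js(2) by auto
  moreover have "set w \<subseteq> set ?L"
  proof
    fix l assume "l \<in> set w"
    then have "letter_index l \<in> {1..n}" using assms(2) by (auto simp: letters_in_def)
    then show "l \<in> set ?L" by (cases l) auto
  qed
  ultimately have "w = concat (map (\<lambda>l. replicate (count_list w l) l) ?L)"
    using assms(1) by (intro sorted_eq_concat_replicate)
  also have "\<dots> = star_part n (\<lambda>j. count_list w (LYadj j)) (\<lambda>j. count_list w (LXadj j))
      @ plain_part n (\<lambda>j. count_list w (LX j)) (\<lambda>j. count_list w (LY j))"
    by (simp add: star_part_def plain_part_def comp_def)
  finally show ?thesis unfolding pbw_words_def by blast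
qed

lemma keys_sandwich:
  assumes "supp e \<subseteq> Word ` E"
  shows "supp (mon (Word u) * e * mon (Word v) :: free_alg)
    \<subseteq> (\<lambda>w. Word (u @ w @ v)) ` E"
proof
  fix w assume "w \<in> supp (mon (Word u) * e * mon (Word v) :: free_alg)"
  then obtain x y where x: "w = x + y" "x \<in> supp (mon (Word u) * e :: free_alg)"
    "y \<in> supp (mon (Word v))"
    using keys_mult[of "mon (Word u) * e" "mon (Word v) :: free_alg"] by blast
  then obtain z where "x = Word u + z" "z \<in> supp e"
    using keys_mult[of "mon (Word u) :: free_alg" e] by fastforce
  with x assms show "w \<in> (\<lambda>w. Word (u @ w @ v)) ` E"
    by (auto simp: plus_free_monoid_def split: if_splits)
qed

lemma single_in_carrier: "set u \<subseteq> letters_in n \<Longrightarrow> Poly_Mapping.single (Word u) c \<in> carrier (free_ring n)"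
  by (auto simp: mem_free_ring')

lemma straightening_step:
  assumes I: "ideal I (free_ring n)" and R: "hom_relators q n \<union> adj ` hom_relators q n \<subseteq> I"
    and w: "w \<in> words_in n" "w \<notin> pbw_words n"
  shows "\<exists>e. supp e \<subseteq> {v \<in> words_in n. (v, w) \<in> simpler n} \<and> mon w - e \<in> I"
proof -
  obtain l where l: "w = Word l" by (cases w)
  have "set l \<subseteq> letters_in n" using w by (simp add: l words_in_def)
  moreover from this have "\<not> sorted (map (rank n) l)" using sorted_in_pbw_words w l by blast
  ultimately obtain u a b v where uv: "l = u @ a # b # v" "rank n b < rank n a"
    "a \<in> letters_in n" "b \<in> letters_in n" "set u \<subseteq> letters_in n" "set v \<subseteq> letters_in n"
    using unsorted_adjacent[of "rank n" l] by auto
  from straightening_rule[OF uv(3,4,2), of q] R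
  obtain e where e: "low n a b e" "gen a * gen b - e \<in> I" by blast
  let ?e = "mon (Word u) * e * mon (Word v)"
  have "mon w = mon (Word u) * (gen a * gen b) * mon (Word v)"
    unfolding l uv(1) gen_mult by (simp add: mult_single plus_free_monoid_def)
  then have "mon w - ?e = mon (Word u) * (gen a * gen b - e) * mon (Word v)"
    by (simp add: algebra_simps)
  also have "\<dots> \<in> I" using uv by (intro ideal_free_ring(4,5)[OF I] e single_in_carrier)
  finally have "mon w - ?e \<in> I" .
  moreover have "supp ?e \<subseteq> {v \<in> words_in n. (v, w) \<in> simpler n}"
  proof -
    have "supp e \<subseteq> Word ` {[c, d] | c d. lower n a b c d}" using e(1) by (auto simp: low_def)
    from keys_sandwich[OF this, of u v]
    have "supp ?e \<subseteq> (\<lambda>w. Word (u @ w @ v)) ` {[c, d] | c d. lower n a b c d}" .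
    also have "\<dots> \<subseteq> {v \<in> words_in n. (v, w) \<in> simpler n}"
    proof clarify
      fix c d assume cd: "lower n a b c d"
      then have "c \<in> letters_in n" "d \<in> letters_in n" by (auto simp: lower_def)
      with uv have "Word (u @ c # d # v) \<in> words_in n" by (simp add: words_in_def)
      moreover have "(Word (u @ c # d # v), w) \<in> simpler n"
        using lower_simpler[OF cd uv(2), of u v] by (simp only: l uv(1))
      ultimately show "Word (u @ [c, d] @ v) \<in> words_in n \<and> (Word (u @ [c, d] @ v), w) \<in> simpler n" by simp
    qed
    finally show ?thesis .
  qed
  ultimately show ?thesis by blast
qed

lemma plain_part_split:
  assumes "0 < s n" "0 < n"
  shows "\<exists>v. plain_part n s t = LX n # v"
proof -
  have "rev [1..<n+1] = n # rev [1..<n]" using assms(2) by (cases n) auto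
  moreover have "replicate (s n) (LX n) = LX n # replicate (s n - 1) (LX n)" using assms(1) by (cases "s n") auto
  ultimately show ?thesis by (simp add: plain_part_def)
qed

lemma star_part_split:
  assumes "0 < k n" "0 < n"
  shows "\<exists>u. star_part n m k = u @ [LXadj n]"
proof -
  have "[1..<n+1] = [1..<n] @ [n]" using assms(2) by (cases n) auto
  moreover have "replicate (k n) (LXadj n) = replicate (k n - 1) (LXadj n) @ [LXadj n]"
    using assms(1) by (cases "k n") (auto simp: replicate_append_same)
  ultimately show ?thesis by (simp add: star_part_def)
qed

lemma count_list_simpler:
  assumes "half c = half a" "half d = half b" "count_list [c, d] (LXadj n) < count_list [a, b] (LXadj n)"
  shows "(Word (u @ c # d # v), Word (u @ a # b # v)) \<in> simpler n"
  using assms by (auto simp: simpler_def complexity_def simp del: inversions.simps split: if_splits)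

text \<open>In the chosen order x_n^* ends the starred half and x_n begins the plain half, so
  positive exponents of both make them adjacent. Solving the sphere relation for x_n^* x_n lowers
  the number of x_n^* without new inversions of halves.\<close>

lemma sphere_step:
  assumes I: "ideal I (free_ring n)" and S: "sphere_element n - 1 \<in> I" and n: "0 < n"
    and w: "w \<in> words_in n" "w \<in> pbw_words n" "w \<notin> normal_words n"
  shows "\<exists>e. supp e \<subseteq> {v \<in> words_in n. (v, w) \<in> simpler n} \<and> mon w - e \<in> I"
proof -
  from w(2) obtain m k s t where l: "w = Word (star_part n m k @ plain_part n s t)"
    unfolding pbw_words_def by blast
  then have "0 < k n" "0 < s n" using w(3) by (auto simp: normal_words_def)
  then obtain u v where "star_part n m k = u @ [LXadj n]" "plain_part n s t = LX n # v"
    using star_part_split plain_part_split n by metis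
  with l have uv: "w = Word (u @ LXadj n # LX n # v)" by simp
  then have inc: "set u \<subseteq> letters_in n" "set v \<subseteq> letters_in n" "LXadj n \<in> letters_in n"
    using w(1) by (auto simp: words_in_def)
  define e where "e = 1 - ((\<Sum>i\<in>{1..<n}. gxs i * gx i) + (\<Sum>i\<in>{1..n}. gys i * gy i))"
  have "{1..n} = insert n {1..<n}" using n by auto
  then have "(\<Sum>i\<in>{1..n}. gxs i * gx i) = gxs n * gx n + (\<Sum>i\<in>{1..<n}. gxs i * gx i)" by simp
  then have "gen (LXadj n) * gen (LX n) - e = sphere_element n - 1"
    by (simp add: sphere_element_def e_def sum.distrib gen_simps)
  with S have e: "gen (LXadj n) * gen (LX n) - e \<in> I" by simp
  let ?E = "{[]} \<union> {[LXadj i, LX i] | i. i \<in> {1..<n}} \<union> {[LYadj i, LY i] | i. i \<in> {1..n}}"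
  have keys_e: "supp e \<subseteq> Word ` ?E"
  proof -
    have "supp (1 :: free_alg) \<subseteq> Word ` ?E" by (simp add: zero_free_monoid_def)
    moreover have "supp (\<Sum>i\<in>{1..<n}. gxs i * gx i) \<subseteq> Word ` ?E"
      by (rule order_trans[OF keys_sum]) (auto simp: gen_simps gen_mult)
    moreover have "supp (\<Sum>i\<in>{1..n}. gys i * gy i) \<subseteq> Word ` ?E"
      by (rule order_trans[OF keys_sum]) (auto simp: gen_simps gen_mult)
    ultimately show ?thesis
      unfolding e_def by (intro order_trans[OF keys_minus] Un_least order_trans[OF keys_add])
  qed
  let ?e = "mon (Word u) * e * mon (Word v)"
  have "mon w = mon (Word u) * (gen (LXadj n) * gen (LX n)) * mon (Word v)"
    unfolding uv gen_mult by (simp add: mult_single plus_free_monoid_def)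
  then have "mon w - ?e = mon (Word u) * (gen (LXadj n) * gen (LX n) - e) * mon (Word v)"
    by (simp add: algebra_simps)
  also have "\<dots> \<in> I" using inc by (intro ideal_free_ring(4,5)[OF I] e single_in_carrier)
  finally have "mon w - ?e \<in> I" .
  moreover have "supp ?e \<subseteq> {v \<in> words_in n. (v, w) \<in> simpler n}"
  proof -
    \<comment> \<open>The constant 1 deletes both letters: inversions of halves do not increase, and
      if they stay the same the count of x_n^* still drops.\<close>
    have empty: "(Word (u @ v), w) \<in> simpler n"
      using inversions_remove[of "map half u" "map half v" "half (LXadj n)" "half (LX n)"]
      by (auto simp: uv simpler_def complexity_def simp del: inversions.simps)
    have x: "(Word (u @ LXadj i # LX i # v), w) \<in> simpler n" if "i \<in> {1..<n}" for i
      unfolding uv using that by (intro count_list_simpler) auto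
    have y: "(Word (u @ LYadj i # LY i # v), w) \<in> simpler n" for i
      unfolding uv by (intro count_list_simpler) auto
    show ?thesis
    proof (rule order_trans[OF keys_sandwich[OF keys_e, of u v]])
      show "(\<lambda>w. Word (u @ w @ v)) ` ?E \<subseteq> {v \<in> words_in n. (v, w) \<in> simpler n}"
        using empty x y inc by (auto simp: words_in_def letters_in_def)
    qed
  qed
  ultimately show ?thesis by blast
qed

lemma pbw_spanning:
  assumes "ideal I (free_ring n)" "hom_relators q n \<union> adj ` hom_relators q n \<subseteq> I" "a \<in> carrier (free_ring n)"
  shows "reduces I (pbw_words n) a"
  using assms straightening_step by (intro reduces_carrier) blast+

lemma normal_spanning:
  assumes "ideal I (free_ring n)" "hom_relators q n \<union> adj ` hom_relators q n \<subseteq> I" "a \<in> carrier (free_ring n)"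
    "sphere_element n - 1 \<in> I" "0 < n"
  shows "reduces I (normal_words n) a"
  using assms straightening_step sphere_step by (intro reduces_carrier) blast+

section \<open>Linear independence\<close>

primrec plain_index :: "nat \<Rightarrow> letter \<Rightarrow> nat" where
  "plain_index n (LX i) = i"
| "plain_index n (LY i) = 2 * n + 1 - i"
| "plain_index n (LXadj i) = i"
| "plain_index n (LYadj i) = 2 * n + 1 - i"

context qsphere begin

lemma plain_index_idx: "l \<in> letters_in n \<Longrightarrow> plain_index n l \<in> idx"
  by (cases l) (auto simp: letters_in_def)

lemma plain_index_set: "set w \<subseteq> letters_in n \<Longrightarrow> set (map (plain_index n) w) \<subseteq> idx"
  unfolding set_map by (intro image_subsetI plain_index_idx) blast

lemma act_plain: "half l = 1 \<Longrightarrow> act l = Lz (plain_index n l)"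
  by (cases l) (auto simp: bar_def)

lemma act_star: "half l = 0 \<Longrightarrow> act l = Ls (plain_index n l)"
  by (cases l) (auto simp: bar_def)

lemma half_cases: "half l = 0 \<or> half l = 1"
  by (cases l) auto

lemma good_act:
  assumes "good k" "l \<in> letters_in n" shows "good (act l k)"
proof (cases "half l = 0")
  case True
  show ?thesis unfolding act_star[OF True] Ls_def by (intro good_scale good_Lw assms)
next
  case False
  then show ?thesis using half_cases[of l] good_Lz[OF assms(1) plain_index_idx[OF assms(2)]]
    by (simp add: act_plain)
qed

lemma good_act_word: "good k \<Longrightarrow> set w \<subseteq> letters_in n \<Longrightarrow> good (act_word w k)"
  by (induction w arbitrary: k) (auto simp: good_act)

lemma good_sum: "(\<And>j. j \<in> J \<Longrightarrow> good (k j)) \<Longrightarrow> good (\<lambda>t f. \<Sum>j\<in>J. k j t f)"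
  by (induction J rule: infinite_finite_induct) (simp_all add: good_zero good_add)

lemma good_act_alg:
  assumes "good k" "a \<in> carrier (free_ring n)" shows "good (act_alg a k)"
  unfolding act_alg_def
proof (intro good_sum good_scale good_act_word assms)
  fix w assume "w \<in> supp a"
  then show "set (letters w) \<subseteq> letters_in n" using assms(2) by (auto simp: mem_free_ring')
qed

lemma Lc_scale: "Lc (\<lambda>t f. x * k t f) = (\<lambda>t f. x * Lc k t f)"
  by (intro ext) (simp add: Lc_def Lw_def Lz_scale sum_distrib_left mult_ac)

lemma Lc_add: "Lc (\<lambda>t f. k t f + k' t f) = (\<lambda>t f. Lc k t f + Lc k' t f)"
  by (intro ext) (simp add: Lc_def Lw_def Lz_add sum.distrib algebra_simps)

lemma Lc_sum: "Lc (\<lambda>t f. \<Sum>j\<in>J. k j t f) = (\<lambda>t f. \<Sum>j\<in>J. Lc (k j) t f)"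
proof (induction J rule: infinite_finite_induct)
  case (insert j J)
  then show ?case by (simp add: Lc_add)
qed (use Lc_scale[of 0] in simp_all)

lemma Lc_act:
  assumes "good k" "l \<in> letters_in n" shows "Lc (act l k) = act l (Lc k)"
proof (cases "half l = 0")
  case True
  have "bar (plain_index n l) \<in> idx" using plain_index_idx[OF assms(2)] by simp
  from Lc_Lw[OF assms(1) this] show ?thesis
    by (simp only: act_star[OF True] Ls_def Lc_scale)
next
  case False
  then show ?thesis using half_cases[of l] Lc_Lz[OF assms(1) plain_index_idx[OF assms(2)]]
    by (simp add: act_plain)
qed

lemma Lc_act_word: "good k \<Longrightarrow> set w \<subseteq> letters_in n \<Longrightarrow> Lc (act_word w k) = act_word w (Lc k)"
  by (induction w arbitrary: k) (auto simp: good_act Lc_act)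

lemma Lc_act_alg:
  assumes "good k" "a \<in> carrier (free_ring n)" shows "Lc (act_alg a k) = act_alg a (Lc k)"
proof (intro ext)
  fix t f
  have "Lc (act_word (letters w) k) = act_word (letters w) (Lc k)" if "w \<in> supp a" for w
    using assms that by (intro Lc_act_word) (auto simp: mem_free_ring')
  then show "Lc (act_alg a k) t f = act_alg a (Lc k) t f"
    unfolding act_alg_def Lc_sum Lc_scale by (intro sum.cong) auto
qed

lemma act_sphere_element': "act_alg (sphere_element n) k = (\<lambda>t f. - (1 / Q ^ (2 * n + 2)) * Lc k t f)"
  by (intro ext) (simp add: act_sphere_element)

lemma act_alg_sphere_element_commute:
  assumes "good k" "a \<in> carrier (free_ring n)"
  shows "act_alg (a * sphere_element n) k = act_alg (sphere_element n * a) k"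
  unfolding act_alg_mult act_sphere_element' act_alg_scale Lc_act_alg[OF assms] ..

text \<open>Substitute for the ideal of the quadratic relations: it contains them, and membership
  can be refuted by a single good functional.\<close>

definition annihilator :: "free_alg set" where
  "annihilator = {a \<in> carrier (free_ring n). \<forall>k. good k \<longrightarrow> act_alg a k = (\<lambda>t f. 0)}"

lemma ideal_annihilator: "ideal annihilator (free_ring n)"
proof (rule idealI_free_ring)
  fix a u assume "a \<in> annihilator" "u \<in> carrier (free_ring n)"
  then show "u * a \<in> annihilator" "a * u \<in> annihilator"
    by (auto simp: annihilator_def act_alg_mult good_act_alg intro: free_ring_closed)
qed (auto simp: annihilator_def act_alg_plus intro: free_ring_closed)

lemma sphere_element_carrier: "sphere_element n \<in> carrier (free_ring n)"
  unfolding sphere_element_def by (intro free_ring_closed) auto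

text \<open>One factor \<open>g\<close> on the right suffices because c commutes with everything
  modulo \<open>annihilator\<close>; this is what makes the set a two-sided ideal.\<close>

definition central_ideal :: "free_alg set" where
  "central_ideal = {a \<in> carrier (free_ring n).
     \<exists>g\<in>carrier (free_ring n). a - (sphere_element n - 1) * g \<in> annihilator}"

lemma ideal_central_ideal: "ideal central_ideal (free_ring n)"
proof (rule idealI_free_ring)
  note A = ideal_free_ring[OF ideal_annihilator]
  let ?c = "sphere_element n"
  show "0 \<in> central_ideal"
    using A(2) by (auto simp: central_ideal_def free_ring_closed intro!: bexI[of _ 0])
  fix a assume a: "a \<in> central_ideal"
  then obtain g where g: "a \<in> carrier (free_ring n)" "g \<in> carrier (free_ring n)" "a - (?c - 1) * g \<in> annihilator"
    by (auto simp: central_ideal_def)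
  show "a + b \<in> central_ideal" if "b \<in> central_ideal" for b
  proof -
    from that obtain h where h: "b \<in> carrier (free_ring n)" "h \<in> carrier (free_ring n)" "b - (?c - 1) * h \<in> annihilator"
      by (auto simp: central_ideal_def)
    have "(a + b) - (?c - 1) * (g + h) = (a - (?c - 1) * g) + (b - (?c - 1) * h)" by (simp add: algebra_simps)
    also have "\<dots> \<in> annihilator" using A(3) g h by blast
    finally show ?thesis using g h unfolding central_ideal_def by (blast intro: free_ring_closed)
  qed
  fix u assume u: "u \<in> carrier (free_ring n)"
  have "u * ?c - ?c * u \<in> annihilator"
    using u act_alg_sphere_element_commute
    by (simp add: annihilator_def act_alg_minus free_ring_closed sphere_element_carrier)
  then have "u * (a - (?c - 1) * g) + (u * ?c - ?c * u) * g \<in> annihilator"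
    using A(3,4,5) g u by blast
  \<comment> \<open>The commutator of u and c compensates for moving u past c - 1, so
    \<open>u * g\<close> is the new witness.\<close>
  also have "u * (a - (?c - 1) * g) + (u * ?c - ?c * u) * g = u * a - (?c - 1) * (u * g)"
    by (simp add: algebra_simps)
  finally show "u * a \<in> central_ideal" using g u unfolding central_ideal_def by (blast intro: free_ring_closed)
  have "(a - (?c - 1) * g) * u \<in> annihilator" using A(5) g u by blast
  also have "(a - (?c - 1) * g) * u = a * u - (?c - 1) * (g * u)" by (simp add: algebra_simps)
  finally show "a * u \<in> central_ideal" using g u unfolding central_ideal_def by (blast intro: free_ring_closed)
qed (auto simp: central_ideal_def)

lemma hom_relators_annihilator:
  assumes "Q = complex_of_real q"
  shows "hom_relators q n \<union> adj ` hom_relators q n \<subseteq> annihilator"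
proof
  fix r assume r: "r \<in> hom_relators q n \<union> adj ` hom_relators q n"
  have "hom_relators q n \<subseteq> carrier (free_ring n)"
    using sphere_relators_closed[of q n] unfolding sphere_relators_eq by blast
  then have "r \<in> carrier (free_ring n)" using r by (auto intro: free_ring_closed)
  with kills_hom_relators[OF assms r] show "r \<in> annihilator" by (auto simp: annihilator_def fun_eq_iff)
qed

lemma adj_sphere_element: "adj (sphere_element n - 1) = sphere_element n - 1"
  by (simp add: sphere_element_def adj_minus adj_sum adj_plus adj_mult)

lemma sphere_ideal_central:
  assumes "Q = complex_of_real q"
  shows "sphere_ideal q n \<subseteq> central_ideal"
proof -
  interpret R: ring "free_ring n" by (rule ring_free_ring)
  have "annihilator \<subseteq> central_ideal"
    using ideal_free_ring(1)[OF ideal_annihilator]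
    by (auto simp: central_ideal_def free_ring_closed intro!: bexI[of _ 0])
  moreover have "sphere_element n - 1 \<in> central_ideal"
    using ideal_free_ring(2)[OF ideal_annihilator] sphere_element_carrier
    by (auto simp: central_ideal_def free_ring_closed intro!: bexI[of _ 1])
  ultimately have "sphere_relators q n \<union> adj ` sphere_relators q n \<subseteq> central_ideal"
    using hom_relators_annihilator[OF assms] adj_sphere_element unfolding sphere_relators_eq by auto
  then show ?thesis
    unfolding sphere_ideal_def by (intro R.genideal_minimal ideal_central_ideal)
qed

section \<open>Evaluation at pairs of torus points\<close>

text \<open>Both tensor factors are evaluated in the quantum torus, the starred one backwards, so that
  multiplication by \<open>w\<^bsub>bar b\<^esub> \<otimes> z\<^sub>b\<close> in the middle becomes a shift by \<open>b\<close> in both factors.\<close>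

definition point :: "torus \<Rightarrow> torus \<Rightarrow> functional" where
  "point p r = (\<lambda>t f. coord p (rev (map bar t)) * coord r f)"

lemma good_point: "good (point p r)"
  unfolding good_def
proof (intro conjI allI)
  fix u v f
  have "qrel (\<lambda>a b. coord p (rev (map bar v) @ a # b # rev (map bar u)))"
    unfolding coord_def by (rule qrel_ev)
  from qrel_bar_swap[OF this]
  have "qrel (\<lambda>a b. coord r f * coord p (rev (map bar v) @ bar b # bar a # rev (map bar u)))"
    by (rule qrel_scale)
  then show "qrel (\<lambda>a b. point p r (u @ a # b # v) f)" by (simp add: point_def mult.commute)
next
  fix t u v
  have "qrel (\<lambda>a b. coord r (u @ a # b # v))" unfolding coord_def by (rule qrel_ev)
  then show "qrel (\<lambda>a b. point p r t (u @ a # b # v))" unfolding point_def by (rule qrel_scale)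
qed

definition star_coeff :: "letter list \<Rightarrow> complex" where
  "star_coeff u = prod_list (map (\<lambda>l. - (wt (plain_index n l) / Q ^ (2 * n + 2))) u)"

lemma star_coeff_nonzero: "star_coeff u \<noteq> 0"
  by (induction u) (simp_all add: star_coeff_def)

lemma act_word_star:
  assumes "\<forall>l\<in>set u. half l = 0"
  shows "act_word u k t f = star_coeff u * k (map (\<lambda>l. bar (plain_index n l)) u @ t) f"
  using assms
  by (induction u arbitrary: k) (simp_all add: star_coeff_def act_star Ls_def Lw_def)

lemma act_word_plain:
  assumes "\<forall>l\<in>set v. half l = 1"
  shows "act_word v k [] f = k [] (map (plain_index n) v @ f)"
  using assms by (induction v arbitrary: k) (simp_all add: act_plain Lz_def)

abbreviation star_lead :: "letter list \<Rightarrow> torus" where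
  "star_lead u \<equiv> lead (rev (map (plain_index n) u))"

abbreviation plain_lead :: "letter list \<Rightarrow> torus" where
  "plain_lead v \<equiv> lead (map (plain_index n) v)"

lemma bar_plain_index: "l \<in> letters_in n \<Longrightarrow> bar (bar (plain_index n l)) = plain_index n l"
  using plain_index_idx[of l] by simp

lemma point_word:
  assumes u: "\<forall>l\<in>set u. half l = 0" "set u \<subseteq> letters_in n" and v: "\<forall>l\<in>set v. half l = 1"
  shows "act_word (u @ v) (point p r) [] [] = star_coeff u
     * (coord p (rev (map (plain_index n) u)) * coord r (map (plain_index n) v))"
proof -
  have m: "map (bar \<circ> (\<lambda>l. bar (plain_index n l))) u = map (plain_index n) u"
    using u(2) bar_plain_index by auto
  show ?thesis
    by (simp add: act_word_append act_word_plain[OF v] act_word_star[OF u(1)] point_def m)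
qed

text \<open>Centrality moves c between the starred and the plain half. There its summands w_{bar b}
  z_b are already straightened, and each just puts \<open>b\<close> in front in both torus
  words.\<close>

lemma point_sphere_word:
  assumes u: "\<forall>l\<in>set u. half l = 0" "set u \<subseteq> letters_in n"
    and v: "\<forall>l\<in>set v. half l = 1" "set v \<subseteq> letters_in n"
  shows "act_alg (sphere_element n * mon (Word (u @ v))) (point p r) [] [] =
     - (1 / Q ^ (2 * n + 2)) * star_coeff u * (\<Sum>b\<in>idx. wt b *
        (coord p (b # rev (map (plain_index n) u)) * coord r (b # map (plain_index n) v)))"
proof -
  have k: "good (act_word u (point p r))" by (rule good_act_word[OF good_point u(2)])
  have m: "map (bar \<circ> (\<lambda>l. bar (plain_index n l))) u = map (plain_index n) u"
    using u(2) bar_plain_index by auto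
  have "act_alg (sphere_element n * mon (Word (u @ v))) (point p r) [] []
      = - (1 / Q ^ (2 * n + 2)) * act_word v (Lc (act_word u (point p r))) [] []"
    unfolding act_alg_mult act_sphere_element' act_alg_scale act_alg_single
    using Lc_act_word[OF good_point u(2), of p r] by (simp add: act_word_append)
  also have "act_word v (Lc (act_word u (point p r))) [] []
      = (\<Sum>b\<in>idx. wt b * act_word u (point p r) [bar b] (b # map (plain_index n) v))"
    by (simp add: act_word_plain[OF v(1)] Lc_def Lz_def Lw_def)
  also have "\<dots> = star_coeff u * (\<Sum>b\<in>idx. wt b *
        (coord p (b # rev (map (plain_index n) u)) * coord r (b # map (plain_index n) v)))"
    unfolding sum_distrib_left
  proof (rule sum.cong[OF refl])
    fix b assume "b \<in> idx"
    then have "bar (bar b) = b" by simp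
    then show "wt b * act_word u (point p r) [bar b] (b # map (plain_index n) v) = star_coeff u * (wt b *
        (coord p (b # rev (map (plain_index n) u)) * coord r (b # map (plain_index n) v)))"
      by (simp add: act_word_star[OF u(1)] point_def m)
  qed
  finally show ?thesis by (simp only: mult.assoc)
qed

text \<open>A word has nonzero coordinates only at its leading point and at points of strictly lower
  level. If the levels add up to at least the leading total, both points must be leading.\<close>

lemma coord_pair:
  assumes "set f \<subseteq> idx" "set g \<subseteq> idx" "level (lead f) + level (lead g) \<le> level p + level r"
  shows "coord p f * coord r g \<noteq> 0 \<longleftrightarrow> p = lead f \<and> r = lead g"
proof
  assume "coord p f * coord r g \<noteq> 0"
  then have "\<not> (level (lead f) \<le> level p \<and> lead f \<noteq> p)" "\<not> (level (lead g) \<le> level r \<and> lead g \<noteq> r)"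
    using coord_eq_0[OF assms(1), of p] coord_eq_0[OF assms(2), of r] by auto
  then show "p = lead f \<and> r = lead g"
    using assms(3) by (cases "lead f = p"; cases "lead g = r") auto
next
  assume "p = lead f \<and> r = lead g"
  then show "coord p f * coord r g \<noteq> 0" using coord_lead assms(1,2) by simp
qed

lemma star_part_props:
  "\<forall>l\<in>set (star_part n m k). half l = 0" "set (star_part n m k) \<subseteq> letters_in n"
  "\<forall>l\<in>set (plain_part n s t). half l = 1" "set (plain_part n s t) \<subseteq> letters_in n"
  by (auto simp: star_part_def plain_part_def letters_in_def split: if_splits)

lemma count_list_replicate: "count_list (replicate k x) y = (if x = y then k else 0)"
  by (induction k) auto

lemma count_concat_replicate:
  assumes "distinct js" "inj L"
  shows "count_list (map P (concat (map (\<lambda>j. replicate (m j) (L j)) js))) x = (\<Sum>j\<in>set js. if P (L j) = x then m j else 0)"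
  using assms(1) by (induction js) (auto simp: count_list_replicate)

lemma sum_if_bar:
  assumes "i \<in> {1..n}"
  shows "(\<Sum>j\<in>{1..n}. if bar j = i then m j else 0 :: nat) = 0" "(\<Sum>j\<in>{1..n}. if j = bar i then m j else 0 :: nat) = 0"
    "(\<Sum>j\<in>{1..n}. if bar j = bar i then m j else 0 :: nat) = m i" "(\<Sum>j\<in>{1..n}. if j = i then m j else 0 :: nat) = m i"
proof -
  show "(\<Sum>j\<in>{1..n}. if bar j = i then m j else 0 :: nat) = 0" "(\<Sum>j\<in>{1..n}. if j = bar i then m j else 0 :: nat) = 0"
    using assms by (intro sum.neutral; auto simp: bar_def)+
  have "(\<Sum>j\<in>{1..n}. if bar j = bar i then m j else 0 :: nat) = (\<Sum>j\<in>{1..n}. if j = i then m j else 0)"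
    using assms by (intro sum.cong) (auto simp: bar_def)
  then show "(\<Sum>j\<in>{1..n}. if bar j = bar i then m j else 0 :: nat) = m i" "(\<Sum>j\<in>{1..n}. if j = i then m j else 0 :: nat) = m i"
    using assms by simp_all
qed

lemma star_lead_values:
  assumes i: "i \<in> {1..n}"
  shows "fst (star_lead (star_part n m k)) i = int (k i) - int (m i)" "snd (star_lead (star_part n m k)) i = int (m i)"
proof -
  have "set (rev (map (plain_index n) (star_part n m k))) \<subseteq> idx"
    using plain_index_set[OF star_part_props(2)] by (simp only: set_rev)
  note lc = lead_count[OF this i]
  have x: "count_list (map (plain_index n) (star_part n m k)) x
     = (\<Sum>j\<in>{1..n}. if bar j = x then m j else 0) + (\<Sum>j\<in>{1..n}. if j = x then k j else 0)" for x
  proof -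
    have "set [1..<n+1] = {1..n}" by auto
    then show ?thesis
      unfolding star_part_def map_append count_list_append
      by (subst (1 2) count_concat_replicate) (auto simp: inj_def bar_def)
  qed
  have "count_list (map (plain_index n) (star_part n m k)) i = k i"
    "count_list (map (plain_index n) (star_part n m k)) (bar i) = m i"
    unfolding x sum_if_bar[OF i] by simp_all
  with lc show "fst (star_lead (star_part n m k)) i = int (k i) - int (m i)"
    "snd (star_lead (star_part n m k)) i = int (m i)" by simp_all
qed

lemma plain_lead_values:
  assumes i: "i \<in> {1..n}"
  shows "fst (plain_lead (plain_part n s t)) i = int (s i) - int (t i)" "snd (plain_lead (plain_part n s t)) i = int (t i)"
proof -
  have "set (map (plain_index n) (plain_part n s t)) \<subseteq> idx"
    by (rule plain_index_set[OF star_part_props(4)])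
  note lc = lead_count[OF this i]
  have x: "count_list (map (plain_index n) (plain_part n s t)) x
     = (\<Sum>j\<in>{1..n}. if j = x then s j else 0) + (\<Sum>j\<in>{1..n}. if bar j = x then t j else 0)" for x
  proof -
    have "set (rev [1..<n+1]) = {1..n}" by auto
    then show ?thesis
      unfolding plain_part_def map_append count_list_append
      by (subst (1 2) count_concat_replicate) (auto simp: inj_def bar_def)
  qed
  have "count_list (map (plain_index n) (plain_part n s t)) i = s i"
    "count_list (map (plain_index n) (plain_part n s t)) (bar i) = t i"
    unfolding x sum_if_bar[OF i] by simp_all
  with lc show "fst (plain_lead (plain_part n s t)) i = int (s i) - int (t i)"
    "snd (plain_lead (plain_part n s t)) i = int (t i)" by simp_all
qed

lemma star_part_cong: "(\<And>i. i \<in> {1..n} \<Longrightarrow> m i = m' i \<and> k i = k' i) \<Longrightarrow> star_part n m k = star_part n m' k'"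
  unfolding star_part_def by (intro arg_cong2[of _ _ _ _ "(@)"] arg_cong[of _ _ concat] map_cong refl) auto

lemma plain_part_cong: "(\<And>i. i \<in> {1..n} \<Longrightarrow> s i = s' i \<and> t i = t' i) \<Longrightarrow> plain_part n s t = plain_part n s' t'"
  unfolding plain_part_def by (intro arg_cong2[of _ _ _ _ "(@)"] arg_cong[of _ _ concat] map_cong refl) auto

definition stars :: "free_monoid \<Rightarrow> letter list" where "stars w = filter (\<lambda>l. half l = 0) (letters w)"
definition plains :: "free_monoid \<Rightarrow> letter list" where "plains w = filter (\<lambda>l. half l = 1) (letters w)"

lemma stars_plains_pbw:
  "stars (Word (star_part n m k @ plain_part n s t)) = star_part n m k"
  "plains (Word (star_part n m k @ plain_part n s t)) = plain_part n s t"
  using star_part_props by (auto simp: stars_def plains_def filter_id_conv filter_empty_conv)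

definition leading :: "free_monoid \<Rightarrow> torus \<times> torus" where
  "leading w = (star_lead (stars w), plain_lead (plains w))"

definition total_level :: "torus \<times> torus \<Rightarrow> int" where
  "total_level = (\<lambda>(p, r). level p + level r)"

text \<open>The effect of the summand x_n^* x_n of the sphere element on leading points.\<close>

definition diagonal_shift :: "torus \<times> torus \<Rightarrow> torus \<times> torus" where
  "diagonal_shift = (\<lambda>(p, r). (shift n p, shift n r))"

lemma inj_leading:
  assumes "w \<in> pbw_words n" "w' \<in> pbw_words n" "leading w = leading w'"
  shows "w = w'"
proof -
  from assms(1) obtain m k s t where w: "w = Word (star_part n m k @ plain_part n s t)" by (auto simp: pbw_words_def)
  from assms(2) obtain m' k' s' t' where w': "w' = Word (star_part n m' k' @ plain_part n s' t')" by (auto simp: pbw_words_def)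
  have eq: "star_lead (star_part n m k) = star_lead (star_part n m' k')"
    "plain_lead (plain_part n s t) = plain_lead (plain_part n s' t')"
    using assms(3) by (auto simp: leading_def w w' stars_plains_pbw)
  have "m i = m' i \<and> k i = k' i" "s i = s' i \<and> t i = t' i" if "i \<in> {1..n}" for i
    using star_lead_values[OF that, of m k] star_lead_values[OF that, of m' k'] eq
      plain_lead_values[OF that, of s t] plain_lead_values[OF that, of s' t'] by auto
  then show ?thesis unfolding w w' using star_part_cong plain_part_cong by metis
qed

text \<open>The shift leaves the second components alone, so the exponents of y_n and y_n^* agree
  and those of both x_n and x_n^* grow by one. A normal word has one of the latter equal to
  0.\<close>

lemma leading_normal:
  assumes "w \<in> normal_words n" "w' \<in> pbw_words n" and n: "0 < n"
  shows "leading w \<noteq> diagonal_shift (leading w')"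
proof
  assume eq: "leading w = diagonal_shift (leading w')"
  from assms(1) obtain m k s t where w: "w = Word (star_part n m k @ plain_part n s t)" "k n = 0 \<or> s n = 0"
    by (auto simp: normal_words_def)
  from assms(2) obtain m' k' s' t' where w': "w' = Word (star_part n m' k' @ plain_part n s' t')" by (auto simp: pbw_words_def)
  have i: "n \<in> {1..n}" using n by auto
  have "star_lead (star_part n m k) = shift n (star_lead (star_part n m' k'))"
    "plain_lead (plain_part n s t) = shift n (plain_lead (plain_part n s' t'))"
    using eq by (auto simp: leading_def diagonal_shift_def w w' stars_plains_pbw)
  moreover have "fst (shift n p) n = fst p n + 1" "snd (shift n p) n = snd p n" for p
    by (auto simp: shift_def bump_def split: prod.splits)
  ultimately have "int (k n) - int (m n) = int (k' n) - int (m' n) + 1" "int (m n) = int (m' n)"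
    "int (s n) - int (t n) = int (s' n) - int (t' n) + 1" "int (t n) = int (t' n)"
    using star_lead_values[OF i, of m k] star_lead_values[OF i, of m' k']
      plain_lead_values[OF i, of s t] plain_lead_values[OF i, of s' t'] by metis+
  with w(2) show False by linarith
qed

lemma inj_diagonal_shift: "diagonal_shift x = diagonal_shift y \<Longrightarrow> x = y"
proof -
  have "p = p'" if "shift n p = shift n p'" for p p' :: torus
  proof (cases p, cases p')
    fix \<alpha> \<beta> \<alpha>' \<beta>' assume p: "p = (\<alpha>, \<beta>)" "p' = (\<alpha>', \<beta>')"
    then have "bump n 1 \<alpha> = bump n 1 \<alpha>'" "\<beta> = \<beta>'" using that by (auto simp: shift_def)
    then have "bump n (- 1) (bump n 1 \<alpha>) = bump n (- 1) (bump n 1 \<alpha>')" by simp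
    then show "p = p'" using \<open>\<beta> = \<beta>'\<close> by (simp add: p bump_bump)
  qed
  then show "diagonal_shift x = diagonal_shift y \<Longrightarrow> x = y" by (auto simp: diagonal_shift_def split: prod.splits)
qed

lemma total_level_diagonal_shift: "0 < n \<Longrightarrow> total_level (diagonal_shift x) = total_level x + 2 * (int n + 1)"
  by (cases x) (simp add: total_level_def diagonal_shift_def level_shift level_of_def)

abbreviation eval_at :: "torus \<times> torus \<Rightarrow> free_alg \<Rightarrow> complex" where
  "eval_at x a \<equiv> act_alg a (point (fst x) (snd x)) [] []"

lemma eval_at_pbw:
  assumes "w \<in> pbw_words n" "total_level (leading w) \<le> total_level x"
  shows "eval_at x (mon w) \<noteq> 0 \<longleftrightarrow> x = leading w"
proof -
  from assms(1) obtain m k s t where w: "w = Word (star_part n m k @ plain_part n s t)" by (auto simp: pbw_words_def)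
  let ?u = "star_part n m k" and ?v = "plain_part n s t"
  have idx: "set (rev (map (plain_index n) ?u)) \<subseteq> idx" "set (map (plain_index n) ?v) \<subseteq> idx"
    using plain_index_set[OF star_part_props(2)] plain_index_set[OF star_part_props(4)]
    by (simp_all only: set_rev)
  have "eval_at x (mon w) = star_coeff ?u *
     (coord (fst x) (rev (map (plain_index n) ?u)) * coord (snd x) (map (plain_index n) ?v))"
    using point_word[OF star_part_props(1,2,3)] by (simp add: act_alg_single w)
  moreover have "level (star_lead ?u) + level (plain_lead ?v) \<le> level (fst x) + level (snd x)"
    using assms(2) by (simp add: total_level_def leading_def w stars_plains_pbw split: prod.splits)
  from coord_pair[OF idx this]
  have "coord (fst x) (rev (map (plain_index n) ?u)) * coord (snd x) (map (plain_index n) ?v) \<noteq> 0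
     \<longleftrightarrow> fst x = star_lead ?u \<and> snd x = plain_lead ?v" .
  ultimately show ?thesis
    using star_coeff_nonzero[of ?u] by (auto simp: leading_def w stars_plains_pbw prod_eq_iff)
qed

text \<open>Of the \<open>2 n\<close> terms of the sphere element only \<open>x\<^sub>n\<^sup>* x\<^sub>n\<close> reaches the top level.\<close>

lemma eval_at_sphere_pbw:
  assumes "w \<in> pbw_words n" "total_level (diagonal_shift (leading w)) \<le> total_level x" and n: "0 < n"
  shows "eval_at x (sphere_element n * mon w) \<noteq> 0 \<longleftrightarrow> x = diagonal_shift (leading w)"
proof -
  from assms(1) obtain m k s t where w: "w = Word (star_part n m k @ plain_part n s t)" by (auto simp: pbw_words_def)
  let ?u = "rev (map (plain_index n) (star_part n m k))" and ?v = "map (plain_index n) (plain_part n s t)"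
  have idx: "set ?u \<subseteq> idx" "set ?v \<subseteq> idx"
    using plain_index_set[OF star_part_props(2)] plain_index_set[OF star_part_props(4)]
    by (simp_all only: set_rev)
  have lv: "level (lead ?u) + level (lead ?v) + 2 * (int n + 1) \<le> level (fst x) + level (snd x)"
    using assms(2) total_level_diagonal_shift[OF n]
    by (simp add: total_level_def leading_def w stars_plains_pbw split: prod.splits)
  have zero: "coord (fst x) (b # ?u) * coord (snd x) (b # ?v) = 0" if b: "b \<in> idx" "b \<noteq> n" for b
  proof -
    have "level_of b < int n + 1" using b by (auto simp: level_of_def bar_def)
    then have less: "level (lead (b # ?u)) + level (lead (b # ?v)) < level (fst x) + level (snd x)"
      using lv b(1) by (simp add: level_shift)
    then have "\<not> (fst x = lead (b # ?u) \<and> snd x = lead (b # ?v))" by auto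
    with coord_pair[of "b # ?u" "b # ?v" "fst x" "snd x"] show ?thesis using idx b(1) less by auto
  qed
  have "n \<in> idx" using n by auto
  then have "(\<Sum>b\<in>idx. wt b * (coord (fst x) (b # ?u) * coord (snd x) (b # ?v)))
     = wt n * (coord (fst x) (n # ?u) * coord (snd x) (n # ?v))"
    using zero by (subst sum.remove[of _ n]) (simp_all add: sum.neutral)
  then have "eval_at x (sphere_element n * mon w) \<noteq> 0
     \<longleftrightarrow> coord (fst x) (n # ?u) * coord (snd x) (n # ?v) \<noteq> 0"
    using point_sphere_word[OF star_part_props(1,2,3,4), of m k s t] star_coeff_nonzero
    by (simp add: w)
  also have "\<dots> \<longleftrightarrow> fst x = lead (n # ?u) \<and> snd x = lead (n # ?v)"
    using idx \<open>n \<in> idx\<close> lv by (intro coord_pair) (auto simp: level_shift level_of_def)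
  also have "\<dots> \<longleftrightarrow> x = diagonal_shift (leading w)"
    by (auto simp: leading_def diagonal_shift_def w stars_plains_pbw prod_eq_iff)
  finally show ?thesis .
qed

lemma eval_at_sum:
  "eval_at x (u * f) = (\<Sum>w\<in>supp f. Poly_Mapping.lookup f w * eval_at x (u * mon w))"
proof -
  have "u * f = (\<Sum>w\<in>supp f. Poly_Mapping.lookup f w \<cdot>\<^sub>f (u * mon w))"
  proof -
    have comm: "u * (c \<cdot>\<^sub>f a) = c \<cdot>\<^sub>f (u * a)" for c :: complex and a :: free_alg
    proof -
      have "Poly_Mapping.single 0 c * b = b * Poly_Mapping.single 0 c" for b :: free_alg
        by (induction b rule: free_alg_induct) (simp_all add: mult_single algebra_simps)
      then show ?thesis unfolding fscale_def by (metis mult.assoc)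
    qed
    show ?thesis by (subst (1) free_alg_expand) (simp add: sum_distrib_left comm)
  qed
  then show ?thesis by (simp add: act_alg_sum act_alg_fscale)
qed

theorem normal_words_independent:
  assumes q: "Q = complex_of_real q" and n: "0 < n"
    and f: "supp f \<subseteq> normal_words n" "f \<in> sphere_ideal q n"
  shows "f = 0"
proof (rule ccontr)
  assume "f \<noteq> 0"
  have normal_pbw: "normal_words n \<subseteq> pbw_words n" unfolding normal_words_def pbw_words_def by blast
  from f(2) sphere_ideal_central[OF q] obtain g0 where g0: "g0 \<in> carrier (free_ring n)"
    "f - (sphere_element n - 1) * g0 \<in> annihilator" by (auto simp: central_ideal_def)
  note A = ideal_free_ring[OF ideal_annihilator]
  from pbw_spanning[OF ideal_annihilator hom_relators_annihilator[OF q] g0(1)]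
  obtain g where g: "supp g \<subseteq> pbw_words n" "g0 - g \<in> annihilator"
    unfolding reduces_def by blast
  have "sphere_element n - 1 \<in> carrier (free_ring n)"
    by (intro free_ring_closed sphere_element_carrier)
  \<comment> \<open>Replacing g0 by its reduction changes the difference by an element of
    \<open>annihilator\<close>, so g may be taken as a combination of ordered words.\<close>
  then have "(f - (sphere_element n - 1) * g0) + (sphere_element n - 1) * (g0 - g) \<in> annihilator"
    using g0(2) g(2) A(3,4) by blast
  also have "(f - (sphere_element n - 1) * g0) + (sphere_element n - 1) * (g0 - g)
      = f + g - sphere_element n * g" by (simp add: algebra_simps)
  finally have "act_alg (f + g - sphere_element n * g) (point (fst x) (snd x)) = (\<lambda>t f. 0)" for x
    using good_point by (auto simp: annihilator_def)
  then have eq: "eval_at x f + eval_at x g = eval_at x (sphere_element n * g)" for x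
    by (simp add: act_alg_plus act_alg_minus fun_eq_iff)
  \<comment> \<open>M is the highest level occurring in f or in c g. Multiplication by c raises
    levels by 2 (n + 1), so g itself contributes nothing at level M.\<close>
  let ?T = "(\<lambda>w. total_level (leading w)) ` supp f
    \<union> (\<lambda>w. total_level (diagonal_shift (leading w))) ` supp g"
  define M where "M = Max ?T"
  have T: "finite ?T" "?T \<noteq> {}" using \<open>f \<noteq> 0\<close> by auto
  then have "M \<in> ?T" unfolding M_def by (rule Max_in)
  have le: "w \<in> supp f \<Longrightarrow> total_level (leading w) \<le> M"
    "w \<in> supp g \<Longrightarrow> total_level (diagonal_shift (leading w)) \<le> M" for w
    unfolding M_def using T(1) by (auto intro!: Max_ge)
  have less: "total_level (leading w) < M" if "w \<in> supp g" for w
    using le(2)[OF that] by (simp add: total_level_diagonal_shift[OF n])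
  have f_pbw: "w \<in> pbw_words n" if "w \<in> supp f" for w using that f(1) normal_pbw by blast
  have eval_g: "eval_at x g = 0" if "total_level x = M" for x
  proof -
    have "eval_at x (mon w) = 0" if w: "w \<in> supp g" for w
      using eval_at_pbw[of w x] less[OF w] g(1) w \<open>total_level x = M\<close> by auto
    then show ?thesis using eval_at_sum[of 1 g x] by simp
  qed
  have eval_f: "eval_at x f = (\<Sum>w\<in>supp f. Poly_Mapping.lookup f w * eval_at x (mon w))" for x
    using eval_at_sum[of 1 f x] by simp
  show False
  proof (cases "M \<in> (\<lambda>w. total_level (diagonal_shift (leading w))) ` supp g")
    case True
    then obtain w0 where w0: "w0 \<in> supp g" "total_level (diagonal_shift (leading w0)) = M" by auto
    \<comment> \<open>Here c g reaches level M. At this point f vanishes by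
      \<open>leading_normal\<close>, while c g has the nonzero contribution of w0 alone.\<close>
    let ?x = "diagonal_shift (leading w0)"
    have "eval_at ?x (mon w) = 0" if w: "w \<in> supp f" for w
    proof -
      have "?x \<noteq> leading w" using leading_normal[of w w0] w f(1) g(1) w0(1) n by (metis subsetD)
      then show ?thesis using eval_at_pbw[OF f_pbw[OF w], of ?x] le(1)[OF w] w0(2) by simp
    qed
    then have "eval_at ?x f = 0" unfolding eval_f by simp
    then have 0: "eval_at ?x (sphere_element n * g) = 0" using eq[of ?x] eval_g[OF w0(2)] by simp
    have nz: "eval_at ?x (sphere_element n * mon w) \<noteq> 0 \<longleftrightarrow> w = w0" if "w \<in> supp g" for w
      using eval_at_sphere_pbw[of w ?x] le(2)[OF that] w0 that g(1) n inj_leading inj_diagonal_shift by (metis subsetD)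
    have "eval_at ?x (sphere_element n * g)
      = Poly_Mapping.lookup g w0 * eval_at ?x (sphere_element n * mon w0)"
      unfolding eval_at_sum[of "sphere_element n" g ?x] using nz w0(1)
      by (subst sum.remove[of _ w0]) (auto intro!: sum.neutral)
    with 0 nz[OF w0(1)] w0(1) show False by (simp add: in_keys_iff)
  next
    case False
    then obtain w0 where w0: "w0 \<in> supp f" "total_level (leading w0) = M" using \<open>M \<in> ?T\<close> by auto
    \<comment> \<open>Now only f reaches level M, so both g and c g vanish at this point, but f does
      not.\<close>
    let ?x = "leading w0"
    have "eval_at ?x (sphere_element n * mon w) = 0" if w: "w \<in> supp g" for w
    proof -
      have "?x \<noteq> diagonal_shift (leading w)" using False w w0(2) by force
      then show ?thesis using eval_at_sphere_pbw[of w ?x] le(2)[OF w] w g(1) w0(2) n by auto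
    qed
    then have "eval_at ?x (sphere_element n * g) = 0"
      unfolding eval_at_sum[of "sphere_element n" g ?x] by simp
    then have 0: "eval_at ?x f = 0" using eq[of ?x] eval_g[OF w0(2)] by simp
    have nz: "eval_at ?x (mon w) \<noteq> 0 \<longleftrightarrow> w = w0" if "w \<in> supp f" for w
      using eval_at_pbw[OF f_pbw[OF that], of ?x] le(1)[OF that] w0 inj_leading f_pbw that by metis
    have "eval_at ?x f = Poly_Mapping.lookup f w0 * eval_at ?x (mon w0)"
      unfolding eval_f using nz w0(1) by (subst sum.remove[of _ w0]) (auto intro!: sum.neutral)
    with 0 nz[OF w0(1)] w0(1) show False by (simp add: in_keys_iff)
  qed
qed

end

section \<open>The basis\<close>

lemma gen_power: "gen l ^ k = mon (Word (replicate k l))"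
proof (induction k)
  case 0
  show ?case by (simp flip: zero_free_monoid_def)
next
  case (Suc k)
  then show ?case by (simp add: gen_def mult_single plus_free_monoid_def)
qed

lemma prod_list_gen_power:
  "prod_list (map (\<lambda>j. gen (L j) ^ m j) js) = Poly_Mapping.single (Word (concat (map (\<lambda>j. replicate (m j) (L j)) js))) 1"
proof (induction js)
  case Nil
  show ?case by (simp flip: zero_free_monoid_def)
next
  case (Cons j js)
  then show ?case by (simp add: gen_power mult_single plus_free_monoid_def)
qed

text \<open>Setting the exponent of x_n to 0 expresses its absence, so that both families become
  ordered words of the same shape.\<close>

lemma monomial1_eq:
  assumes "0 < n"
  shows "monomial1 n m k s t = Poly_Mapping.single (Word (star_part n m k @ plain_part n (s(n := 0)) t)) 1"
proof -
  have e: "map (\<lambda>j. replicate (if j = n then 0 else s j) (LX j)) (rev [Suc 0..<n]) = map (\<lambda>j. replicate (s j) (LX j)) (rev [Suc 0..<n])"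
    by (intro map_cong) auto
  show ?thesis
    unfolding monomial1_def gen_simps prod_list_gen_power star_part_def plain_part_def
    using assms by (simp add: mult_single plus_free_monoid_def e Suc_le_eq)
qed

lemma monomial2_eq:
  assumes "0 < n"
  shows "monomial2 n m k s t = Poly_Mapping.single (Word (star_part n m (k(n := 0)) @ plain_part n s t)) 1"
proof -
  have e: "map (\<lambda>j. replicate (if j = n then 0 else k j) (LXadj j)) [Suc 0..<n] = map (\<lambda>j. replicate (k j) (LXadj j)) [Suc 0..<n]"
    by (intro map_cong) auto
  show ?thesis
    unfolding monomial2_def gen_simps prod_list_gen_power star_part_def plain_part_def
    using assms by (simp add: mult_single plus_free_monoid_def e Suc_le_eq)
qed

lemma monomials_eq:
  assumes "0 < n"
  shows "monomials n = (\<lambda>w. mon w) ` normal_words n"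
proof (intro subset_antisym subsetI)
  fix x assume "x \<in> monomials n"
  then consider m k s t where "x = monomial1 n m k s t" | m k s t where "x = monomial2 n m k s t"
    by (auto simp: monomials_def)
  then show "x \<in> (\<lambda>w. mon w) ` normal_words n"
  proof cases
    case 1
    have "Word (star_part n m k @ plain_part n (s(n := 0)) t) \<in> normal_words n"
      unfolding normal_words_def by fastforce
    then show ?thesis using 1 monomial1_eq[OF assms] by blast
  next
    case 2
    have "Word (star_part n m (k(n := 0)) @ plain_part n s t) \<in> normal_words n"
      unfolding normal_words_def by fastforce
    then show ?thesis using 2 monomial2_eq[OF assms] by blast
  qed
next
  fix x :: free_alg assume "x \<in> (\<lambda>w. mon w) ` normal_words n"
  then obtain m k s t where x: "x = mon (Word (star_part n m k @ plain_part n s t))"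
    and "k n = 0 \<or> s n = 0" by (auto simp: normal_words_def)
  then consider "s(n := 0) = s" | "k(n := 0) = k" by (metis fun_upd_triv)
  then show "x \<in> monomials n"
  proof cases
    case 1
    then have "x = monomial1 n m k s t" using monomial1_eq[OF assms, of m k s t] by (simp only: x)
    then show ?thesis unfolding monomials_def by blast
  next
    case 2
    then have "x = monomial2 n m k s t" using monomial2_eq[OF assms, of m k s t] by (simp only: x)
    then show ?thesis unfolding monomials_def by blast
  qed
qed

lemma normal_words_in: "normal_words n \<subseteq> words_in n"
  by (auto simp: normal_words_def words_in_def star_part_def plain_part_def letters_in_def split: if_splits)

section \<open>Passage to the quotient\<close>

lemma zero_sphere_alg: "\<zero>\<^bsub>sphere_alg q n\<^esub> = sphere_class q n 0"
proof -
  interpret A: ring "sphere_alg q n" by (rule ring_sphere_alg)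
  have 0: "0 \<in> carrier (free_ring n)" by (rule free_ring_closed)
  then have c: "sphere_class q n 0 \<in> carrier (sphere_alg q n)" by (auto simp: carrier_sphere_alg)
  have "sphere_class q n 0 \<oplus>\<^bsub>sphere_alg q n\<^esub> sphere_class q n 0 = sphere_class q n 0"
    using sphere_alg_class(2)[OF 0 0, of q] by simp
  then show ?thesis using A.add.l_cancel_one[OF c c] by simp
qed

lemma sphere_relators_in_ideal:
  "hom_relators q n \<union> adj ` hom_relators q n \<subseteq> sphere_ideal q n" "sphere_element n - 1 \<in> sphere_ideal q n"
proof -
  interpret R: ring "free_ring n" by (rule ring_free_ring)
  have "sphere_relators q n \<union> adj ` sphere_relators q n \<subseteq> carrier (free_ring n)"
    using sphere_relators_closed by (auto intro: free_ring_closed)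
  from R.genideal_self[OF this] show "hom_relators q n \<union> adj ` hom_relators q n \<subseteq> sphere_ideal q n"
    "sphere_element n - 1 \<in> sphere_ideal q n"
    unfolding sphere_ideal_def[symmetric] by (auto simp: sphere_relators_eq)
qed

text \<open>Linear combinations are indexed by classes; injectivity on W ensures that no two words
  share one summand.\<close>

lemma class_lincomb:
  fixes q :: real and n :: nat
  assumes "finite W" "W \<subseteq> words_in n" "inj_on (\<lambda>w. sphere_class q n (mon w)) W"
  shows "module.lincomb (sphere_alg q n) a ((\<lambda>w. sphere_class q n (mon w)) ` W)
    = sphere_class q n (\<Sum>w\<in>W. a (sphere_class q n (mon w)) \<cdot>\<^sub>f mon w)"
  using assms
proof (induction W rule: finite_induct)
  interpret V: vectorspace class_ring "sphere_alg q n" by (rule vectorspace_sphere_alg)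
  let ?c = "\<lambda>w. sphere_class q n (mon w)"
  {
    case empty
    show ?case by (simp add: V.lincomb_def zero_sphere_alg)
  next
    case (insert w W)
    have carr: "(mon w) \<in> carrier (free_ring n)" if "w \<in> words_in n" for w
      using that by (simp add: carrier_free_ring)
    then have in_V: "?c w \<in> carrier (sphere_alg q n)" if "w \<in> words_in n" for w
      using that by (auto simp: carrier_sphere_alg)
    have w: "w \<in> words_in n" "W \<subseteq> words_in n" using insert by auto
    have notin: "?c w \<notin> ?c ` W" using insert by auto
    have "V.lincomb a (?c ` insert w W) = a (?c w) \<odot>\<^bsub>sphere_alg q n\<^esub> ?c w \<oplus>\<^bsub>sphere_alg q n\<^esub> V.lincomb a (?c ` W)"
      unfolding V.lincomb_def image_insert
      using insert(1) notin w in_V by (intro V.finsum_insert) (auto simp: class_ring_simps intro!: V.smult_closed)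
    also have "V.lincomb a (?c ` W) = sphere_class q n (\<Sum>w\<in>W. a (?c w) \<cdot>\<^sub>f mon w)"
      using insert by auto
    also have "a (?c w) \<odot>\<^bsub>sphere_alg q n\<^esub> ?c w \<oplus>\<^bsub>sphere_alg q n\<^esub> \<dots>
       = sphere_class q n (\<Sum>w\<in>insert w W. a (?c w) \<cdot>\<^sub>f mon w)"
    proof -
      have s: "(\<Sum>w\<in>W. a (?c w) \<cdot>\<^sub>f mon w) \<in> carrier (free_ring n)"
        using w by (intro free_ring_closed carr) auto
      show ?thesis
        using insert(1,2) sphere_alg_class(3)[OF carr[OF w(1)], of q "a (?c w)"]
          sphere_alg_class(2)[OF free_ring_closed(7)[OF carr[OF w(1)]] s, of q] by simp
    qed
    finally show ?case .
  }
qed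

theorem mainTheorem1:
  fixes q :: real and n :: nat
  assumes "q \<in> {0<..<1}" and "n \<in> {1..8}"
  shows "inj_on (sphere_class q n) (monomials n) \<and>
    vectorspace.basis class_ring (sphere_alg q n) (sphere_class q n ` monomials n)"
proof -
  have n: "0 < n" using assms by auto
  interpret S: qsphere "complex_of_real q" n using assms by unfold_locales simp
  interpret V: vectorspace class_ring "sphere_alg q n" by (rule vectorspace_sphere_alg)
  note I = ideal_free_ring[OF ideal_sphere_ideal]
  let ?c = "\<lambda>w. sphere_class q n (mon w)"
  have indep: "f = 0" if "supp f \<subseteq> normal_words n" "f \<in> sphere_ideal q n" for f
    using S.normal_words_independent[OF refl n that] .
  have carr: "(mon w) \<in> carrier (free_ring n)" if "w \<in> normal_words n" for w
    using that normal_words_in by (auto simp: carrier_free_ring)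
  have inj_c: "inj_on ?c (normal_words n)"
  proof (rule inj_onI)
    fix w w' assume w: "w \<in> normal_words n" "w' \<in> normal_words n" "?c w = ?c w'"
    then have "mon w - mon w' \<in> sphere_ideal q n"
      using sphere_class_eq_iff carr by blast
    moreover have "supp (mon w - mon w' :: free_alg) \<subseteq> normal_words n"
      using keys_minus[of "mon w" "mon w'"] w by auto
    ultimately have "(mon w) = mon w'"
      using indep by (metis right_minus_eq)
    then have "supp (mon w) = supp (mon w')" by simp
    then show "w = w'" by simp
  qed
  then have inj: "inj_on (sphere_class q n) (monomials n)"
    unfolding monomials_eq[OF n] by (auto simp: inj_on_def)
  have image: "sphere_class q n ` monomials n = ?c ` normal_words n"
    unfolding monomials_eq[OF n] image_image ..
  have sub: "?c ` normal_words n \<subseteq> carrier (sphere_alg q n)"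
    using carr by (auto simp: carrier_sphere_alg)
  have "V.lin_indpt (?c ` normal_words n)"
  proof
    assume "V.lin_dep (?c ` normal_words n)"
    then obtain A a v where A: "finite A" "A \<subseteq> ?c ` normal_words n" "V.lincomb a A = \<zero>\<^bsub>sphere_alg q n\<^esub>"
      "v \<in> A" "a v \<noteq> \<zero>\<^bsub>class_ring\<^esub>" unfolding V.lin_dep_def by blast
    from A(1,2) obtain W where W: "finite W" "W \<subseteq> normal_words n" "A = ?c ` W"
      by (meson finite_subset_image)
    let ?f = "\<Sum>w\<in>W. a (?c w) \<cdot>\<^sub>f (mon w)"
    have f: "?f \<in> carrier (free_ring n)" using W carr by (intro free_ring_closed) auto
    have "sphere_class q n ?f = sphere_class q n 0"
      using class_lincomb[OF W(1) order_trans[OF W(2) normal_words_in] inj_on_subset[OF inj_c W(2)], of a]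
        A(3) by (simp only: W(3) zero_sphere_alg)
    then have "?f \<in> sphere_ideal q n"
      using sphere_class_eq_iff[OF f free_ring_closed(1)] by simp
    have look: "Poly_Mapping.lookup ?f w = (if w \<in> W then a (?c w) else 0)" for w
      using W(1) by (simp add: lookup_sum lookup_fscale lookup_single when_def if_distrib cong: if_cong)
    then have "supp ?f \<subseteq> normal_words n"
      using W(2) by (auto simp: in_keys_iff split: if_splits)
    then have "?f = 0" using indep \<open>?f \<in> sphere_ideal q n\<close> by blast
    moreover obtain w where "w \<in> W" "v = ?c w" using A(4) W(3) by auto
    ultimately have "a v = 0" using look[of w] by simp
    then show False using A(5) by (simp add: class_ring_simps)
  qed
  moreover have "V.span (?c ` normal_words n) = carrier (sphere_alg q n)"
  proof (rule subset_antisym)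
    show "V.span (?c ` normal_words n) \<subseteq> carrier (sphere_alg q n)"
      by (rule V.span_is_subset2[OF sub])
    show "carrier (sphere_alg q n) \<subseteq> V.span (?c ` normal_words n)"
    proof
      fix x assume "x \<in> carrier (sphere_alg q n)"
      then obtain a where a: "a \<in> carrier (free_ring n)" "x = sphere_class q n a" by (auto simp: carrier_sphere_alg)
      from normal_spanning[OF ideal_sphere_ideal sphere_relators_in_ideal(1) a(1) sphere_relators_in_ideal(2) n]
      obtain f where f: "supp f \<subseteq> normal_words n" "a - f \<in> sphere_ideal q n"
        unfolding reduces_def by blast
      let ?W = "supp f"
      \<comment> \<open>Coefficients must be a function of the class, so those of f are transported
        along the inverse of the injective class map.\<close>
      define b where "b v = Poly_Mapping.lookup f (inv_into ?W ?c v)" for v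
      have inj_W: "inj_on ?c ?W" using inj_on_subset[OF inj_c f(1)] .
      have "b (?c w) = Poly_Mapping.lookup f w" if "w \<in> ?W" for w
        unfolding b_def using inv_into_f_f[OF inj_W that] by simp
      then have "(\<Sum>w\<in>?W. b (?c w) \<cdot>\<^sub>f (mon w)) = f"
        by (subst (2) free_alg_expand) (auto intro: sum.cong)
      then have "V.lincomb b (?c ` ?W) = sphere_class q n f"
        using class_lincomb[OF finite_keys order_trans[OF f(1) normal_words_in] inj_W, of b] by simp
      also have "f \<in> carrier (free_ring n)" using f(1) normal_words_in by (auto simp: carrier_free_ring)
      then have "sphere_class q n f = x"
        using sphere_class_eq_iff[OF a(1)] f(2) a(2) by metis
      finally have "x = V.lincomb b (?c ` ?W)" by simp
      moreover have "?c ` ?W \<subseteq> ?c ` normal_words n" using f(1) by blast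
      moreover have "finite (?c ` ?W)" "b \<in> ?c ` ?W \<rightarrow> carrier class_ring"
        by (simp_all add: class_ring_simps)
      ultimately show "x \<in> V.span (?c ` normal_words n)"
        unfolding V.span_def by blast
    qed
  qed
  ultimately have "V.basis (?c ` normal_words n)" unfolding V.basis_def using sub by blast
  then show ?thesis using inj by (simp only: image simp_thms)
qed

end
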